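(* Let $p \in (0,1)$ be fixed. There exists a constant $c = c(p) > 0$ such that $$\mathbb{P}\left[ a_{-}(G(n,p)) \geq c \right] \to 1 \quad \text{as } n \to \infty.$$ Moreover, one can take $c = 1/8 - \eta$, for any constant $\eta > 0$.
   Context: $G(n,p)$ is the Erdős–Rényi random graph on $n$ vertices in which each pair of vertices is joined by an edge independently with probability $p$. For a finite simple graph $G=(V,E)$ with $n$ vertices, adjacency matrix $A$ and diagonal degree matrix $D$, the normalized Laplacian is $\mathcal{L}_G = D^{-1/2}(D-A)D^{-1/2}$, where, by convention, the diagonal entry of $D^{-1/2}$ at a vertex of degree $0$ is $0$. Its eigenvalues are listed in increasing order $0=\lambda_1(\mathcal{L}_G) \le \lambda_2(\mathcal{L}_G) \le \dots \le \lambda_n(\mathcal{L}_G)$, and $\lambda_2(\mathcal{L}_G)$ is called the spectral gap of $G$. A non-edge of $G$ is an unordered pair $\{u,v\}$ of distinct vertices with $\{u,v\}\notin E$. The quantity $a_{-}(G)$ is the proportion of non-edges $\{u,v\}$ of $G$ for which adding the edge $\{u,v\}$ decreases the spectral gap, i.e. $\lambda_2(\mathcal{L}_{G_+}) < \lambda_2(\mathcal{L}_G)$ with $G_+ = (V, E\cup\{\{u,v\}\})$. *)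

theory Defs
  imports
    "HOL-Probability.Product_PMF"
    "Jordan_Normal_Form.Char_Poly"
begin

text \<open>
  A simple graph with \<open>n\<close> vertices has vertex set \<open>{..<n}\<close> and is given by its edge set \<open>E\<close>,
  a subset of \<open>vertex_pairs n\<close>.
\<close>

definition vertex_pairs :: "nat \<Rightarrow> nat set set" where
  "vertex_pairs n = {e. e \<subseteq> {..<n} \<and> card e = 2}"

definition non_edges :: "nat \<Rightarrow> nat set set \<Rightarrow> nat set set" where
  "non_edges n E = vertex_pairs n - E"

definition vertex_degree :: "nat \<Rightarrow> nat set set \<Rightarrow> nat \<Rightarrow> nat" where
  "vertex_degree n E v = card {u \<in> {..<n}. {u, v} \<in> E}"

definition adjacency_matrix :: "nat \<Rightarrow> nat set set \<Rightarrow> real mat" where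
  "adjacency_matrix n E = mat n n (\<lambda>(i, j). if {i, j} \<in> E then 1 else 0)"

definition degree_matrix :: "nat \<Rightarrow> nat set set \<Rightarrow> real mat" where
  "degree_matrix n E = mat n n (\<lambda>(i, j). if i = j then real (vertex_degree n E i) else 0)"

definition inv_sqrt_degree_matrix :: "nat \<Rightarrow> nat set set \<Rightarrow> real mat" where
  "inv_sqrt_degree_matrix n E =
     mat n n (\<lambda>(i, j). if i = j \<and> vertex_degree n E i \<noteq> 0 then 1 / sqrt (real (vertex_degree n E i)) else 0)"

definition normalized_laplacian :: "nat \<Rightarrow> nat set set \<Rightarrow> real mat" where
  "normalized_laplacian n E =
     inv_sqrt_degree_matrix n E * (degree_matrix n E - adjacency_matrix n E)
       * inv_sqrt_degree_matrix n E"

text \<open>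
  \<open>ordered_eigenvalue M k\<close> is the \<open>k\<close>-th smallest eigenvalue (\<open>k = 1, 2, \<dots>\<close>), counted with
  multiplicity.  It is meant for real symmetric \<open>M\<close>, whose characteristic polynomial has all
  its roots in the reals, and for \<open>k\<close> at most the dimension.
\<close>

definition ordered_eigenvalue :: "real mat \<Rightarrow> nat \<Rightarrow> real" where
  "ordered_eigenvalue M k = sorted_list_of_multiset (proots (char_poly M)) ! (k - 1)"

definition spectral_gap :: "nat \<Rightarrow> nat set set \<Rightarrow> real" where
  "spectral_gap n E = ordered_eigenvalue (normalized_laplacian n E) 2"

text \<open>For a graph without non-edges the proportion is \<open>0 / 0 = 0\<close>.\<close>

definition gap_decrease_proportion :: "nat \<Rightarrow> nat set set \<Rightarrow> real" where
  "gap_decrease_proportion n E =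
     real (card {e \<in> non_edges n E. spectral_gap n (insert e E) < spectral_gap n E})
       / real (card (non_edges n E))"

definition erdos_renyi :: "nat \<Rightarrow> real \<Rightarrow> nat set set pmf" where
  "erdos_renyi n p =
     map_pmf (\<lambda>f. {e \<in> vertex_pairs n. f e})
       (Pi_pmf (vertex_pairs n) False (\<lambda>_. bernoulli_pmf p))"

end

theory Submission
  imports
    Defs
    "HOL-Probability.Probability"
    "HOL-Real_Asymp.Real_Asymp"
    "Jordan_Normal_Form.Schur_Decomposition"
begin

text \<open>
  Let \<open>g = D\<^sup>-\<^sup>1\<^sup>/\<^sup>2 f\<close> for a second eigenvector \<open>f\<close>, normalised to \<open>|g| = 1\<close>, so that
  \<open>A g = (1 - \<lambda>) D g\<close> with \<open>\<lambda> = \<lambda>\<^sub>2\<close>.  Using \<open>g\<close>, recentred, as a test vector for the graph with the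
  extra edge \<open>{u, v}\<close> shows that the gap decreases as soon as \<open>2 g\<^sub>u g\<^sub>v\<close> exceeds essentially
  \<open>(1 - \<lambda>) (g\<^sub>u\<^sup>2 + g\<^sub>v\<^sup>2)\<close>.  Since \<open>A - p J\<close> has norm \<open>O(\<surd>n)\<close>, \<open>1 - \<lambda>\<close> is \<open>O(1 / \<surd>n)\<close>, and it suffices
  that \<open>g\<^sub>u\<close> and \<open>g\<^sub>v\<close> have the same sign and lie in absolute value between \<open>\<omega> / n\<close> and \<open>M / \<surd>n\<close>
  for suitable constants.  All but \<open>n / M\<^sup>2\<close> entries satisfy the upper bound.  If more than
  \<open>(1/2 + \<eta>) n\<close> entries violated the lower bound, the block of \<open>A\<close> with these rows and the remaining
  columns would map a vector of norm almost 1 to within \<open>O(1)\<close> of a constant vector; as this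
  block has many more rows than columns, small-ball estimates and a net argument exclude this.
  Hence there are \<open>(1/2 - 2 \<eta>) n\<close> good vertices, of which at least half of the pairs have equal signs,
  and \<open>(1/2)\<^sup>2 / 2 = 1/8\<close>.
\<close>

section \<open>Spectral decomposition of real symmetric matrices\<close>

no_notation Finite_Cartesian_Product.vec_nth (infixl "$" 90)

text \<open>The eigenvector depends on the graph, so an estimate for one fixed vector is useless:
  each random estimate is made uniform over all vectors by a union bound over lattice points, and
  the rest is deterministic. Symmetry of A makes its rows dependent; independence returns when only
  columns in a set S and rows outside S are kept, since these rows use disjoint sets of edges. If
  |S| <= a n and the mesh is t, the lattice costs (27/t)^(a n) while the rows gain (D t)^((1 - a) n)
  up to constants, so a small t wins once a < 1/2. This is where the 1/2 comes from. A gain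
  proportional to t needs mass on coordinates of size O(1/sqrt n), because the small-ball bound has
  an error of fourth order in the coordinate size. That g has such mass is again a nonconcentration
  statement, proved separately with a very small: the gain per row is then only a constant below 1,
  but there are few supports.\<close>

lemma map_poly_of_real_prod_linear:
  "map_poly (of_real :: real \<Rightarrow> complex) (\<Prod>e\<leftarrow>es. [:- e, 1:]) = (\<Prod>e\<leftarrow>es. [:- of_real e, 1:])"
proof -
  interpret h: map_poly_inj_comm_ring_hom "of_real :: real \<Rightarrow> complex" ..
  show ?thesis
    by (induction es) (simp_all add: h.hom_mult del: mult_pCons_left)
qed

text \<open>The Hermitian form of an eigenvector equals \<open>a\<close> times its squared norm, and
  for a real symmetric matrix this form is its own conjugate.\<close>

lemma complex_eigenvalue_of_real_symmetric:
  fixes A :: "real mat"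
  assumes A: "A \<in> carrier_mat n n"
    and sym: "\<And>i j. i < n \<Longrightarrow> j < n \<Longrightarrow> A $$ (i, j) = A $$ (j, i)"
    and ev: "eigenvalue (map_mat complex_of_real A) a"
  shows "a = of_real (Re a)"
proof -
  obtain v where v: "v \<in> carrier_vec n" "v \<noteq> 0\<^sub>v n" "map_mat complex_of_real A *\<^sub>v v = a \<cdot>\<^sub>v v"
    using ev A by (auto simp: eigenvalue_def eigenvector_def)
  have row: "(\<Sum>j<n. of_real (A $$ (i, j)) * v $ j) = a * v $ i" if "i < n" for i
  proof -
    have "(map_mat complex_of_real A *\<^sub>v v) $ i = a * v $ i" using v that by simp
    moreover have "(map_mat complex_of_real A *\<^sub>v v) $ i = (\<Sum>j<n. of_real (A $$ (i, j)) * v $ j)"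
      using A v(1) that by (auto simp: scalar_prod_def lessThan_atLeast0 intro!: sum.cong)
    ultimately show ?thesis by simp
  qed
  define q where "q = (\<Sum>i<n. \<Sum>j<n. cnj (v $ i) * of_real (A $$ (i, j)) * v $ j)"
  define s where "s = (\<Sum>i<n. (cmod (v $ i))\<^sup>2)"
  have "q = (\<Sum>i<n. cnj (v $ i) * (a * v $ i))"
    unfolding q_def by (intro sum.cong refl) (simp add: row[symmetric] sum_distrib_left mult.assoc)
  also have "\<dots> = a * of_real s"
    unfolding s_def of_real_sum sum_distrib_left
    by (intro sum.cong refl) (simp add: complex_norm_square algebra_simps del: of_real_power)
  finally have q: "q = a * of_real s" .
  have "cnj q = (\<Sum>i<n. \<Sum>j<n. v $ i * of_real (A $$ (i, j)) * cnj (v $ j))"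
    unfolding q_def by simp
  also have "\<dots> = (\<Sum>j<n. \<Sum>i<n. v $ i * of_real (A $$ (i, j)) * cnj (v $ j))"
    by (rule sum.swap)
  also have "\<dots> = q"
    unfolding q_def by (intro sum.cong refl) (auto simp: sym mult_ac)
  finally have "cnj q = q" .
  moreover have "s \<noteq> 0"
  proof
    assume "s = 0"
    then have "\<forall>i<n. v $ i = 0" unfolding s_def by (subst (asm) sum_nonneg_eq_0_iff) auto
    then have "v = 0\<^sub>v n" using v(1) by auto
    then show False using v(2) by simp
  qed
  ultimately have "cnj a = a" using q by simp
  then show ?thesis by (metis Reals_cnj_iff of_real_Re)
qed

text \<open>Over the complex numbers the polynomial splits, and all roots are real; hence the
  factorisation is the image of a real one, and the embedding of real polynomials is
  injective.\<close>

lemma real_symmetric_char_poly_splits: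
  fixes A :: "real mat"
  assumes A: "A \<in> carrier_mat n n"
    and sym: "\<And>i j. i < n \<Longrightarrow> j < n \<Longrightarrow> A $$ (i, j) = A $$ (j, i)"
  shows "\<exists>es. char_poly A = (\<Prod>e\<leftarrow>es. [:- e, 1:])"
proof -
  interpret h: map_poly_inj_comm_ring_hom "of_real :: real \<Rightarrow> complex" ..
  let ?B = "map_mat complex_of_real A"
  have B: "?B \<in> carrier_mat n n" using A by simp
  obtain as where as: "char_poly ?B = (\<Prod>a\<leftarrow>as. [:- a, 1:])"
    using char_poly_factorized[OF B] by auto
  have "a = of_real (Re a)" if "a \<in> set as" for a
  proof (rule complex_eigenvalue_of_real_symmetric[OF A sym])
    show "eigenvalue ?B a"
      unfolding eigenvalue_root_char_poly[OF B] as poly_prod_list prod_list_zero_iff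
      using that by (auto simp: image_iff intro!: bexI[of _ a])
  qed auto
  then have "map (\<lambda>a. of_real (Re a)) as = as" by (intro map_idI) metis
  then have "as = map of_real (map Re as)" by (simp add: o_def)
  then have "map_poly complex_of_real (char_poly A) = (\<Prod>a\<leftarrow>map of_real (map Re as). [:- a, 1:])"
    using as of_real_hom.char_poly_hom[OF A] by metis
  also have "\<dots> = map_poly of_real (\<Prod>e\<leftarrow>map Re as. [:- e, 1:])"
    unfolding map_poly_of_real_prod_linear by (simp add: o_def)
  finally have "char_poly A = (\<Prod>e\<leftarrow>map Re as. [:- e, 1:])"
    by (simp only: h.eq_iff)
  then show ?thesis by blast
qed

text \<open>Gram-Schmidt applied to a basis that starts with \<open>v\<close> keeps the direction of
  its first vector; lengths are normalised afterwards. It supplies the orthogonal change of basis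
  that splits off one eigenvector.\<close>

lemma orthonormal_completion:
  fixes v :: "real vec"
  assumes v: "v \<in> carrier_vec n" "v \<noteq> 0\<^sub>v n"
  shows "\<exists>W \<in> carrier_mat n n. transpose_mat W * W = 1\<^sub>m n \<and>
    (\<exists>c. col W 0 = c \<cdot>\<^sub>v v)"
proof -
  interpret cof_vec_space n "TYPE(real)" .
  define b where "b = basis_completion v"
  define ws where "ws = gram_schmidt n b"
  note b = basis_completion[OF v, folded b_def]
  have n0: "n > 0" using v by (cases n) auto
  obtain vs where bv: "b = v # vs" using b(6,7) n0 by (cases b) auto
  note ws = gram_schmidt_result[OF b(2,4,5) ws_def]
  have len: "length ws = n" using ws(4) b(6) by simp
  have hd: "hd ws = v" unfolding ws_def bv using v(1) by (rule gram_schmidt_hd)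
  define f where "f = (\<lambda>w::real vec. (1 / sqrt (w \<bullet> w)) \<cdot>\<^sub>v w)"
  define W where "W = mat_of_cols n (map f ws)"
  have W: "W \<in> carrier_mat n n" unfolding W_def using len by (metis length_map mat_of_cols_carrier(1))
  have carr: "ws ! i \<in> carrier_vec n" if "i < n" for i using ws(3) len that by auto
  have colW: "col W i = f (ws ! i)" if "i < n" for i
    unfolding W_def using len that carr[OF that] by (simp add: f_def)
  \<comment> \<open>Gram-Schmidt yields orthogonality for the conjugated product, which over the
    reals is the ordinary one.\<close>
  have conj: "conjugate (w :: real vec) = w" for w by (intro eq_vecI) (auto simp: conjugate_real_def)
  have orth: "ws ! i \<bullet> ws ! j = 0 \<longleftrightarrow> i \<noteq> j" if "i < n" "j < n" for i j
    using corthogonalD[OF ws(2), of i j] that len by (simp add: conj)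
  have "transpose_mat W * W = 1\<^sub>m n"
  proof (rule eq_matI)
    fix i j assume "i < dim_row (1\<^sub>m n :: real mat)" "j < dim_col (1\<^sub>m n :: real mat)"
    then have ij: "i < n" "j < n" by auto
    have "(transpose_mat W * W) $$ (i, j) = f (ws ! i) \<bullet> f (ws ! j)"
      using W ij by (simp add: colW)
    also have "\<dots> = (ws ! i \<bullet> ws ! j) / (sqrt (ws ! i \<bullet> ws ! i) * sqrt (ws ! j \<bullet> ws ! j))"
      unfolding f_def using carr[OF ij(1)] carr[OF ij(2)] by simp
    also have "\<dots> = (1\<^sub>m n :: real mat) $$ (i, j)"
    proof (cases "i = j")
      case True
      have "ws ! i \<bullet> ws ! i \<ge> 0" unfolding scalar_prod_def by (intro sum_nonneg) auto
      moreover have "ws ! i \<bullet> ws ! i \<noteq> 0" using orth[of i i] ij by simp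
      ultimately show ?thesis using True ij by simp
    next
      case False
      then show ?thesis using orth[of i j] ij by simp
    qed
    finally show "(transpose_mat W * W) $$ (i, j) = (1\<^sub>m n :: real mat) $$ (i, j)" .
  qed (use W in auto)
  moreover have "col W 0 = (1 / sqrt (v \<bullet> v)) \<cdot>\<^sub>v v"
    using colW[OF n0] hd n0 len by (cases ws) (auto simp: f_def)
  ultimately show ?thesis using W by blast
qed

text \<open>Induction on the list of roots. In an orthonormal basis starting with an eigenvector for
  \<open>e\<close>, the first column vanishes below its first entry by the eigenvalue equation and
  the first row by symmetry; the remaining block is symmetric with the remaining roots. The order of
  \<open>es\<close> is preserved, so the caller may sort it.\<close>

lemma real_symmetric_diagonalization:
  fixes A :: "real mat"
  assumes "A \<in> carrier_mat n n" and "transpose_mat A = A"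
    and "char_poly A = (\<Prod>e\<leftarrow>es. [:- e, 1:])"
  shows "\<exists>U \<in> carrier_mat n n. transpose_mat U * U = 1\<^sub>m n \<and>
    transpose_mat U * A * U = mat n n (\<lambda>(i, j). if i = j then es ! i else 0)"
  using assms
proof (induction es arbitrary: n A)
  case Nil
  then have "n = 0" using degree_monic_char_poly[of A n] by auto
  then show ?case using Nil by (intro bexI[of _ "1\<^sub>m 0"]) auto
next
  case (Cons e es)
  note A = Cons.prems(1) and sym = Cons.prems(2)
  have cp: "char_poly A = [:- e, 1:] * (\<Prod>e\<leftarrow>es. [:- e, 1:])" using Cons.prems(3) by simp
  have "eigenvalue A e" unfolding eigenvalue_root_char_poly[OF A] cp by simp
  then obtain v where v: "v \<in> carrier_vec n" "v \<noteq> 0\<^sub>v n" and Av: "A *\<^sub>v v = e \<cdot>\<^sub>v v"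
    using A by (auto simp: eigenvalue_def eigenvector_def)
  obtain m where n: "n = Suc m" using v by (cases n) auto
  obtain W c where W: "W \<in> carrier_mat n n" and WW: "transpose_mat W * W = 1\<^sub>m n"
    and c: "col W 0 = c \<cdot>\<^sub>v v"
    using orthonormal_completion[OF v] by blast
  let ?Wt = "transpose_mat W"
  have Wt: "?Wt \<in> carrier_mat n n" using W by simp
  have WW': "W * ?Wt = 1\<^sub>m n" by (rule mat_mult_left_right_inverse[OF Wt W WW])
  define B where "B = ?Wt * A * W"
  have B: "B \<in> carrier_mat n n" unfolding B_def using A W by simp
  have symB: "transpose_mat B = B"
    unfolding B_def using A W Wt sym
    by (simp add: transpose_mult[of _ n n _ n] assoc_mult_mat[of _ n n _ n _ n])
  have Bsym: "B $$ (i, j) = B $$ (j, i)" if "i < n" "j < n" for i j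
    using symB B that by (metis carrier_matD index_transpose_mat(1))
  have "W * (?Wt * A * W) * ?Wt = (W * ?Wt) * A * (W * ?Wt)"
    using A W Wt by (simp add: assoc_mult_mat[of _ n n _ n _ n])
  then have AB: "A = W * B * ?Wt" unfolding B_def WW' using A by simp
  have "similar_mat A B"
    unfolding similar_mat_def using similar_mat_witI[OF WW' WW AB A B W Wt] by blast
  then have cpB: "char_poly B = char_poly A" using char_poly_similar by metis
  have Acol: "A *\<^sub>v col W 0 = e \<cdot>\<^sub>v col W 0"
    unfolding c using A v Av by (simp add: mult_mat_vec[of _ n n] smult_smult_assoc mult.commute)
  have B0: "B $$ (i, 0) = (if i = 0 then e else 0)" if i: "i < n" for i
  proof -
    have "B $$ (i, 0) = row ?Wt i \<bullet> col (A * W) 0"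
      unfolding B_def using A W Wt i n by (simp add: assoc_mult_mat[of _ n n _ n _ n])
    also have "col (A * W) 0 = e \<cdot>\<^sub>v col W 0" using Acol col_mult2[OF A W] n by simp
    also have "row ?Wt i \<bullet> (e \<cdot>\<^sub>v col W 0) = e * ((?Wt * W) $$ (i, 0))"
      using W i n by (simp add: scalar_prod_smult_distrib[of _ n])
    also have "\<dots> = (if i = 0 then e else 0)" unfolding WW using i n by simp
    finally show ?thesis .
  qed
  have B0': "B $$ (0, j) = (if j = 0 then e else 0)" if "j < n" for j
    using B0[OF that] Bsym[of 0 j] that by auto
  define C where "C = mat m m (\<lambda>(i, j). B $$ (Suc i, Suc j))"
  have C: "C \<in> carrier_mat m m" unfolding C_def by simp
  let ?E = "mat 1 1 (\<lambda>_. e)"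
  have E: "?E \<in> carrier_mat 1 1" by simp
  have Bb: "B = four_block_mat ?E (0\<^sub>m 1 m) (0\<^sub>m m 1) C"
  proof (rule eq_matI)
    fix i j assume "i < dim_row (four_block_mat ?E (0\<^sub>m 1 m) (0\<^sub>m m 1) C)"
      "j < dim_col (four_block_mat ?E (0\<^sub>m 1 m) (0\<^sub>m m 1) C)"
    then have "i < n" "j < n" using C n by auto
    then show "B $$ (i, j) = four_block_mat ?E (0\<^sub>m 1 m) (0\<^sub>m m 1) C $$ (i, j)"
      using B0 B0' n C by (cases i; cases j) (auto simp: C_def)
  qed (use B C n in auto)
  have "char_poly B = char_poly ?E * char_poly C"
    unfolding Bb by (rule char_poly_four_block_zeros_col[OF E _ C]) simp
  moreover have "char_poly ?E = [:- e, 1:]" by (simp add: char_poly_defs det_def sign_def)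
  ultimately have cpC: "char_poly C = (\<Prod>e\<leftarrow>es. [:- e, 1:])"
    using cpB cp by (metis mult_cancel_left pCons_eq_0_iff zero_neq_one)
  have symC: "transpose_mat C = C"
    by (rule eq_matI) (auto simp: C_def n intro!: Bsym)
  obtain V where V: "V \<in> carrier_mat m m" and VV: "transpose_mat V * V = 1\<^sub>m m"
    and VC: "transpose_mat V * C * V = mat m m (\<lambda>(i, j). if i = j then es ! i else 0)"
    using Cons.IH[OF C symC cpC] by blast
  define P where "P = four_block_mat (1\<^sub>m 1) (0\<^sub>m 1 m) (0\<^sub>m m 1) V"
  have P: "P \<in> carrier_mat n n" unfolding P_def n using V
    by (metis One_nat_def four_block_carrier_mat one_carrier_mat plus_1_eq_Suc)
  have Pt: "transpose_mat P = four_block_mat (1\<^sub>m 1) (0\<^sub>m 1 m) (0\<^sub>m m 1) (transpose_mat V)"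
    unfolding P_def using V by (subst transpose_four_block_mat[of _ 1 1 _ m _ m]) auto
  have Vt: "transpose_mat V \<in> carrier_mat m m" using V by simp
  have PP: "transpose_mat P * P = 1\<^sub>m n"
    unfolding Pt unfolding P_def using V Vt VV
    by (subst mult_four_block_mat[of _ 1 1 _ m _ m _ _ 1 _ m]) (auto simp: n)
  have PBP: "transpose_mat P * B * P = four_block_mat ?E (0\<^sub>m 1 m) (0\<^sub>m m 1) (transpose_mat V * C * V)"
  proof -
    have "transpose_mat P * B = four_block_mat ?E (0\<^sub>m 1 m) (0\<^sub>m m 1) (transpose_mat V * C)"
      unfolding Pt Bb using V Vt C E
      by (subst mult_four_block_mat[of _ 1 1 _ m _ m _ _ 1 _ m]) auto
    then show ?thesis
      unfolding P_def using V Vt C E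
      by (simp, subst mult_four_block_mat[of _ 1 1 _ m _ m _ _ 1 _ m]) auto
  qed
  let ?U = "W * P"
  have U: "?U \<in> carrier_mat n n" using W P by simp
  have Ut: "transpose_mat ?U = transpose_mat P * ?Wt" using W P by (rule transpose_mult)
  have Ptc: "transpose_mat P \<in> carrier_mat n n" using P by simp
  have "transpose_mat ?U * ?U = transpose_mat P * (?Wt * W) * P"
    unfolding Ut using W Wt P Ptc by (simp add: assoc_mult_mat[of _ n n _ n _ n])
  then have "transpose_mat ?U * ?U = 1\<^sub>m n" unfolding WW using PP Ptc by simp
  moreover have "transpose_mat ?U * A * ?U = transpose_mat P * B * P"
    unfolding Ut B_def using W Wt P Ptc A by (simp add: assoc_mult_mat[of _ n n _ n _ n])
  moreover have "transpose_mat P * B * P = mat n n (\<lambda>(i, j). if i = j then (e # es) ! i else 0)"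
    unfolding PBP VC
  proof (rule eq_matI)
    fix i j assume "i < dim_row (mat n n (\<lambda>(i, j). if i = j then (e # es) ! i else 0))"
      "j < dim_col (mat n n (\<lambda>(i, j). if i = j then (e # es) ! i else 0))"
    then show "four_block_mat ?E (0\<^sub>m 1 m) (0\<^sub>m m 1) (mat m m (\<lambda>(i, j). if i = j then es ! i else 0)) $$ (i, j)
      = mat n n (\<lambda>(i, j). if i = j then (e # es) ! i else 0) $$ (i, j)"
      by (cases i; cases j) (auto simp: n)
  qed (auto simp: n)
  ultimately show ?case using U by metis
qed

text \<open>Diagonalisation along the sorted list of roots. The result is phrased with functions and
  sums, so that no matrix algebra is needed later; \<open>e\<close> counts from 0, eigenvalues from
  1. Orthonormality is stated for rows and for columns because expansions in the eigenbasis use the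
  latter.\<close>

lemma ordered_spectral_decomposition:
  fixes A :: "real mat"
  assumes A: "A \<in> carrier_mat n n"
    and tA: "transpose_mat A = A"
  shows "\<exists>(u :: nat \<Rightarrow> nat \<Rightarrow> real) e.
    (\<forall>k l. k \<le> l \<longrightarrow> l < n \<longrightarrow> e k \<le> e l) \<and>
    (\<forall>k<n. ordered_eigenvalue A (Suc k) = e k) \<and>
    (\<forall>k<n. \<forall>l<n. (\<Sum>i<n. u k i * u l i) = (if k = l then 1 else 0)) \<and>
    (\<forall>i<n. \<forall>j<n. (\<Sum>k<n. u k i * u k j) = (if i = j then 1 else 0)) \<and>
    (\<forall>k<n. \<forall>i<n. (\<Sum>j<n. A $$ (i, j) * u k j) = e k * u k i)"
proof -
  have sym: "A $$ (i, j) = A $$ (j, i)" if "i < n" "j < n" for i j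
    using tA A that by (metis carrier_matD index_transpose_mat(1))
  obtain es0 where es0: "char_poly A = (\<Prod>e\<leftarrow>es0. [:- e, 1:])"
    using real_symmetric_char_poly_splits[OF A sym] by blast
  define es where "es = sort es0"
  have "(\<Prod>e\<leftarrow>es. [:- e, 1:]) = (\<Prod>e\<leftarrow>es0. [:- e, 1:])"
    unfolding es_def prod_mset_prod_list[symmetric] mset_map by simp
  then have cp: "char_poly A = (\<Prod>e\<leftarrow>es. [:- e, 1:])" using es0 by simp
  obtain U where U: "U \<in> carrier_mat n n" and UU: "transpose_mat U * U = 1\<^sub>m n"
    and D: "transpose_mat U * A * U = mat n n (\<lambda>(i, j). if i = j then es ! i else 0)"
    using real_symmetric_diagonalization[OF A tA cp] by blast
  have "degree (\<Prod>e\<leftarrow>xs. [:- e, 1:]) = length xs" for xs :: "real list"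
  proof (induction xs)
    case (Cons x xs)
    have "(\<Prod>e\<leftarrow>xs. [:- e, 1:]) \<noteq> 0" by (auto simp: prod_list_zero_iff)
    then have "degree ([:- x, 1:] * (\<Prod>e\<leftarrow>xs. [:- e, 1:])) = Suc (length xs)"
      using Cons by (subst degree_mult_eq) auto
    then show ?case by simp
  qed simp
  then have len: "length es = n" using cp degree_monic_char_poly[OF A] by metis
  have "proots (\<Prod>e\<leftarrow>xs. [:- e, 1:]) = mset xs" for xs :: "real list"
  proof (induction xs)
    case (Cons x xs)
    have "(\<Prod>e\<leftarrow>xs. [:- e, 1:]) \<noteq> 0" by (auto simp: prod_list_zero_iff)
    then have "proots ([:- x, 1:] * (\<Prod>e\<leftarrow>xs. [:- e, 1:])) = {#x#} + mset xs"
      using Cons by (subst proots_mult) auto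
    then show ?case by simp
  qed simp
  then have oe: "ordered_eigenvalue A (Suc k) = es ! k" for k
    unfolding ordered_eigenvalue_def cp by (simp add: es_def)
  have srt: "es ! k \<le> es ! l" if "k \<le> l" "l < n" for k l
    using that len by (intro sorted_nth_mono) (auto simp: es_def)
  have Ut: "transpose_mat U \<in> carrier_mat n n" using U by simp
  have UU': "U * transpose_mat U = 1\<^sub>m n" by (rule mat_mult_left_right_inverse[OF Ut U UU])
  have o1: "(\<Sum>i<n. U $$ (i, k) * U $$ (i, l)) = (if k = l then 1 else 0)" if "k < n" "l < n" for k l
  proof -
    have "(transpose_mat U * U) $$ (k, l) = (\<Sum>i<n. U $$ (i, k) * U $$ (i, l))"
      using U that by (auto simp: scalar_prod_def lessThan_atLeast0 intro!: sum.cong)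
    then show ?thesis unfolding UU using that by simp
  qed
  have o2: "(\<Sum>k<n. U $$ (i, k) * U $$ (j, k)) = (if i = j then 1 else 0)" if "i < n" "j < n" for i j
  proof -
    have "(U * transpose_mat U) $$ (i, j) = (\<Sum>k<n. U $$ (i, k) * U $$ (j, k))"
      using U that by (auto simp: scalar_prod_def lessThan_atLeast0 intro!: sum.cong)
    then show ?thesis unfolding UU' using that by simp
  qed
  have "A * U = (U * transpose_mat U) * (A * U)" unfolding UU' using A U by simp
  also have "\<dots> = U * (transpose_mat U * A * U)"
    using A U Ut by (simp add: assoc_mult_mat[of _ n n _ n _ n])
  finally have AU: "A * U = U * (transpose_mat U * A * U)" .
  have ev: "(\<Sum>j<n. A $$ (i, j) * U $$ (j, k)) = es ! k * U $$ (i, k)" if "i < n" "k < n" for i k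
  proof -
    have "(A * U) $$ (i, k) = (\<Sum>j<n. A $$ (i, j) * U $$ (j, k))"
      using A U that by (auto simp: scalar_prod_def lessThan_atLeast0 intro!: sum.cong)
    moreover have "(U * mat n n (\<lambda>(i, j). if i = j then es ! i else 0)) $$ (i, k)
        = (\<Sum>l<n. U $$ (i, l) * (if l = k then es ! l else 0))"
      using U that by (auto simp: scalar_prod_def lessThan_atLeast0 intro!: sum.cong)
    moreover have "\<dots> = es ! k * U $$ (i, k)"
      using that by (subst sum.remove[of _ k]) auto
    ultimately show ?thesis using AU D by metis
  qed
  show ?thesis
    by (rule exI[of _ "\<lambda>k i. U $$ (i, k)"], rule exI[of _ "(!) es"])
      (use srt oe o1 o2 ev in auto)
qed

text \<open>The min-max principle relative to a known kernel vector \<open>w\<close>. The difficulty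
  is that \<open>w\<close> need not be parallel to \<open>u 0\<close> when 0 is a multiple
  eigenvalue; but then \<open>e 1 = 0\<close>, so the inequality is just positive semidefiniteness
  and an eigenvector can be sought in the span of \<open>u 0\<close> and \<open>u 1\<close>.\<close>

lemma second_eigenvalue_orthogonal:
  fixes L u :: "nat \<Rightarrow> nat \<Rightarrow> real" and e w :: "nat \<Rightarrow> real"
  assumes n: "n \<ge> 2"
    and mono: "\<And>k l. k \<le> l \<Longrightarrow> l < n \<Longrightarrow> e k \<le> e l"
    and o1: "\<And>k l. k < n \<Longrightarrow> l < n \<Longrightarrow> (\<Sum>i<n. u k i * u l i) = (if k = l then 1 else 0)"
    and o2: "\<And>i j. i < n \<Longrightarrow> j < n \<Longrightarrow> (\<Sum>k<n. u k i * u k j) = (if i = j then 1 else 0)"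
    and ev: "\<And>k i. k < n \<Longrightarrow> i < n \<Longrightarrow> (\<Sum>j<n. L i j * u k j) = e k * u k i"
    and sym: "\<And>i j. i < n \<Longrightarrow> j < n \<Longrightarrow> L i j = L j i"
    and psd: "\<And>x. (\<Sum>i<n. \<Sum>j<n. L i j * x i * x j) \<ge> 0"
    and kernel: "\<And>i. i < n \<Longrightarrow> (\<Sum>j<n. L i j * w j) = 0"
    and w0: "\<exists>i<n. w i \<noteq> 0"
  shows "\<exists>x. (\<exists>i<n. x i \<noteq> 0) \<and> (\<Sum>i<n. x i * w i) = 0 \<and> (\<forall>i<n. (\<Sum>j<n. L i j * x j) = e 1 * x i)"
    and "(\<Sum>i<n. x i * w i) = 0 \<Longrightarrow> e 1 * (\<Sum>i<n. (x i)\<^sup>2) \<le> (\<Sum>i<n. \<Sum>j<n. L i j * x i * x j)"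
proof -
  define c where "c = (\<lambda>x k. \<Sum>i<n. u k i * x i)"
  have expand: "x j = (\<Sum>k<n. c x k * u k j)" if "j < n" for x j
  proof -
    have "(\<Sum>k<n. c x k * u k j) = (\<Sum>k<n. \<Sum>i<n. x i * (u k i * u k j))"
      unfolding c_def by (simp add: sum_distrib_left sum_distrib_right mult_ac)
    also have "\<dots> = (\<Sum>i<n. x i * (\<Sum>k<n. u k i * u k j))"
      by (subst sum.swap) (simp add: sum_distrib_left)
    also have "\<dots> = (\<Sum>i<n. x i * (if i = j then 1 else 0))"
      by (intro sum.cong refl) (use o2 that in auto)
    also have "\<dots> = x j" using that by (subst sum.remove[of _ j]) auto
    finally show ?thesis ..
  qed
  have inner: "(\<Sum>i<n. x i * y i) = (\<Sum>k<n. c x k * c y k)" for x y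
  proof -
    have "(\<Sum>i<n. x i * y i) = (\<Sum>i<n. \<Sum>k<n. c x k * (u k i * y i))"
      by (intro sum.cong refl, subst expand[of _ x]) (auto simp: sum_distrib_left sum_distrib_right mult_ac)
    also have "\<dots> = (\<Sum>k<n. c x k * (\<Sum>i<n. u k i * y i))"
      by (subst sum.swap) (simp add: sum_distrib_left)
    finally show ?thesis by (simp add: c_def)
  qed
  have self_adj: "(\<Sum>i<n. y i * (\<Sum>j<n. L i j * z j)) = (\<Sum>i<n. z i * (\<Sum>j<n. L i j * y j))" for y z
  proof -
    have "(\<Sum>i<n. y i * (\<Sum>j<n. L i j * z j)) = (\<Sum>i<n. \<Sum>j<n. L i j * y i * z j)"
      by (simp add: sum_distrib_left mult_ac)
    also have "\<dots> = (\<Sum>j<n. \<Sum>i<n. L i j * y i * z j)" by (rule sum.swap)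
    also have "\<dots> = (\<Sum>j<n. z j * (\<Sum>i<n. L j i * y i))"
      by (auto simp: sum_distrib_left sym mult_ac intro!: sum.cong)
    finally show ?thesis .
  qed
  have cL: "c (\<lambda>i. \<Sum>j<n. L i j * x j) k = e k * c x k" if "k < n" for x k
  proof -
    have "c (\<lambda>i. \<Sum>j<n. L i j * x j) k = (\<Sum>i<n. x i * (\<Sum>j<n. L i j * u k j))"
      unfolding c_def by (rule self_adj)
    also have "\<dots> = (\<Sum>i<n. e k * (u k i * x i))" by (intro sum.cong refl) (use ev that in auto)
    finally show ?thesis by (simp add: c_def sum_distrib_left)
  qed
  have quad: "(\<Sum>i<n. \<Sum>j<n. L i j * x i * x j) = (\<Sum>k<n. e k * (c x k)\<^sup>2)" for x
  proof -
    have "(\<Sum>i<n. \<Sum>j<n. L i j * x i * x j) = (\<Sum>i<n. x i * (\<Sum>j<n. L i j * x j))"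
      by (simp add: sum_distrib_left mult_ac)
    also have "\<dots> = (\<Sum>k<n. c x k * c (\<lambda>i. \<Sum>j<n. L i j * x j) k)" by (rule inner)
    also have "\<dots> = (\<Sum>k<n. c x k * (e k * c x k))" by (intro sum.cong refl) (simp add: cL)
    finally show ?thesis by (simp add: power2_eq_square mult_ac)
  qed
  have cu: "c (u l) k = (if k = l then 1 else 0)" if "k < n" "l < n" for k l
    unfolding c_def using o1 that by simp
  have epos: "e k \<ge> 0" if "k < n" for k
  proof -
    have "(\<Sum>l<n. e l * (c (u k) l)\<^sup>2) = (\<Sum>l<n. if l = k then e l else 0)"
      using that by (intro sum.cong refl) (auto simp: cu)
    then show ?thesis using psd[of "u k"] quad[of "u k"] that by simp
  qed
  have cw: "e k * c w k = 0" if "k < n" for k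
  proof -
    have "c (\<lambda>i. \<Sum>j<n. L i j * w j) k = 0" unfolding c_def by (rule sum.neutral) (simp add: kernel)
    then show ?thesis using cL that by simp
  qed
  have unz: "\<exists>i<n. u k i \<noteq> 0" if "k < n" for k
  proof (rule ccontr)
    assume "\<not> ?thesis"
    then have "(\<Sum>i<n. u k i * u k i) = 0" by simp
    then show False using o1[OF that that] by simp
  qed
  have uw: "(\<Sum>i<n. u k i * w i) = c w k" for k by (simp add: c_def)
  show "\<exists>x. (\<exists>i<n. x i \<noteq> 0) \<and> (\<Sum>i<n. x i * w i) = 0 \<and> (\<forall>i<n. (\<Sum>j<n. L i j * x j) = e 1 * x i)"
  proof (cases "c w 1 = 0")
    case True
    then show ?thesis using unz[of 1] ev[of 1] n uw[of 1] by (intro exI[of _ "u 1"]) auto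
  next
    case False
    then have e1: "e 1 = 0" using cw[of 1] n by simp
    then have e0: "e 0 = 0" using mono[of 0 1] epos[of 0] n by simp
    \<comment> \<open>This combination of two kernel vectors is orthogonal to \<open>w\<close> by
      construction, and it is nonzero because its coefficient along \<open>u 0\<close> is
      \<open>c w 1\<close>.\<close>
    define x where "x = (\<lambda>i. c w 1 * u 0 i - c w 0 * u 1 i)"
    have "(\<Sum>i<n. u 0 i * x i) = c w 1 * (\<Sum>i<n. u 0 i * u 0 i) - c w 0 * (\<Sum>i<n. u 0 i * u 1 i)"
      unfolding x_def by (simp add: sum_subtractf sum_distrib_left algebra_simps)
    also have "\<dots> = c w 1" using o1[of 0 0] o1[of 0 1] n by simp
    finally have "(\<Sum>i<n. u 0 i * x i) \<noteq> 0" using False by simp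
    then obtain i where "i \<in> {..<n}" "u 0 i * x i \<noteq> 0" by (rule sum.not_neutral_contains_not_neutral)
    then have "\<exists>i<n. x i \<noteq> 0" by auto
    moreover have "(\<Sum>i<n. x i * w i) = c w 1 * (\<Sum>i<n. u 0 i * w i) - c w 0 * (\<Sum>i<n. u 1 i * w i)"
      unfolding x_def by (simp add: sum_subtractf sum_distrib_left algebra_simps)
    moreover have "(\<Sum>j<n. L i j * x j) = c w 1 * (\<Sum>j<n. L i j * u 0 j) - c w 0 * (\<Sum>j<n. L i j * u 1 j)" for i
      unfolding x_def by (simp add: sum_subtractf sum_distrib_left algebra_simps)
    ultimately show ?thesis using ev[of 0] ev[of 1] n e0 e1 uw
      by (intro exI[of _ x]) (auto simp: mult.commute)
  qed
  show "e 1 * (\<Sum>i<n. (x i)\<^sup>2) \<le> (\<Sum>i<n. \<Sum>j<n. L i j * x i * x j)" if xw: "(\<Sum>i<n. x i * w i) = 0"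
  proof (cases "e 1 = 0")
    case True
    then show ?thesis using psd by simp
  next
    case False
    then have e1: "e 1 > 0" using epos[of 1] n by simp
    \<comment> \<open>All eigenvalues from index 1 on are positive, so the kernel vector
      \<open>w\<close> is a multiple of \<open>u 0\<close>, and orthogonality to \<open>w\<close>
      means orthogonality to \<open>u 0\<close>.\<close>
    have cw0: "c w k = 0" if "k < n" "k \<noteq> 0" for k
      using cw[OF that(1)] mono[of 1 k] that e1 by auto
    have sum0: "(\<Sum>k<n. f k) = f 0 + (\<Sum>k\<in>{1..<n}. f k)" for f :: "nat \<Rightarrow> real"
      using n by (simp add: lessThan_atLeast0 sum.atLeast_Suc_lessThan)
    have "c w 0 \<noteq> 0"
    proof
      assume "c w 0 = 0"
      then have "c w k = 0" if "k < n" for k using cw0 that by (cases "k = 0") auto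
      then have "w j = 0" if "j < n" for j using expand[OF that, of w] by simp
      then show False using w0 by auto
    qed
    moreover have "(\<Sum>k<n. c x k * c w k) = 0" using inner[of x w] xw by simp
    then have "c x 0 * c w 0 = 0" unfolding sum0 by (simp add: cw0)
    ultimately have cx0: "c x 0 = 0" by simp
    have "e 1 * (\<Sum>i<n. (x i)\<^sup>2) = (\<Sum>k<n. e 1 * (c x k)\<^sup>2)"
      using inner[of x x] by (simp add: power2_eq_square sum_distrib_left)
    also have "\<dots> \<le> (\<Sum>k<n. e k * (c x k)\<^sup>2)"
    proof (rule sum_mono)
      fix k assume "k \<in> {..<n}"
      then show "e 1 * (c x k)\<^sup>2 \<le> e k * (c x k)\<^sup>2"
        using mono[of 1 k] cx0 by (cases "k = 0") (auto intro!: mult_right_mono)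
    qed
    finally show ?thesis by (simp add: quad)
  qed
qed

section \<open>The effect of an additional edge on the spectral gap\<close>

lemma finite_vertex_pairs [simp]: "finite (vertex_pairs n)"
  unfolding vertex_pairs_def by (rule finite_subset[of _ "Pow {..<n}"]) auto

text \<open>Real-valued, so that it enters quadratic forms directly. On the diagonal it asks for a
  singleton edge, hence it is 0 whenever \<open>E\<close> consists of two-element sets.\<close>

definition adj :: "nat set set \<Rightarrow> nat \<Rightarrow> nat \<Rightarrow> real" where
  "adj E i j = (if {i, j} \<in> E then 1 else 0)"

definition deg :: "nat \<Rightarrow> nat set set \<Rightarrow> nat \<Rightarrow> real" where
  "deg n E i = (\<Sum>j<n. adj E i j)"

lemma adj_commute: "adj E i j = adj E j i"
  by (simp add: adj_def insert_commute)

lemma adj_nonneg [simp]: "adj E i j \<ge> 0"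
  by (simp add: adj_def)

lemma adj_le_1 [simp]: "adj E i j \<le> 1"
  by (simp add: adj_def)

lemma adj_refl [simp]: "E \<subseteq> vertex_pairs n \<Longrightarrow> adj E i i = 0"
  by (auto simp: adj_def vertex_pairs_def)

lemma real_vertex_degree: "real (vertex_degree n E i) = deg n E i"
proof -
  have "deg n E i = (\<Sum>j<n. if {j, i} \<in> E then 1 else 0)"
    unfolding deg_def by (intro sum.cong refl) (simp add: adj_def insert_commute)
  also have "\<dots> = real (card {j \<in> {..<n}. {j, i} \<in> E})"
    by (subst sum.inter_filter[symmetric]) auto
  finally show ?thesis by (simp add: vertex_degree_def)
qed

lemma normalized_laplacian_carrier: "normalized_laplacian n E \<in> carrier_mat n n"
  unfolding normalized_laplacian_def inv_sqrt_degree_matrix_def degree_matrix_def adjacency_matrix_def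
  by (intro mult_carrier_mat[of _ n n] minus_carrier_mat) auto

lemma diagonal_congruence_entry:
  fixes M :: "'a :: comm_ring_1 mat"
  assumes M: "M \<in> carrier_mat n n" and ij: "i < n" "j < n"
  shows "(mat n n (\<lambda>(i, j). if i = j then f i else 0) * M * mat n n (\<lambda>(i, j). if i = j then f i else 0)) $$ (i, j)
    = f i * M $$ (i, j) * f j"
proof -
  let ?D = "mat n n (\<lambda>(i, j). if i = j then f i else 0)"
  have 1: "(?D * M) $$ (i, k) = f i * M $$ (i, k)" if "k < n" for k
  proof -
    have "(?D * M) $$ (i, k) = (\<Sum>l<n. (if i = l then f i else 0) * M $$ (l, k))"
      using M ij that by (auto simp: scalar_prod_def lessThan_atLeast0 intro!: sum.cong)
    also have "\<dots> = (\<Sum>l<n. if i = l then f i * M $$ (l, k) else 0)"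
      by (intro sum.cong refl) auto
    finally show ?thesis using ij by simp
  qed
  have "(?D * M * ?D) $$ (i, j) = (\<Sum>k<n. (?D * M) $$ (i, k) * (if k = j then f k else 0))"
    using M ij by (auto simp: scalar_prod_def lessThan_atLeast0 intro!: sum.cong)
  also have "\<dots> = (\<Sum>k<n. if k = j then (?D * M) $$ (i, k) * f k else 0)"
    by (intro sum.cong refl) auto
  finally show ?thesis using ij 1 by simp
qed

text \<open>With all degrees positive the convention for isolated vertices never applies; in the
  random graph this holds with high probability.\<close>

lemma normalized_laplacian_entry:
  assumes "i < n" "j < n" and d: "\<And>i. i < n \<Longrightarrow> deg n E i > 0"
  shows "normalized_laplacian n E $$ (i, j) =
    ((if i = j then deg n E i else 0) - adj E i j) / (sqrt (deg n E i) * sqrt (deg n E j))"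
proof -
  have D: "inv_sqrt_degree_matrix n E = mat n n (\<lambda>(i, j). if i = j then 1 / sqrt (deg n E i) else 0)"
    unfolding inv_sqrt_degree_matrix_def real_vertex_degree
    by (rule eq_matI) (use d in \<open>auto simp: real_vertex_degree[symmetric]\<close>)
  have M: "degree_matrix n E - adjacency_matrix n E \<in> carrier_mat n n"
    unfolding degree_matrix_def adjacency_matrix_def by (intro minus_carrier_mat) auto
  show ?thesis
    unfolding normalized_laplacian_def D diagonal_congruence_entry[OF M assms(1,2)]
    using assms(1,2) by (simp add: degree_matrix_def adjacency_matrix_def adj_def real_vertex_degree)
qed

lemma dirichlet_energy:
  fixes h :: "nat \<Rightarrow> real"
  shows "(\<Sum>i<n. \<Sum>j<n. adj E i j * (h i - h j)\<^sup>2) / 2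
    = (\<Sum>i<n. deg n E i * (h i)\<^sup>2) - (\<Sum>i<n. \<Sum>j<n. adj E i j * h i * h j)"
proof -
  have "(\<Sum>i<n. \<Sum>j<n. adj E i j * (h i - h j)\<^sup>2)
      = (\<Sum>i<n. \<Sum>j<n. adj E i j * (h i)\<^sup>2) + (\<Sum>i<n. \<Sum>j<n. adj E i j * (h j)\<^sup>2)
        - 2 * (\<Sum>i<n. \<Sum>j<n. adj E i j * h i * h j)"
    by (simp add: power2_diff algebra_simps sum.distrib sum_subtractf sum_distrib_left)
  also have "(\<Sum>i<n. \<Sum>j<n. adj E i j * (h j)\<^sup>2) = (\<Sum>i<n. \<Sum>j<n. adj E i j * (h i)\<^sup>2)"
    by (subst sum.swap) (simp add: adj_commute)
  also have "(\<Sum>i<n. \<Sum>j<n. adj E i j * (h i)\<^sup>2) = (\<Sum>i<n. deg n E i * (h i)\<^sup>2)"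
    by (simp add: deg_def sum_distrib_right)
  finally show ?thesis by simp
qed

text \<open>Substituting x = D^(1/2) h turns the Laplacian form into the Dirichlet energy, the
  squared norm into the degree-weighted one, and orthogonality to the kernel vector D^(1/2) 1 into
  degree-weighted mean zero. The vector \<open>g\<close> is normalised in the unweighted norm, since
  it is later paired with A - p J.\<close>

lemma spectral_gap_variational:
  assumes n: "n \<ge> 2" and d: "\<And>i. i < n \<Longrightarrow> deg n E i > 0"
  shows "\<exists>g. (\<Sum>i<n. deg n E i * g i) = 0 \<and> (\<Sum>i<n. (g i)\<^sup>2) = 1 \<and>
      (\<forall>i<n. (\<Sum>j<n. adj E i j * g j) = (1 - spectral_gap n E) * deg n E i * g i)"
    and "(\<Sum>i<n. deg n E i * h i) = 0 \<Longrightarrow>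
      spectral_gap n E * (\<Sum>i<n. deg n E i * (h i)\<^sup>2) \<le> (\<Sum>i<n. \<Sum>j<n. adj E i j * (h i - h j)\<^sup>2) / 2"
proof -
  define A where "A = normalized_laplacian n E"
  define r where "r i = sqrt (deg n E i)" for i
  have r: "r i > 0" "r i * r i = deg n E i" if "i < n" for i
    using d[OF that] by (auto simp: r_def)
  have A: "A \<in> carrier_mat n n" unfolding A_def by (rule normalized_laplacian_carrier)
  have ent: "A $$ (i, j) = ((if i = j then deg n E i else 0) - adj E i j) / (r i * r j)" if "i < n" "j < n" for i j
    unfolding A_def r_def using that d by (rule normalized_laplacian_entry)
  have sym: "A $$ (i, j) = A $$ (j, i)" if "i < n" "j < n" for i j
    using that by (simp add: ent adj_commute[of E i j] mult.commute)
  have tA: "transpose_mat A = A" by (rule eq_matI) (use A sym in auto)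
  have app: "(\<Sum>j<n. A $$ (i, j) * (r j * h j)) = (deg n E i * h i - (\<Sum>j<n. adj E i j * h j)) / r i"
    if "i < n" for h i
  proof -
    have "(\<Sum>j<n. A $$ (i, j) * (r j * h j)) = (\<Sum>j<n. ((if i = j then deg n E i * h i else 0) - adj E i j * h j) / r i)"
    proof (intro sum.cong refl)
      fix j assume "j \<in> {..<n}"
      then have "r j > 0" "j < n" using r by auto
      then show "A $$ (i, j) * (r j * h j) = ((if i = j then deg n E i * h i else 0) - adj E i j * h j) / r i"
        using ent[OF that \<open>j < n\<close>] by (auto simp: field_simps)
    qed
    also have "\<dots> = ((\<Sum>j<n. if i = j then deg n E i * h i else 0) - (\<Sum>j<n. adj E i j * h j)) / r i"
      by (simp add: sum_divide_distrib[symmetric] sum_subtractf)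
    finally show ?thesis using that by simp
  qed
  have quad: "(\<Sum>i<n. \<Sum>j<n. A $$ (i, j) * (r i * h i) * (r j * h j)) = (\<Sum>i<n. \<Sum>j<n. adj E i j * (h i - h j)\<^sup>2) / 2" for h
  proof -
    have "(\<Sum>i<n. \<Sum>j<n. A $$ (i, j) * (r i * h i) * (r j * h j)) = (\<Sum>i<n. (r i * h i) * (\<Sum>j<n. A $$ (i, j) * (r j * h j)))"
      by (simp add: sum_distrib_left mult_ac)
    also have "\<dots> = (\<Sum>i<n. deg n E i * (h i)\<^sup>2 - (\<Sum>j<n. adj E i j * h i * h j))"
    proof (intro sum.cong refl)
      fix i assume "i \<in> {..<n}"
      then have i: "i < n" "r i > 0" using r by auto
      show "(r i * h i) * (\<Sum>j<n. A $$ (i, j) * (r j * h j)) = deg n E i * (h i)\<^sup>2 - (\<Sum>j<n. adj E i j * h i * h j)"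
        unfolding app[OF i(1)] using i(2) by (simp add: field_simps power2_eq_square sum_distrib_left)
    qed
    finally show ?thesis unfolding dirichlet_energy by (simp add: sum_subtractf)
  qed
  have psd: "(\<Sum>i<n. \<Sum>j<n. A $$ (i, j) * x i * x j) \<ge> 0" for x
  proof -
    have "(\<Sum>i<n. \<Sum>j<n. A $$ (i, j) * x i * x j) = (\<Sum>i<n. \<Sum>j<n. A $$ (i, j) * (r i * (x i / r i)) * (r j * (x j / r j)))"
      by (intro sum.cong refl) (use r in force)
    also have "\<dots> \<ge> 0" unfolding quad[of "\<lambda>i. x i / r i"]
      by (intro divide_nonneg_nonneg sum_nonneg mult_nonneg_nonneg) auto
    finally show ?thesis .
  qed
  have ker: "(\<Sum>j<n. A $$ (i, j) * r j) = 0" if "i < n" for i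
    using app[OF that, of "\<lambda>_. 1"] by (simp add: deg_def)
  have rnz: "\<exists>i<n. r i \<noteq> 0" using r(1)[of 0] n by (intro exI[of _ 0]) auto
  obtain u :: "nat \<Rightarrow> nat \<Rightarrow> real" and e where
    mono': "\<forall>k l. k \<le> l \<longrightarrow> l < n \<longrightarrow> e k \<le> e l" and
    oe': "\<forall>k<n. ordered_eigenvalue A (Suc k) = e k" and
    o1': "\<forall>k<n. \<forall>l<n. (\<Sum>i<n. u k i * u l i) = (if k = l then 1 else 0)" and
    o2': "\<forall>i<n. \<forall>j<n. (\<Sum>k<n. u k i * u k j) = (if i = j then 1 else 0)" and
    ev': "\<forall>k<n. \<forall>i<n. (\<Sum>j<n. A $$ (i, j) * u k j) = e k * u k i"
    using ordered_spectral_decomposition[OF A tA] by (elim exE conjE) (rule that)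
  have mono: "e k \<le> e l" if "k \<le> l" "l < n" for k l using mono' that by blast
  have oe: "ordered_eigenvalue A (Suc k) = e k" if "k < n" for k using oe' that by blast
  have o1: "(\<Sum>i<n. u k i * u l i) = (if k = l then 1 else 0)" if "k < n" "l < n" for k l
    using o1' that by blast
  have o2: "(\<Sum>k<n. u k i * u k j) = (if i = j then 1 else 0)" if "i < n" "j < n" for i j
    using o2' that by blast
  have ev: "(\<Sum>j<n. A $$ (i, j) * u k j) = e k * u k i" if "k < n" "i < n" for k i
    using ev' that by blast
  have gap: "spectral_gap n E = e 1"
    unfolding spectral_gap_def A_def[symmetric] using oe[of 1] n by (simp add: numeral_2_eq_2)
  note S = second_eigenvalue_orthogonal[where L = "\<lambda>i j. A $$ (i, j)" and w = r,
      OF n mono o1 o2 ev sym psd ker rnz]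
  show "spectral_gap n E * (\<Sum>i<n. deg n E i * (h i)\<^sup>2) \<le> (\<Sum>i<n. \<Sum>j<n. adj E i j * (h i - h j)\<^sup>2) / 2"
    if h: "(\<Sum>i<n. deg n E i * h i) = 0"
  proof -
    have "(\<Sum>i<n. r i * h i * r i) = (\<Sum>i<n. deg n E i * h i)"
      by (intro sum.cong refl) (use r in \<open>auto simp: mult_ac simp flip: mult.assoc\<close>)
    then have "e 1 * (\<Sum>i<n. (r i * h i)\<^sup>2) \<le> (\<Sum>i<n. \<Sum>j<n. A $$ (i, j) * (r i * h i) * (r j * h j))"
      using S(2)[of "\<lambda>i. r i * h i"] h by simp
    moreover have "(\<Sum>i<n. (r i * h i)\<^sup>2) = (\<Sum>i<n. deg n E i * (h i)\<^sup>2)"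
      by (intro sum.cong refl) (use r in \<open>auto simp: power2_eq_square simp flip: r(2)\<close>)
    ultimately show ?thesis unfolding quad gap by simp
  qed
  obtain x where x: "\<exists>i<n. x i \<noteq> 0" "(\<Sum>i<n. x i * r i) = 0"
    "\<And>i. i < n \<Longrightarrow> (\<Sum>j<n. A $$ (i, j) * x j) = e 1 * x i"
    using S(1) by blast
  define g where "g = (\<lambda>i. x i / r i)"
  have xg: "x i = r i * g i" if "i < n" for i using r(1)[OF that] by (simp add: g_def)
  have g1: "(\<Sum>i<n. deg n E i * g i) = 0"
  proof -
    have "(\<Sum>i<n. deg n E i * g i) = (\<Sum>i<n. x i * r i)"
      by (intro sum.cong refl) (auto simp: xg simp flip: r(2))
    then show ?thesis using x(2) by simp
  qed
  have g2: "(\<Sum>j<n. adj E i j * g j) = (1 - spectral_gap n E) * deg n E i * g i" if "i < n" for i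
  proof -
    have "(\<Sum>j<n. A $$ (i, j) * x j) = (\<Sum>j<n. A $$ (i, j) * (r j * g j))"
      by (intro sum.cong refl) (simp add: xg)
    then have "(deg n E i * g i - (\<Sum>j<n. adj E i j * g j)) / r i = e 1 * (r i * g i)"
      using x(3)[OF that] app[OF that, of g] xg[OF that] by simp
    then have "deg n E i * g i - (\<Sum>j<n. adj E i j * g j) = e 1 * (r i * r i) * g i"
      using r(1)[OF that] by (simp add: field_simps)
    then show ?thesis unfolding gap using r(2)[OF that] by (simp add: algebra_simps)
  qed
  define s where "s = (\<Sum>i<n. (g i)\<^sup>2)"
  have "s > 0"
  proof -
    obtain i where i: "i < n" "x i \<noteq> 0" using x(1) by blast
    then have "(g i)\<^sup>2 > 0" using r(1)[of i] by (simp add: g_def)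
    then show ?thesis unfolding s_def using i(1) by (intro sum_pos2[of _ i]) auto
  qed
  show "\<exists>g. (\<Sum>i<n. deg n E i * g i) = 0 \<and> (\<Sum>i<n. (g i)\<^sup>2) = 1 \<and>
      (\<forall>i<n. (\<Sum>j<n. adj E i j * g j) = (1 - spectral_gap n E) * deg n E i * g i)"
  proof (intro exI[of _ "\<lambda>i. g i / sqrt s"] conjI allI impI)
    show "(\<Sum>i<n. deg n E i * (g i / sqrt s)) = 0"
      using g1 by (simp add: sum_divide_distrib[symmetric])
    show "(\<Sum>i<n. (g i / sqrt s)\<^sup>2) = 1"
      using \<open>s > 0\<close> by (simp add: power_divide sum_divide_distrib[symmetric] s_def[symmetric])
    show "(\<Sum>j<n. adj E i j * (g j / sqrt s)) = (1 - spectral_gap n E) * deg n E i * (g i / sqrt s)" if "i < n" for i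
      using g2[OF that] by (simp add: sum_divide_distrib[symmetric])
  qed
qed

section \<open>Quadratic forms after the insertion of an edge\<close>

lemma adj_insert:
  assumes "{u, v} \<notin> E" "u \<noteq> v"
  shows "adj (insert {u, v} E) i j = adj E i j + ((if i = u then if j = v then 1 else 0 else 0)
    + (if i = v then if j = u then 1 else 0 else 0))"
proof -
  have eq: "{i, j} = {u, v} \<longleftrightarrow> i = u \<and> j = v \<or> i = v \<and> j = u"
    by (rule doubleton_eq_iff)
  show ?thesis
  proof (cases "{i, j} = {u, v}")
    case True
    then have "adj E i j = 0" "adj (insert {u, v} E) i j = 1"
      using assms(1) by (simp_all add: adj_def)
    then show ?thesis using True assms(2) unfolding eq by auto
  next
    case False
    then have "adj (insert {u, v} E) i j = adj E i j" by (simp add: adj_def)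
    then show ?thesis using False unfolding eq by auto
  qed
qed

lemma sum_adj_insert:
  fixes f :: "nat \<Rightarrow> nat \<Rightarrow> real"
  assumes "{u, v} \<notin> E" "u \<noteq> v" "u < n" "v < n"
  shows "(\<Sum>i<n. \<Sum>j<n. adj (insert {u, v} E) i j * f i j) = (\<Sum>i<n. \<Sum>j<n. adj E i j * f i j) + f u v + f v u"
proof -
  have "(\<Sum>i<n. \<Sum>j<n. adj (insert {u, v} E) i j * f i j)
      = (\<Sum>i<n. \<Sum>j<n. adj E i j * f i j + ((if j = v then if i = u then f i j else 0 else 0)
        + (if j = u then if i = v then f i j else 0 else 0)))"
    unfolding adj_insert[OF assms(1,2)] by (intro sum.cong refl) (auto simp: distrib_right)
  also have "\<dots> = (\<Sum>i<n. \<Sum>j<n. adj E i j * f i j) + ((\<Sum>i<n. if i = u then f i v else 0) + (\<Sum>i<n. if i = v then f i u else 0))"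
    using assms(3,4) by (simp add: sum.distrib sum.delta)
  finally show ?thesis using assms(3,4) by simp
qed

text \<open>The test vector is \<open>g\<close> minus its mean with respect to the new degrees.\<close>

lemma gap_decrease_criterion:
  assumes n: "n \<ge> 2" and d: "\<And>i. i < n \<Longrightarrow> deg n E i > 0"
    and uv: "{u, v} \<notin> E" "u \<noteq> v" "u < n" "v < n"
    and g0: "(\<Sum>i<n. deg n E i * g i) = 0"
    and ev: "\<And>i. i < n \<Longrightarrow> (\<Sum>j<n. adj E i j * g j) = (1 - spectral_gap n E) * deg n E i * g i"
    and crit: "(1 - spectral_gap n E) * ((g u)\<^sup>2 + (g v)\<^sup>2)
      + spectral_gap n E * (g u + g v)\<^sup>2 / ((\<Sum>i<n. deg n E i) + 2) < 2 * g u * g v"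
  shows "spectral_gap n (insert {u, v} E) < spectral_gap n E"
proof (rule ccontr)
  let ?E = "insert {u, v} E"
  define l where "l = spectral_gap n E"
  define l' where "l' = spectral_gap n ?E"
  define m where "m = (g u + g v) / ((\<Sum>i<n. deg n E i) + 2)"
  define Q where "Q = (\<Sum>i<n. deg n E i * (g i)\<^sup>2)"
  assume "\<not> spectral_gap n (insert {u, v} E) < spectral_gap n E"
  then have ll: "l \<le> l'" by (simp add: l_def l'_def)
  have dsum: "(\<Sum>i<n. deg n ?E i * f i) = (\<Sum>i<n. deg n E i * f i) + f u + f v" for f :: "nat \<Rightarrow> real"
    using sum_adj_insert[OF uv, of "\<lambda>i j. f i"] by (simp add: deg_def sum_distrib_right)
  have d': "deg n ?E i > 0" if "i < n" for i
  proof -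
    have "deg n E i \<le> deg n ?E i" unfolding deg_def by (intro sum_mono) (auto simp: adj_def)
    then show ?thesis using d[OF that] by simp
  qed
  have S0: "(\<Sum>i<n. deg n E i) \<ge> 0" using d by (intro sum_nonneg less_imp_le) auto
  let ?h = "\<lambda>i. g i - m"
  have m: "m * ((\<Sum>i<n. deg n E i) + 2) = g u + g v" unfolding m_def using S0 by simp
  have "(\<Sum>i<n. deg n ?E i * ?h i) = (\<Sum>i<n. deg n E i * g i) - m * ((\<Sum>i<n. deg n E i) + 2) + g u + g v"
    unfolding dsum by (simp add: algebra_simps sum_subtractf sum_distrib_left)
  then have h0: "(\<Sum>i<n. deg n ?E i * ?h i) = 0" using g0 m by simp
  have den: "(\<Sum>i<n. deg n ?E i * (?h i)\<^sup>2) = Q + (g u)\<^sup>2 + (g v)\<^sup>2 - m * (g u + g v)"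
  proof -
    have "(\<Sum>i<n. deg n E i * (?h i)\<^sup>2) = Q - 2 * m * (\<Sum>i<n. deg n E i * g i) + m\<^sup>2 * (\<Sum>i<n. deg n E i)"
      unfolding Q_def by (simp add: algebra_simps power2_diff sum_subtractf sum.distrib sum_distrib_left)
    then have "(\<Sum>i<n. deg n ?E i * (?h i)\<^sup>2) = Q + (g u)\<^sup>2 + (g v)\<^sup>2 - 2 * m * (g u + g v)
        + m * (m * ((\<Sum>i<n. deg n E i) + 2))"
      unfolding dsum using g0 by (simp add: algebra_simps power2_diff power2_eq_square)
    then show ?thesis unfolding m by (simp add: algebra_simps)
  qed
  have "(\<Sum>i<n. \<Sum>j<n. adj E i j * g i * g j) = (\<Sum>i<n. g i * (\<Sum>j<n. adj E i j * g j))"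
    by (simp add: sum_distrib_left mult_ac)
  also have "\<dots> = (\<Sum>i<n. g i * ((1 - l) * deg n E i * g i))"
    by (intro sum.cong refl) (simp add: ev l_def)
  also have "\<dots> = (1 - l) * Q"
    unfolding Q_def by (simp add: sum_distrib_left power2_eq_square mult_ac)
  finally have "(\<Sum>i<n. \<Sum>j<n. adj E i j * (g i - g j)\<^sup>2) / 2 = l * Q"
    unfolding dirichlet_energy Q_def[symmetric] by (simp add: algebra_simps)
  \<comment> \<open>The shift by \<open>m\<close> does not affect differences, so only the new edge
    adds energy.\<close>
  then have num: "(\<Sum>i<n. \<Sum>j<n. adj ?E i j * (?h i - ?h j)\<^sup>2) / 2 = l * Q + (g u - g v)\<^sup>2"
    unfolding sum_adj_insert[OF uv] by (simp add: power2_commute[of "g v"] add_divide_distrib)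
  let ?D = "\<Sum>i<n. deg n ?E i * (?h i)\<^sup>2"
  \<comment> \<open>Nonnegativity of \<open>?D\<close> allows the assumed \<open>l \<le> l'\<close>
    to be multiplied by it. In the resulting comparison the terms \<open>l * Q\<close> cancel, and
    what is left contradicts \<open>crit\<close>.\<close>
  have "?D \<ge> 0" using d' by (intro sum_nonneg mult_nonneg_nonneg) (auto intro: less_imp_le)
  then have "l * ?D \<le> l' * ?D" by (rule mult_right_mono[OF ll])
  also have "\<dots> \<le> l * Q + (g u - g v)\<^sup>2"
    using spectral_gap_variational(2)[OF n d' h0] unfolding num l'_def .
  finally have "l * ((g u)\<^sup>2 + (g v)\<^sup>2) - l * (m * (g u + g v)) \<le> (g u - g v)\<^sup>2"
    unfolding den by (simp add: algebra_simps)
  moreover have "l * (g u + g v)\<^sup>2 / ((\<Sum>i<n. deg n E i) + 2) = l * (m * (g u + g v))"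
    unfolding m_def by (simp add: power2_eq_square)
  ultimately show False using crit unfolding l_def[symmetric] by (simp add: algebra_simps power2_diff)
qed

section \<open>Entries of the second eigenvector\<close>

text \<open>The operator norm of A - p J is at most K sqrt n, squared to avoid roots. J has a full
  diagonal, so the centred matrix has diagonal entries \<open>- p\<close> for a simple
  graph.\<close>

definition op_bound :: "real \<Rightarrow> nat \<Rightarrow> nat set set \<Rightarrow> real \<Rightarrow> bool" where
  "op_bound p n E K \<longleftrightarrow>
    (\<forall>x. (\<Sum>i<n. (\<Sum>j<n. (adj E i j - p) * x j)\<^sup>2) \<le> K\<^sup>2 * real n * (\<Sum>i<n. (x i)\<^sup>2))"

text \<open>Quantitative injectivity, modulo constant vectors, of the block with columns in
  \<open>S\<close> and rows outside. Norm at most 1 makes a finite net available; mass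
  \<open>s\<^sup>2\<close> on coordinates bounded by \<open>m\<close> is what the small-ball bound
  consumes. For \<open>m = s = 1\<close> the two conditions together just say that \<open>x\<close>
  is a unit vector on \<open>S\<close>.\<close>

definition nonconcentrated :: "nat \<Rightarrow> nat set set \<Rightarrow> real \<Rightarrow> real \<Rightarrow> real \<Rightarrow> real \<Rightarrow> bool" where
  "nonconcentrated n E \<alpha> m s c \<longleftrightarrow>
    (\<forall>S x b. S \<subseteq> {..<n} \<longrightarrow> real (card S) \<le> \<alpha> * real n \<longrightarrow> (\<Sum>i\<in>S. (x i)\<^sup>2) \<le> 1 \<longrightarrow>
      s\<^sup>2 \<le> (\<Sum>i\<in>{i\<in>S. \<bar>x i\<bar> \<le> m}. (x i)\<^sup>2) \<longrightarrow>
      c\<^sup>2 * real n \<le> (\<Sum>v\<in>{..<n} - S. ((\<Sum>i\<in>S. adj E v i * x i) - b)\<^sup>2))"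

lemma abs_bilinear_le:
  assumes W: "op_bound p n E K" and K: "K \<ge> 0"
  shows "\<bar>\<Sum>i<n. y i * (\<Sum>j<n. (adj E i j - p) * x j)\<bar> \<le>
    K * sqrt (real n) * sqrt (\<Sum>i<n. (x i)\<^sup>2) * sqrt (\<Sum>i<n. (y i)\<^sup>2)"
proof -
  let ?w = "\<lambda>i. \<Sum>j<n. (adj E i j - p) * x j"
  have "(\<Sum>i<n. y i * ?w i)\<^sup>2 \<le> (\<Sum>i<n. (y i)\<^sup>2) * (\<Sum>i<n. (?w i)\<^sup>2)"
    by (rule Cauchy_Schwarz_ineq_sum)
  also have "\<dots> \<le> (\<Sum>i<n. (y i)\<^sup>2) * (K\<^sup>2 * real n * (\<Sum>i<n. (x i)\<^sup>2))"
    using W unfolding op_bound_def by (intro mult_left_mono sum_nonneg) auto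
  finally have "sqrt ((\<Sum>i<n. y i * ?w i)\<^sup>2) \<le> sqrt ((\<Sum>i<n. (y i)\<^sup>2) * (K\<^sup>2 * real n * (\<Sum>i<n. (x i)\<^sup>2)))"
    by (rule real_sqrt_le_mono)
  then show ?thesis using K by (simp add: real_sqrt_mult mult_ac)
qed

lemma deg_le: "deg n E i \<le> real n"
proof -
  have "deg n E i \<le> (\<Sum>j<n. 1)" unfolding deg_def by (intro sum_mono) simp
  then show ?thesis by simp
qed

lemma deg_nonneg: "deg n E i \<ge> 0"
  unfolding deg_def by (intro sum_nonneg) simp

text \<open>Pairing A - p J with \<open>g\<close> and the all-ones vector, and using the
  degree-weighted mean zero, bounds the sum of the \<open>g i\<close> by K/p. Pairing it with
  \<open>g\<close> twice then bounds \<open>\<epsilon> * Q\<close>, where \<open>Q\<close> is at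
  least n p / 2, by K sqrt n plus the contribution K^2/p of the rank-one part.\<close>

lemma eigenvalue_near_one:
  assumes n: "n \<ge> 1" and p: "0 < p" and K: "K \<ge> 0" and W: "op_bound p n E K"
    and d: "\<And>i. i < n \<Longrightarrow> deg n E i \<ge> real n * p / 2"
    and g0: "(\<Sum>i<n. deg n E i * g i) = 0" and g1: "(\<Sum>i<n. (g i)\<^sup>2) = 1"
    and ev: "\<And>i. i < n \<Longrightarrow> (\<Sum>j<n. adj E i j * g j) = \<epsilon> * deg n E i * g i"
  shows "\<bar>\<epsilon>\<bar> * sqrt (real n) \<le> 2 / p * (K + K\<^sup>2 / p)"
proof -
  let ?G = "\<Sum>i<n. g i"
  have rn: "sqrt (real n) \<ge> 1" "real n \<ge> 1" "sqrt (real n) * sqrt (real n) = real n" using n by auto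
  have rowone: "(\<Sum>j<n. (adj E i j - p) * 1) = deg n E i - p * real n" for i
    by (simp add: sum_subtractf deg_def)
  have "(\<Sum>i<n. g i * (\<Sum>j<n. (adj E i j - p) * 1)) = (\<Sum>i<n. deg n E i * g i) - p * real n * ?G"
    unfolding rowone by (simp add: algebra_simps sum_subtractf sum_distrib_left)
  then have "\<bar>p * real n * ?G\<bar> \<le> K * real n"
    using abs_bilinear_le[OF W K, of g "\<lambda>_. 1"] g0 g1 by (simp add: mult.assoc)
  then have G: "\<bar>?G\<bar> \<le> K / p" using p rn by (simp add: abs_mult field_simps)
  then have "\<bar>?G\<bar>\<^sup>2 \<le> (K / p)\<^sup>2" by (intro power_mono) auto
  then have G2: "p * ?G\<^sup>2 \<le> K\<^sup>2 / p" using p by (simp add: power_divide field_simps power2_eq_square)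
  define Q where "Q = (\<Sum>i<n. deg n E i * (g i)\<^sup>2)"
  have "real n * p / 2 * (\<Sum>i<n. (g i)\<^sup>2) \<le> Q"
    unfolding Q_def sum_distrib_left by (intro sum_mono mult_right_mono) (use d in auto)
  then have Q: "real n * p / 2 \<le> Q" using g1 by simp
  have Q0: "Q > 0" using Q mult_pos_pos[of "real n" p] p rn by linarith
  have "(\<Sum>i<n. g i * (\<Sum>j<n. adj E i j * g j)) = (\<Sum>i<n. g i * (\<epsilon> * deg n E i * g i))"
    by (intro sum.cong refl) (simp add: ev)
  then have 1: "(\<Sum>i<n. g i * (\<Sum>j<n. adj E i j * g j)) = \<epsilon> * Q"
    unfolding Q_def by (simp add: sum_distrib_left power2_eq_square mult_ac)
  have "(\<Sum>j<n. (adj E i j - p) * g j) = (\<Sum>j<n. adj E i j * g j) - p * ?G" for i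
    by (simp add: algebra_simps sum_subtractf sum_distrib_left)
  then have "(\<Sum>i<n. g i * (\<Sum>j<n. (adj E i j - p) * g j)) = \<epsilon> * Q - p * ?G\<^sup>2"
    using 1 by (simp add: right_diff_distrib sum_subtractf sum_distrib_right[symmetric] power2_eq_square)
  then have "\<bar>\<epsilon> * Q - p * ?G\<^sup>2\<bar> \<le> K * sqrt (real n)"
    using abs_bilinear_le[OF W K, of g g] g1 by simp
  moreover have "p * ?G\<^sup>2 \<ge> 0" using p by simp
  ultimately have "\<bar>\<epsilon> * Q\<bar> \<le> K * sqrt (real n) + K\<^sup>2 / p" using G2 by linarith
  also have "\<dots> \<le> K * sqrt (real n) + K\<^sup>2 / p * sqrt (real n)"
    using mult_left_mono[OF rn(1), of "K\<^sup>2 / p"] p by simp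
  finally have "\<bar>\<epsilon>\<bar> * Q \<le> (K + K\<^sup>2 / p) * sqrt (real n)" using Q0 by (simp add: abs_mult algebra_simps)
  moreover have "\<bar>\<epsilon>\<bar> * (real n * p / 2) \<le> \<bar>\<epsilon>\<bar> * Q" using Q by (intro mult_left_mono) auto
  ultimately have "\<bar>\<epsilon>\<bar> * (real n * p / 2) \<le> (K + K\<^sup>2 / p) * sqrt (real n)"
    by (rule order_trans[rotated])
  moreover have "(\<bar>\<epsilon>\<bar> * sqrt (real n) * p / 2) * sqrt (real n) = \<bar>\<epsilon>\<bar> * ((sqrt (real n) * sqrt (real n)) * p / 2)"
    by (simp only: times_divide_eq_right times_divide_eq_left mult_ac)
  moreover have "\<bar>\<epsilon>\<bar> * ((sqrt (real n) * sqrt (real n)) * p / 2) = \<bar>\<epsilon>\<bar> * (real n * p / 2)"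
    by (simp only: rn(3))
  ultimately have "(\<bar>\<epsilon>\<bar> * sqrt (real n) * p / 2) * sqrt (real n) \<le> (K + K\<^sup>2 / p) * sqrt (real n)"
    by (simp only:)
  then have "\<bar>\<epsilon>\<bar> * sqrt (real n) * p / 2 \<le> K + K\<^sup>2 / p"
    by (rule mult_right_le_imp_le) (use rn(1) in linarith)
  then show ?thesis using p by (simp add: field_simps)
qed

text \<open>The constant \<open>b\<close> absorbs the rank-one part \<open>p J\<close> of the adjacency matrix.\<close>

lemma eigenvector_restriction:
  assumes W: "op_bound p n E K" and S: "S \<subseteq> {..<n}"
    and eps: "\<bar>\<epsilon>\<bar> * sqrt (real n) \<le> C"
    and ev: "\<And>i. i < n \<Longrightarrow> (\<Sum>j<n. adj E i j * g j) = \<epsilon> * deg n E i * g i"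
  shows "\<exists>b. (\<Sum>v\<in>{..<n} - S. ((\<Sum>i\<in>S. adj E v i * g i) - b)\<^sup>2)
    \<le> 2 * (C\<^sup>2 + K\<^sup>2) * real n * (\<Sum>i\<in>{..<n} - S. (g i)\<^sup>2)"
proof -
  let ?T = "{..<n} - S"
  define r where "r = (\<lambda>i. if i \<in> S then 0 else g i)"
  define w where "w = (\<lambda>v. \<Sum>j<n. (adj E v j - p) * r j)"
  define b where "b = - p * (\<Sum>j<n. r j)"
  have split: "(\<Sum>j<n. f j) = (\<Sum>j\<in>S. f j) + (\<Sum>j\<in>?T. f j)" for f :: "nat \<Rightarrow> real"
    using sum.subset_diff[OF S, of f] by simp
  have r2: "(\<Sum>i<n. (r i)\<^sup>2) = (\<Sum>i\<in>?T. (g i)\<^sup>2)"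
    unfolding split[of "\<lambda>i. (r i)\<^sup>2"] by (auto simp: r_def intro!: sum.cong)
  \<comment> \<open>For a row outside \<open>S\<close> the eigenvalue equation moves the columns
    outside \<open>S\<close> to the other side; centring them leaves \<open>w v\<close> and the
    row-independent \<open>b\<close>.\<close>
  have row: "(\<Sum>i\<in>S. adj E v i * g i) - b = \<epsilon> * deg n E v * g v - w v" if "v \<in> ?T" for v
  proof -
    have "w v = (\<Sum>j<n. adj E v j * r j) + b"
      unfolding w_def b_def by (simp add: algebra_simps sum_subtractf sum_distrib_left sum_negf)
    also have "(\<Sum>j<n. adj E v j * r j) = (\<Sum>j\<in>?T. adj E v j * g j)"
      unfolding split[of "\<lambda>j. adj E v j * r j"] by (auto simp: r_def intro!: sum.cong)
    finally show ?thesis using ev[of v] that split[of "\<lambda>j. adj E v j * g j"] by simp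
  qed
  have "(\<bar>\<epsilon>\<bar> * sqrt (real n))\<^sup>2 \<le> C\<^sup>2" using eps by (intro power_mono) auto
  then have e2: "\<epsilon>\<^sup>2 * real n \<le> C\<^sup>2" by (simp add: power_mult_distrib)
  have bound: "((\<Sum>i\<in>S. adj E v i * g i) - b)\<^sup>2 \<le> 2 * (C\<^sup>2 * real n * (g v)\<^sup>2) + 2 * (w v)\<^sup>2" if "v \<in> ?T" for v
  proof -
    have "(x - y)\<^sup>2 \<le> 2 * x\<^sup>2 + 2 * y\<^sup>2" for x y :: real
      using zero_le_power2[of "x + y"] by (simp add: power2_diff power2_sum)
    then have "((\<Sum>i\<in>S. adj E v i * g i) - b)\<^sup>2 \<le> 2 * (\<epsilon> * deg n E v * g v)\<^sup>2 + 2 * (w v)\<^sup>2"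
      unfolding row[OF that] .
    moreover have "(\<epsilon> * deg n E v * g v)\<^sup>2 \<le> C\<^sup>2 * real n * (g v)\<^sup>2"
    proof -
      have "(deg n E v)\<^sup>2 \<le> (real n)\<^sup>2" using deg_le deg_nonneg by (intro power_mono)
      then have "\<epsilon>\<^sup>2 * (deg n E v)\<^sup>2 \<le> \<epsilon>\<^sup>2 * (real n)\<^sup>2" by (intro mult_left_mono) auto
      also have "\<dots> = (\<epsilon>\<^sup>2 * real n) * real n" by (simp add: power2_eq_square)
      also have "\<dots> \<le> C\<^sup>2 * real n" using e2 by (intro mult_right_mono) auto
      finally show ?thesis unfolding power_mult_distrib by (intro mult_right_mono) auto
    qed
    ultimately show ?thesis by linarith
  qed
  have "(\<Sum>v\<in>?T. (w v)\<^sup>2) \<le> (\<Sum>v<n. (w v)\<^sup>2)" by (intro sum_mono2) auto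
  also have "\<dots> \<le> K\<^sup>2 * real n * (\<Sum>i\<in>?T. (g i)\<^sup>2)"
    using W unfolding op_bound_def w_def r2[symmetric] by blast
  finally have w: "(\<Sum>v\<in>?T. (w v)\<^sup>2) \<le> K\<^sup>2 * real n * (\<Sum>i\<in>?T. (g i)\<^sup>2)" .
  have "(\<Sum>v\<in>?T. ((\<Sum>i\<in>S. adj E v i * g i) - b)\<^sup>2) \<le> (\<Sum>v\<in>?T. 2 * (C\<^sup>2 * real n * (g v)\<^sup>2) + 2 * (w v)\<^sup>2)"
    by (intro sum_mono bound)
  also have "\<dots> = 2 * (C\<^sup>2 * real n * (\<Sum>v\<in>?T. (g v)\<^sup>2)) + 2 * (\<Sum>v\<in>?T. (w v)\<^sup>2)"
    by (simp add: sum.distrib sum_distrib_left)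
  also have "\<dots> \<le> 2 * (C\<^sup>2 + K\<^sup>2) * real n * (\<Sum>i\<in>?T. (g i)\<^sup>2)"
    using w by (simp add: algebra_simps)
  finally show ?thesis by blast
qed

text \<open>By the unit norm at most \<open>\<delta> * real n\<close> entries are large. If they
  carried mass \<open>q\<close> close to 1, the block on these columns would send them, up to an
  error governed by the mass \<open>1 - q\<close> elsewhere, to a constant vector. Nonconcentration
  thus gives \<open>c0\<^sup>2 * q \<le> B * (1 - q)\<close>, that is, a lower bound for
  \<open>1 - q\<close>.\<close>

lemma eigenvector_spread:
  assumes W: "op_bound p n E K" and n: "n \<ge> 1" and \<delta>: "0 < \<delta>" and c0: "c0 > 0"
    and nc: "nonconcentrated n E \<delta> 1 1 c0"
    and eps: "\<bar>\<epsilon>\<bar> * sqrt (real n) \<le> C"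
    and g1: "(\<Sum>i<n. (g i)\<^sup>2) = 1"
    and ev: "\<And>i. i < n \<Longrightarrow> (\<Sum>j<n. adj E i j * g j) = \<epsilon> * deg n E i * g i"
  shows "c0\<^sup>2 / (c0\<^sup>2 + 2 * (C\<^sup>2 + K\<^sup>2)) \<le> (\<Sum>i\<in>{i\<in>{..<n}. \<bar>g i\<bar> \<le> 1 / sqrt \<delta> / sqrt (real n)}. (g i)\<^sup>2)"
proof -
  let ?M = "1 / sqrt \<delta> / sqrt (real n)"
  define S where "S = {i\<in>{..<n}. \<bar>g i\<bar> > ?M}"
  define q where "q = (\<Sum>i\<in>S. (g i)\<^sup>2)"
  define B where "B = 2 * (C\<^sup>2 + K\<^sup>2)"
  have S: "S \<subseteq> {..<n}" by (auto simp: S_def)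
  have T: "{..<n} - S = {i\<in>{..<n}. \<bar>g i\<bar> \<le> ?M}" by (auto simp: S_def)
  have q1: "q + (\<Sum>i\<in>{..<n} - S. (g i)\<^sup>2) = 1"
    unfolding q_def using sum.subset_diff[OF S, of "\<lambda>i. (g i)\<^sup>2"] g1 by simp
  have q0: "q \<ge> 0" unfolding q_def by (intro sum_nonneg) auto
  have qle: "q \<le> 1" using q1 sum_nonneg[of "{..<n} - S" "\<lambda>i. (g i)\<^sup>2"] by simp
  have "(\<Sum>i\<in>S. ?M\<^sup>2) \<le> q" unfolding q_def
  proof (intro sum_mono)
    fix i assume "i \<in> S"
    then have "?M \<le> \<bar>g i\<bar>" by (auto simp: S_def)
    then have "?M\<^sup>2 \<le> \<bar>g i\<bar>\<^sup>2" using \<delta> by (intro power_mono) auto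
    then show "?M\<^sup>2 \<le> (g i)\<^sup>2" by simp
  qed
  then have "real (card S) * (1 / (\<delta> * real n)) \<le> 1"
    using qle \<delta> by (simp add: power_divide power_mult_distrib)
  then have card: "real (card S) \<le> \<delta> * real n" using \<delta> n by (simp add: field_simps)
  have B: "B \<ge> 0" by (simp add: B_def)
  have "c0\<^sup>2 * q \<le> B * (1 - q)"
  proof (cases "q = 0")
    case True
    then show ?thesis using B by simp
  next
    case False
    then have q: "q > 0" using q0 by simp
    obtain b where b: "(\<Sum>v\<in>{..<n} - S. ((\<Sum>i\<in>S. adj E v i * g i) - b)\<^sup>2) \<le> B * real n * (\<Sum>i\<in>{..<n} - S. (g i)\<^sup>2)"
      using eigenvector_restriction[OF W S eps ev] unfolding B_def by blast
    \<comment> \<open>Rescaling to a unit vector makes every coordinate at most 1, so the truncation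
      at 1 discards nothing; the constant \<open>b\<close> is rescaled along.\<close>
    let ?x = "\<lambda>i. g i / sqrt q"
    have x2: "(\<Sum>i\<in>S. (?x i)\<^sup>2) = 1"
      using q by (simp add: power_divide sum_divide_distrib[symmetric] q_def[symmetric])
    have "\<bar>?x i\<bar> \<le> 1" if "i \<in> S" for i
    proof -
      have "(?x i)\<^sup>2 \<le> (\<Sum>i\<in>S. (?x i)\<^sup>2)"
        using that finite_subset[OF S] by (intro member_le_sum) auto
      then show ?thesis unfolding x2 by (simp add: abs_square_le_1)
    qed
    then have "{i\<in>S. \<bar>?x i\<bar> \<le> 1} = S" by auto
    then have "c0\<^sup>2 * real n \<le> (\<Sum>v\<in>{..<n} - S. ((\<Sum>i\<in>S. adj E v i * ?x i) - b / sqrt q)\<^sup>2)"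
      using nc[unfolded nonconcentrated_def, rule_format, OF S card, of ?x "b / sqrt q"] x2 by simp
    also have "\<dots> = (\<Sum>v\<in>{..<n} - S. ((\<Sum>i\<in>S. adj E v i * g i) - b)\<^sup>2) / q"
      using q by (simp add: sum_divide_distrib[symmetric] diff_divide_distrib[symmetric] power_divide)
    finally have "c0\<^sup>2 * real n * q \<le> (\<Sum>v\<in>{..<n} - S. ((\<Sum>i\<in>S. adj E v i * g i) - b)\<^sup>2)"
      using q by (simp only: pos_le_divide_eq)
    also have "\<dots> \<le> B * real n * (\<Sum>i\<in>{..<n} - S. (g i)\<^sup>2)" by (rule b)
    also have "(\<Sum>i\<in>{..<n} - S. (g i)\<^sup>2) = 1 - q" using q1 by simp
    finally have "c0\<^sup>2 * real n * q \<le> B * real n * (1 - q)" .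
    then have "real n * (c0\<^sup>2 * q) \<le> real n * (B * (1 - q))" by (simp add: mult_ac)
    then show ?thesis using n by simp
  qed
  then have "c0\<^sup>2 \<le> (1 - q) * (c0\<^sup>2 + B)" by (simp add: algebra_simps)
  moreover have "c0\<^sup>2 + B > 0" using c0 B by (simp add: add_pos_nonneg)
  ultimately have "c0\<^sup>2 / (c0\<^sup>2 + B) \<le> 1 - q" by (simp add: pos_divide_le_eq)
  then show ?thesis using q1 unfolding T B_def by simp
qed

text \<open>Let \<open>S\<close> be the entries above \<omega>/n. The others have total mass at most
  \<omega>^2/n, so the block on the columns \<open>S\<close> maps \<open>g\<close> to within bounded
  squared distance of a constant vector. If \<open>S\<close> had at most \<alpha> n elements,
  nonconcentration would force this distance to be of order n. The factor 2 in \<open>spread\<close>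
  leaves mass \<open>\<tau>\<^sup>2\<close> inside \<open>S\<close> after the entries outside are
  removed.\<close>

lemma eigenvector_few_small_entries:
  assumes W: "op_bound p n E K" and n: "n \<ge> 1" and \<tau>: "\<tau> > 0"
    and nc: "nonconcentrated n E \<alpha> m \<tau> c"
    and eps: "\<bar>\<epsilon>\<bar> * sqrt (real n) \<le> C"
    and g1: "(\<Sum>i<n. (g i)\<^sup>2) = 1"
    and ev: "\<And>i. i < n \<Longrightarrow> (\<Sum>j<n. adj E i j * g j) = \<epsilon> * deg n E i * g i"
    and spread: "2 * \<tau>\<^sup>2 \<le> (\<Sum>i\<in>{i\<in>{..<n}. \<bar>g i\<bar> \<le> m}. (g i)\<^sup>2)"
    and large1: "\<omega>\<^sup>2 \<le> \<tau>\<^sup>2 * real n" and large2: "2 * (C\<^sup>2 + K\<^sup>2) * \<omega>\<^sup>2 < c\<^sup>2 * real n"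
  shows "\<alpha> * real n < real (card {v\<in>{..<n}. \<omega> / real n < \<bar>g v\<bar>})"
proof (rule ccontr)
  define S where "S = {v\<in>{..<n}. \<omega> / real n < \<bar>g v\<bar>}"
  assume "\<not> ?thesis"
  then have card: "real (card S) \<le> \<alpha> * real n" by (simp add: S_def)
  have S: "S \<subseteq> {..<n}" by (auto simp: S_def)
  let ?T = "{..<n} - S"
  have "(\<Sum>i\<in>?T. (g i)\<^sup>2) \<le> (\<Sum>i\<in>?T. (\<omega> / real n)\<^sup>2)"
  proof (intro sum_mono)
    fix i assume "i \<in> ?T"
    then have "\<bar>g i\<bar> \<le> \<omega> / real n" by (auto simp: S_def)
    then have "\<bar>g i\<bar>\<^sup>2 \<le> (\<omega> / real n)\<^sup>2" by (intro power_mono) auto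
    then show "(g i)\<^sup>2 \<le> (\<omega> / real n)\<^sup>2" by simp
  qed
  also have "\<dots> \<le> real n * (\<omega> / real n)\<^sup>2"
    using card_mono[of "{..<n}" ?T] by (simp add: mult_right_mono)
  also have "\<dots> = \<omega>\<^sup>2 / real n" using n by (simp add: power2_eq_square)
  finally have T: "(\<Sum>i\<in>?T. (g i)\<^sup>2) \<le> \<omega>\<^sup>2 / real n" .
  have T': "\<omega>\<^sup>2 / real n \<le> \<tau>\<^sup>2" using large1 n by (simp add: field_simps)
  have S1: "(\<Sum>i\<in>S. (g i)\<^sup>2) \<le> 1" unfolding g1[symmetric] using S by (intro sum_mono2) auto
  have "(\<Sum>i\<in>{i\<in>{..<n}. \<bar>g i\<bar> \<le> m}. (g i)\<^sup>2) \<le> (\<Sum>i\<in>{i\<in>S. \<bar>g i\<bar> \<le> m} \<union> ?T. (g i)\<^sup>2)"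
    using S finite_subset[OF S] by (intro sum_mono2) auto
  also have "\<dots> \<le> (\<Sum>i\<in>{i\<in>S. \<bar>g i\<bar> \<le> m}. (g i)\<^sup>2) + (\<Sum>i\<in>?T. (g i)\<^sup>2)"
    using finite_subset[OF S] by (subst sum.union_disjoint) auto
  finally have "\<tau>\<^sup>2 \<le> (\<Sum>i\<in>{i\<in>S. \<bar>g i\<bar> \<le> m}. (g i)\<^sup>2)" using spread T T' by linarith
  then have lower: "c\<^sup>2 * real n \<le> (\<Sum>v\<in>?T. ((\<Sum>i\<in>S. adj E v i * g i) - b)\<^sup>2)" for b
    using nc[unfolded nonconcentrated_def, rule_format, OF S card S1] by simp
  obtain b where "(\<Sum>v\<in>?T. ((\<Sum>i\<in>S. adj E v i * g i) - b)\<^sup>2) \<le> 2 * (C\<^sup>2 + K\<^sup>2) * real n * (\<Sum>i\<in>?T. (g i)\<^sup>2)"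
    using eigenvector_restriction[OF W S eps ev] by blast
  also have "\<dots> \<le> 2 * (C\<^sup>2 + K\<^sup>2) * real n * (\<omega>\<^sup>2 / real n)"
    using T by (intro mult_left_mono) auto
  also have "\<dots> = 2 * (C\<^sup>2 + K\<^sup>2) * \<omega>\<^sup>2" using n by simp
  finally show False using lower[of b] large2 by linarith
qed

section \<open>Counting edges and non-edges inside vertex sets\<close>

lemma card_ordered_pairs:
  assumes F: "F \<subseteq> vertex_pairs n"
  shows "card {(i, j). {i, j} \<in> F} = 2 * card F"
proof -
  have fin: "finite F" using finite_subset[OF F] by simp
  have "{(i, j). {i, j} \<in> F} = (\<Union>e\<in>F. {(i, j). {i, j} = e})" by auto
  also have "card \<dots> = (\<Sum>e\<in>F. card {(i, j). {i, j} = e})"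
  proof (rule card_UN_disjoint[OF fin])
    show "\<forall>e\<in>F. finite {(i, j). {i, j} = e}"
    proof
      fix e assume "e \<in> F"
      then have "e \<subseteq> {..<n}" using F by (auto simp: vertex_pairs_def)
      then have "{(i, j). {i, j} = e} \<subseteq> {..<n} \<times> {..<n}" by auto
      then show "finite {(i, j). {i, j} = e}" by (rule finite_subset) auto
    qed
  qed auto
  also have "\<dots> = (\<Sum>e\<in>F. 2)"
  proof (intro sum.cong refl)
    fix e assume "e \<in> F"
    then have "card e = 2" using F by (auto simp: vertex_pairs_def)
    then obtain a b where e: "e = {a, b}" "a \<noteq> b" by (meson card_2_iff)
    have "{(i, j). {i, j} = e} = {(a, b), (b, a)}" unfolding e(1) by (auto simp: doubleton_eq_iff)
    then show "card {(i, j). {i, j} = e} = 2" using e(2) by simp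
  qed
  finally show ?thesis by (simp add: mult.commute)
qed

lemma card_pairs_without_edge:
  assumes E: "E \<subseteq> vertex_pairs n" and P: "P \<subseteq> {..<n}"
  shows "real (card {(i, j). i \<in> P \<and> j \<in> P \<and> {i, j} \<in> non_edges n E})
    = (real (card P))\<^sup>2 - real (card P) - (\<Sum>i\<in>P. \<Sum>j\<in>P. adj E i j)"
proof -
  have fin: "finite P" using P finite_subset by auto
  have "{(i, j). i \<in> P \<and> j \<in> P \<and> {i, j} \<in> non_edges n E} = {q \<in> P \<times> P. fst q \<noteq> snd q \<and> {fst q, snd q} \<notin> E}"
    using P by (auto simp: non_edges_def vertex_pairs_def card_insert_if split: if_splits)
  then have "real (card {(i, j). i \<in> P \<and> j \<in> P \<and> {i, j} \<in> non_edges n E})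
      = (\<Sum>q\<in>P \<times> P. if fst q \<noteq> snd q \<and> {fst q, snd q} \<notin> E then 1 else 0)"
    using fin by (subst sum.inter_filter[symmetric]) auto
  also have "\<dots> = (\<Sum>i\<in>P. \<Sum>j\<in>P. if i \<noteq> j \<and> {i, j} \<notin> E then 1 else 0)"
    by (simp add: sum.cartesian_product case_prod_beta)
  also have "\<dots> = (\<Sum>i\<in>P. \<Sum>j\<in>P. 1 - (if i = j then 1 else 0) - adj E i j)"
  proof (intro sum.cong refl)
    fix i j
    have "{i} \<notin> E" using E by (auto simp: vertex_pairs_def)
    then show "(if i \<noteq> j \<and> {i, j} \<notin> E then 1 else 0) = 1 - (if i = j then 1 else 0) - adj E i j"
      by (auto simp: adj_def)
  qed
  also have "\<dots> = (real (card P))\<^sup>2 - real (card P) - (\<Sum>i\<in>P. \<Sum>j\<in>P. adj E i j)"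
    using fin by (simp add: sum_subtractf power2_eq_square algebra_simps)
  finally show ?thesis .
qed

text \<open>Expander mixing: the bilinear form of A - p J at the indicator vector of
  \<open>P\<close>, with \<open>card P\<close> finally replaced by n.\<close>

lemma edge_discrepancy:
  assumes W: "op_bound p n E K" and K: "K \<ge> 0" and P: "P \<subseteq> {..<n}"
  shows "\<bar>(\<Sum>i\<in>P. \<Sum>j\<in>P. adj E i j) - p * (real (card P))\<^sup>2\<bar> \<le> K * sqrt (real n) * real n"
proof -
  let ?x = "\<lambda>i. if i \<in> P then 1 else (0::real)"
  have fin: "finite P" using P finite_subset by auto
  have sum: "(\<Sum>i<n. if i \<in> P then f i else 0) = (\<Sum>i\<in>P. f i)" for f :: "nat \<Rightarrow> real"
    using P by (subst sum.inter_restrict[symmetric]) (auto simp: Int_absorb1)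
  have inner: "(\<Sum>j<n. (adj E i j - p) * ?x j) = (\<Sum>j\<in>P. adj E i j - p)" for i
    unfolding sum[symmetric] by (intro sum.cong refl) auto
  have "(\<Sum>i<n. ?x i * (\<Sum>j<n. (adj E i j - p) * ?x j)) = (\<Sum>i\<in>P. \<Sum>j\<in>P. adj E i j - p)"
    unfolding inner sum[symmetric] by (intro sum.cong refl) auto
  also have "\<dots> = (\<Sum>i\<in>P. \<Sum>j\<in>P. adj E i j) - p * (real (card P))\<^sup>2"
    by (simp add: sum_subtractf power2_eq_square)
  finally have "\<bar>(\<Sum>i\<in>P. \<Sum>j\<in>P. adj E i j) - p * (real (card P))\<^sup>2\<bar>
      \<le> K * sqrt (real n) * sqrt (\<Sum>i<n. (?x i)\<^sup>2) * sqrt (\<Sum>i<n. (?x i)\<^sup>2)"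
    using abs_bilinear_le[OF W K, of ?x ?x] by simp
  also have "(\<Sum>i<n. (?x i)\<^sup>2) = real (card P)"
  proof -
    have "(\<Sum>i<n. (?x i)\<^sup>2) = (\<Sum>i<n. if i \<in> P then 1 else 0)" by (intro sum.cong refl) auto
    then show ?thesis using sum[of "\<lambda>_. 1"] by simp
  qed
  also have "K * sqrt (real n) * sqrt (real (card P)) * sqrt (real (card P)) = K * sqrt (real n) * real (card P)"
    by (simp add: mult.assoc)
  also have "\<dots> \<le> K * sqrt (real n) * real n"
    using K card_mono[OF _ P] by (intro mult_left_mono) auto
  finally show ?thesis .
qed

text \<open>The loss in the criterion is at most C2 (a^2 + b^2) / sqrt n with a = |g u|, b = |g v|,
  where C2 adds the constant C of 1 - \<lambda> and 4 (1 + C) / p from the recentring. The upper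
  bound on one entry and the lower bound on the other give C2 a / sqrt n < b and C2 b / sqrt n < a;
  multiplying by a and b and adding yields a loss below 2 a b, which is the gain when the signs
  agree.\<close>

lemma gap_decreases_at_comparable_entries:
  assumes n: "n \<ge> 2" and E: "E \<subseteq> vertex_pairs n" and p: "0 < p"
    and d: "\<And>i. i < n \<Longrightarrow> deg n E i \<ge> real n * p / 2"
    and g0: "(\<Sum>i<n. deg n E i * g i) = 0"
    and ev: "\<And>i. i < n \<Longrightarrow> (\<Sum>j<n. adj E i j * g j) = (1 - spectral_gap n E) * deg n E i * g i"
    and eps: "\<bar>1 - spectral_gap n E\<bar> * sqrt (real n) \<le> C"
    and M: "M > 0" and \<omega>: "(C + 4 * (1 + C) / p) * M \<le> \<omega>"
    and uv: "{u, v} \<in> non_edges n E" and sign: "g u * g v > 0"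
    and u: "\<omega> / real n < \<bar>g u\<bar>" "\<bar>g u\<bar> \<le> M / sqrt (real n)"
    and v: "\<omega> / real n < \<bar>g v\<bar>" "\<bar>g v\<bar> \<le> M / sqrt (real n)"
  shows "spectral_gap n (insert {u, v} E) < spectral_gap n E"
proof -
  define l where "l = spectral_gap n E"
  define C2 where "C2 = C + 4 * (1 + C) / p"
  define s where "s = (g u)\<^sup>2 + (g v)\<^sup>2"
  define D where "D = (\<Sum>i<n. deg n E i) + 2"
  let ?r = "sqrt (real n)"
  have r: "?r \<ge> 1" "real n \<ge> 1" "?r * ?r = real n" using n by auto
  have C: "C \<ge> 0" using eps r(1) by (smt (verit) mult_nonneg_nonneg)
  have C2: "C2 > 0" unfolding C2_def using C p by (smt (verit) divide_pos_pos)
  have s: "s \<ge> 0" by (simp add: s_def)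
  have le: "\<bar>1 - l\<bar> \<le> C / ?r" using eps r(1) by (simp add: l_def field_simps)
  also have "\<dots> \<le> C" using mult_left_mono[OF r(1) C] r(1) by (simp add: field_simps)
  finally have labs: "\<bar>l\<bar> \<le> 1 + C" by linarith
  have D: "D \<ge> real n * ?r * p / 2"
  proof -
    have "real n * (real n * p / 2) \<le> (\<Sum>i<n. deg n E i)"
      using sum_bounded_below[of "{..<n}" "real n * p / 2" "deg n E"] d by simp
    moreover have "real n * ?r * p \<le> real n * real n * p"
      using p r by (intro mult_right_mono mult_left_mono) (auto intro: mult_left_le real_sqrt_le_iff[THEN iffD2] simp: sqrt_le_D real_le_lsqrt power2_eq_square)
    ultimately show ?thesis unfolding D_def by (simp add: mult_ac)
  qed
  \<comment> \<open>The degree sum is of order n^2, but order sqrt n already gives the recentring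
    term the same shape as the eigenvalue term.\<close>
  have "real n * ?r * p / 2 \<ge> ?r * p / 2" using p r by (simp add: mult_right_mono)
  then have D': "D \<ge> ?r * p / 2" using D by linarith
  have D0: "D > 0" using D' p r by (smt (verit) half_gt_zero mult_pos_pos)
  have "l * (g u + g v)\<^sup>2 / D \<le> (1 + C) * (2 * s) / (?r * p / 2)"
  proof (intro frac_le)
    show "l * (g u + g v)\<^sup>2 \<le> (1 + C) * (2 * s)"
    proof (intro mult_mono)
      show "(g u + g v)\<^sup>2 \<le> 2 * s"
        unfolding s_def using zero_le_power2[of "g u - g v"] by (simp add: power2_diff power2_sum)
    qed (use labs C in auto)
  qed (use D' p r C s in auto)
  also have "\<dots> = 4 * (1 + C) / p * s / ?r" using p r by (simp add: field_simps)
  finally have 1: "l * (g u + g v)\<^sup>2 / D \<le> 4 * (1 + C) / p * s / ?r" .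
  have "(1 - l) * s \<le> \<bar>1 - l\<bar> * s" using s by (intro mult_right_mono) auto
  also have "\<dots> \<le> C / ?r * s" using le s by (intro mult_right_mono) auto
  finally have 2: "(1 - l) * s + l * (g u + g v)\<^sup>2 / D \<le> C2 * (s / ?r)"
    using 1 unfolding C2_def by (simp add: algebra_simps add_divide_distrib)
  define a b where "a = \<bar>g u\<bar>" and "b = \<bar>g v\<bar>"
  have ab: "a \<ge> 0" "b \<ge> 0" "a > 0" "b > 0" using sign by (auto simp: a_def b_def)
  have quot: "C2 * (x / ?r) < y" if "\<omega> / real n < y" "x \<le> M / ?r" for x y
  proof -
    have "C2 * (x / ?r) \<le> C2 * ((M / ?r) / ?r)"
      using that C2 r by (intro mult_left_mono divide_right_mono) auto
    also have "\<dots> = C2 * M / real n" using r(3) by simp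
    also have "\<dots> \<le> \<omega> / real n" using \<omega> unfolding C2_def by (intro divide_right_mono) auto
    finally show ?thesis using that(1) by simp
  qed
  have "C2 * (s / ?r) = a * (C2 * (a / ?r)) + b * (C2 * (b / ?r))"
    unfolding s_def a_def b_def using r by (simp add: field_simps power2_eq_square)
  also have "\<dots> < a * b + b * a"
    using quot[of b a] quot[of a b] u v ab
    by (intro add_strict_mono mult_strict_left_mono) (auto simp: a_def b_def)
  also have "a * b = g u * g v" unfolding a_def b_def abs_mult[symmetric] using sign by simp
  also have "b * a = g u * g v" unfolding a_def b_def using sign by (simp add: abs_mult[symmetric] mult.commute)
  finally have crit: "(1 - l) * s + l * (g u + g v)\<^sup>2 / D < 2 * g u * g v" using 2 by linarith
  have dpos: "deg n E i > 0" if "i < n" for i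
    using d[OF that] p r by (smt (verit) half_gt_zero mult_pos_pos)
  have uv': "{u, v} \<notin> E" "u \<noteq> v" "u < n" "v < n"
    using uv by (auto simp: non_edges_def vertex_pairs_def)
  show ?thesis
    by (rule gap_decrease_criterion[OF n dpos uv' g0 ev])
      (use crit in \<open>simp_all add: l_def s_def D_def\<close>)
qed

text \<open>All randomness sits in the hypotheses; what remains is counting ordered pairs. Edge
  discrepancy gives non-edges density 1 - p both inside the two sign classes and in the whole graph,
  so this factor cancels from the ratio. One \<eta> is lost because (1/2 - 2 \<eta>)^2 / 2 is at
  least 1/8 - \<eta>, the other pays for errors of order n^(3/2).\<close>

lemma gap_decrease_proportion_lower_bound:
  assumes n: "n \<ge> 2" and E: "E \<subseteq> vertex_pairs n" and p: "0 < p" "p < 1"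
    and \<eta>: "0 < \<eta>" "\<eta> \<le> 1 / 32" and K: "K \<ge> 0" and \<delta>: "\<delta> > 0" and c0: "c0 > 0"
    and W: "op_bound p n E K"
    and d: "\<And>i. i < n \<Longrightarrow> deg n E i \<ge> real n * p / 2"
    and C: "C = 2 / p * (K + K\<^sup>2 / p)"
    and \<tau>: "\<tau> > 0" "2 * \<tau>\<^sup>2 \<le> c0\<^sup>2 / (c0\<^sup>2 + 2 * (C\<^sup>2 + K\<^sup>2))"
    and nc0: "nonconcentrated n E \<delta> 1 1 c0"
    and nc: "nonconcentrated n E (1 / 2 - \<eta>) (1 / sqrt \<delta> / sqrt (real n)) \<tau> c"
    and \<omega>: "(C + 4 * (1 + C) / p) * (1 / sqrt \<eta>) \<le> \<omega>"
    and large1: "\<omega>\<^sup>2 \<le> \<tau>\<^sup>2 * real n" and large2: "2 * (C\<^sup>2 + K\<^sup>2) * \<omega>\<^sup>2 < c\<^sup>2 * real n"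
    and large3: "3 * K + 2 \<le> (1 - p) * \<eta> * sqrt (real n)"
  shows "1 / 8 - 2 * \<eta> \<le> gap_decrease_proportion n E"
proof -
  let ?r = "sqrt (real n)"
  define l where "l = spectral_gap n E"
  have r: "?r \<ge> 1" "real n \<ge> 1" "?r * ?r = real n" using n by auto
  have dpos: "deg n E i > 0" if "i < n" for i
    using d[OF that] p r by (smt (verit) half_gt_zero mult_pos_pos)
  obtain g where g0: "(\<Sum>i<n. deg n E i * g i) = 0" and g1: "(\<Sum>i<n. (g i)\<^sup>2) = 1"
    and ev: "\<And>i. i < n \<Longrightarrow> (\<Sum>j<n. adj E i j * g j) = (1 - l) * deg n E i * g i"
    using spectral_gap_variational(1)[OF n dpos] unfolding l_def by blast
  have n1: "n \<ge> 1" using n by simp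
  have eps: "\<bar>1 - l\<bar> * ?r \<le> C"
    unfolding C by (rule eigenvalue_near_one[OF n1 p(1) K W d g0 g1 ev])
  have spread: "2 * \<tau>\<^sup>2 \<le> (\<Sum>i\<in>{i\<in>{..<n}. \<bar>g i\<bar> \<le> 1 / sqrt \<delta> / ?r}. (g i)\<^sup>2)"
    using eigenvector_spread[OF W n1 \<delta> c0 nc0 eps g1 ev] \<tau>(2) by simp
  \<comment> \<open>With this value the unit norm allows at most \<eta> n entries above M / sqrt
    n.\<close>
  define M where "M = 1 / sqrt \<eta>"
  have M: "M > 0" using \<eta> by (simp add: M_def)
  define S where "S = {v\<in>{..<n}. \<omega> / real n < \<bar>g v\<bar>}"
  define L where "L = {v\<in>{..<n}. \<bar>g v\<bar> > M / ?r}"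
  define G where "G = S - L"
  define P where "P = {v \<in> G. g v > 0}"
  define Q where "Q = {v \<in> G. g v < 0}"
  have fin: "finite S" "finite L" "finite G" "finite P" "finite Q"
    by (auto simp: S_def L_def G_def P_def Q_def)
  have \<omega>0: "\<omega> \<ge> 0"
  proof -
    have "C \<ge> 0" unfolding C using p K by simp
    then have "0 \<le> (C + 4 * (1 + C) / p) * (1 / sqrt \<eta>)" using p \<eta> by simp
    then show ?thesis using \<omega> by simp
  qed
  have "real (card S) > (1 / 2 - \<eta>) * real n"
    unfolding S_def by (rule eigenvector_few_small_entries[OF W n1 \<tau>(1) nc eps g1 ev spread large1 large2])
  moreover have "real (card L) \<le> \<eta> * real n"
  proof -
    have "(\<Sum>i\<in>L. (M / ?r)\<^sup>2) \<le> (\<Sum>i\<in>L. (g i)\<^sup>2)"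
    proof (intro sum_mono)
      fix i assume "i \<in> L"
      then have "M / ?r \<le> \<bar>g i\<bar>" by (auto simp: L_def)
      then have "(M / ?r)\<^sup>2 \<le> \<bar>g i\<bar>\<^sup>2" using M by (intro power_mono) auto
      then show "(M / ?r)\<^sup>2 \<le> (g i)\<^sup>2" by simp
    qed
    also have "\<dots> \<le> 1" unfolding g1[symmetric] by (intro sum_mono2) (auto simp: L_def)
    finally have "real (card L) * (1 / (\<eta> * real n)) \<le> 1"
      using \<eta> by (simp add: M_def power_divide power_mult_distrib)
    then show ?thesis using \<eta> r by (simp add: field_simps)
  qed
  moreover have "card S \<le> card L + card G"
    using card_mono[of "L \<union> G" S] card_Un_le[of L G] fin by (auto simp: G_def)
  ultimately have cG: "(1 / 2 - 2 * \<eta>) * real n \<le> real (card G)" by (simp add: algebra_simps)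
  have "G = P \<union> Q"
  proof -
    have "g v \<noteq> 0" if "v \<in> G" for v
      using that divide_nonneg_nonneg[OF \<omega>0, of "real n"] by (auto simp: G_def S_def)
    then show ?thesis by (auto simp: P_def Q_def neq_iff)
  qed
  moreover have "P \<inter> Q = {}" by (auto simp: P_def Q_def)
  ultimately have cPQ: "card G = card P + card Q" using fin by (simp add: card_Un_disjoint)
  have PQn: "P \<subseteq> {..<n}" "Q \<subseteq> {..<n}" by (auto simp: P_def Q_def G_def S_def)
  define F where "F = {e \<in> non_edges n E. spectral_gap n (insert e E) < spectral_gap n E}"
  define N where "N = non_edges n E"
  let ?op = "\<lambda>P. {(i, j). i \<in> P \<and> j \<in> P \<and> {i, j} \<in> non_edges n E}"
  have FN: "F \<subseteq> vertex_pairs n" "N \<subseteq> vertex_pairs n" "F \<subseteq> N" by (auto simp: F_def N_def non_edges_def)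
  have finN: "finite N" using FN(2) finite_subset finite_vertex_pairs by blast
  have finop: "finite (?op P)" if "P \<subseteq> {..<n}" for P
    by (rule finite_subset[of _ "{..<n} \<times> {..<n}"]) (use that in auto)
  have dec: "{u, v} \<in> F" if "u \<in> G" "v \<in> G" "g u * g v > 0" "{u, v} \<in> non_edges n E" for u v
    unfolding F_def using that
      gap_decreases_at_comparable_entries[OF n E p(1) d g0 ev[unfolded l_def] eps[unfolded l_def] M \<omega>[folded M_def]]
    by (auto simp: G_def S_def L_def not_less)
  have sub: "?op P \<union> ?op Q \<subseteq> {(i, j). {i, j} \<in> F}"
  proof safe
    fix i j assume "i \<in> P" "j \<in> P" "{i, j} \<in> non_edges n E"
    then show "{i, j} \<in> F" by (intro dec) (auto simp: P_def)
  next
    fix i j assume "i \<in> Q" "j \<in> Q" "{i, j} \<in> non_edges n E"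
    then show "{i, j} \<in> F" by (intro dec) (auto simp: Q_def mult_neg_neg)
  qed
  have "finite {(i, j). {i, j} \<in> F}"
    by (rule finite_subset[of _ "{..<n} \<times> {..<n}"]) (use FN(1) in \<open>auto simp: vertex_pairs_def\<close>)
  then have "card (?op P \<union> ?op Q) \<le> 2 * card F"
    using card_mono[OF _ sub] card_ordered_pairs[OF FN(1)] by simp
  moreover have "card (?op P \<union> ?op Q) = card (?op P) + card (?op Q)"
    using finop PQn \<open>P \<inter> Q = {}\<close> by (intro card_Un_disjoint) auto
  ultimately have F2: "real (card (?op P)) + real (card (?op Q)) \<le> 2 * real (card F)" by simp
  have lower: "(1 - p) * (real (card P))\<^sup>2 - real n - K * ?r * real n \<le> real (card (?op P))" if "P \<subseteq> {..<n}" for P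
  proof -
    have "real (card P) \<le> real n" using card_mono[OF _ that] by simp
    then show ?thesis
      unfolding card_pairs_without_edge[OF E that]
      using edge_discrepancy[OF W K that] by (simp add: algebra_simps abs_le_iff)
  qed
  have "2 * real (card N) = real (card (?op {..<n}))"
  proof -
    have "{(i, j). {i, j} \<in> N} = ?op {..<n}" by (auto simp: N_def non_edges_def vertex_pairs_def)
    then show ?thesis using card_ordered_pairs[OF FN(2)] by simp
  qed
  also have "\<dots> \<le> (1 - p) * (real n)\<^sup>2 + K * ?r * real n"
    unfolding card_pairs_without_edge[OF E order.refl]
    using edge_discrepancy[OF W K order.refl] by (simp add: algebra_simps abs_le_iff)
  finally have N2: "2 * real (card N) \<le> (1 - p) * (real n)\<^sup>2 + K * ?r * real n" .
  define a where "a = real (card G)"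
  have sq: "a\<^sup>2 / 2 \<le> (real (card P))\<^sup>2 + (real (card Q))\<^sup>2"
    unfolding a_def cPQ using zero_le_power2[of "real (card P) - real (card Q)"]
    by (simp add: power2_diff power2_sum)
  have "((1 / 2 - 2 * \<eta>) * real n)\<^sup>2 \<le> a\<^sup>2" unfolding a_def using cG \<eta> by (intro power_mono) auto
  moreover have "(1 / 4 - 2 * \<eta>) * (real n)\<^sup>2 \<le> ((1 / 2 - 2 * \<eta>) * real n)\<^sup>2"
    unfolding power_mult_distrib by (intro mult_right_mono) (auto simp: power2_eq_square algebra_simps)
  ultimately have "(1 / 8 - \<eta>) * (real n)\<^sup>2 \<le> (real (card P))\<^sup>2 + (real (card Q))\<^sup>2"
    using sq by (simp add: algebra_simps)
  then have "(1 - p) * ((1 / 8 - \<eta>) * (real n)\<^sup>2) \<le> (1 - p) * ((real (card P))\<^sup>2 + (real (card Q))\<^sup>2)"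
    using p by (intro mult_left_mono) auto
  also have "\<dots> \<le> 2 * real (card F) + 2 * real n + 2 * (K * ?r * real n)"
    using F2 lower[OF PQn(1)] lower[OF PQn(2)] by (simp add: algebra_simps)
  finally have F3: "(1 - p) * ((1 / 8 - \<eta>) * (real n)\<^sup>2) \<le> 2 * real (card F) + 2 * real n + 2 * (K * ?r * real n)" .
  \<comment> \<open>The error budget: a discrepancy term \<open>K\<close> for each of the two sign
    classes and for the whole graph, and one linear term for the diagonal of each sign
    class.\<close>
  have "real n * ?r * (3 * K + 2) \<le> real n * ?r * ((1 - p) * \<eta> * ?r)"
    using large3 r by (intro mult_left_mono) auto
  also have "\<dots> = (1 - p) * \<eta> * (real n * (?r * ?r))" by (simp only: mult_ac)
  finally have big: "real n * ?r * (3 * K + 2) \<le> (1 - p) * \<eta> * (real n)\<^sup>2" unfolding r(3) by (simp add: power2_eq_square)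
  have nr: "real n \<le> real n * ?r" using r mult_left_mono[OF r(1), of "real n"] by simp
  have Knr: "K * ?r * real n \<ge> 0" using K r by simp
  have key: "(1 / 8 - 2 * \<eta>) * real (card N) \<le> real (card F)"
  proof -
    have "(1 / 8 - 2 * \<eta>) * (2 * real (card N)) \<le> (1 / 8 - 2 * \<eta>) * ((1 - p) * (real n)\<^sup>2 + K * ?r * real n)"
      using N2 \<eta> by (intro mult_left_mono) auto
    also have "\<dots> \<le> (1 / 8 - 2 * \<eta>) * ((1 - p) * (real n)\<^sup>2) + K * ?r * real n"
      unfolding distrib_left using Knr \<eta> by (intro add_left_mono mult_left_le_one_le) auto
    also have "\<dots> = (1 - p) * ((1 / 8 - \<eta>) * (real n)\<^sup>2) - (1 - p) * \<eta> * (real n)\<^sup>2 + K * ?r * real n"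
      by (simp add: field_simps)
    also have "\<dots> \<le> 2 * real (card F) + 2 * real n + 2 * (K * ?r * real n) - real n * ?r * (3 * K + 2) + K * ?r * real n"
      using F3 big by linarith
    also have "\<dots> \<le> 2 * real (card F)" using nr by (simp add: algebra_simps)
    finally show ?thesis by simp
  qed
  \<comment> \<open>The ratio equals 0 by convention if there are no non-edges, so their existence
    has to be established before dividing.\<close>
  have "real (card F) > 0"
  proof -
    have "(1 - p) * ((1 / 8 - \<eta>) * (real n)\<^sup>2) = (1 - p) * ((1 / 8 - 2 * \<eta>) * (real n)\<^sup>2) + (1 - p) * \<eta> * (real n)\<^sup>2"
      by (simp add: algebra_simps)
    moreover have "(1 - p) * ((1 / 8 - 2 * \<eta>) * (real n)\<^sup>2) > 0" using p \<eta> r by (intro mult_pos_pos) auto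
    moreover have "real n * ?r * (3 * K + 2) = 3 * (K * ?r * real n) + 2 * (real n * ?r)" by (simp add: algebra_simps)
    ultimately show ?thesis using F3 big nr Knr by linarith
  qed
  then have "card F > 0" by simp
  then have "card N > 0" using card_mono[OF finN FN(3)] by linarith
  then show ?thesis
    unfolding gap_decrease_proportion_def F_def[symmetric]
    unfolding N_def[symmetric] using key by (simp add: le_divide_eq)
qed

section \<open>Random subsets\<close>

definition subset_weight :: "real \<Rightarrow> 'a set \<Rightarrow> 'a set \<Rightarrow> real" where
  "subset_weight p I X = p ^ card X * (1 - p) ^ card (I - X)"

text \<open>The expectation over a random subset of \<open>I\<close> containing each element independently with
  probability \<open>p\<close>.\<close>

definition bexp :: "real \<Rightarrow> 'a set \<Rightarrow> ('a set \<Rightarrow> 'b :: real_normed_field) \<Rightarrow> 'b" where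
  "bexp p I F = (\<Sum>X\<in>Pow I. of_real (subset_weight p I X) * F X)"

lemma subset_weight_nonneg: "0 \<le> p \<Longrightarrow> p \<le> 1 \<Longrightarrow> subset_weight p I X \<ge> 0"
  by (simp add: subset_weight_def)

lemma bexp_mono:
  fixes F G :: "'a set \<Rightarrow> real"
  assumes "0 \<le> p" "p \<le> 1" "\<And>X. X \<subseteq> I \<Longrightarrow> F X \<le> G X"
  shows "bexp p I F \<le> bexp p I G"
  unfolding bexp_def using assms by (intro sum_mono mult_left_mono) (auto intro: subset_weight_nonneg)

lemma bexp_nonneg:
  fixes F :: "'a set \<Rightarrow> real"
  assumes "0 \<le> p" "p \<le> 1" "\<And>X. X \<subseteq> I \<Longrightarrow> F X \<ge> 0"
  shows "bexp p I F \<ge> 0"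
  unfolding bexp_def using assms by (intro sum_nonneg mult_nonneg_nonneg) (auto intro: subset_weight_nonneg)

lemma bexp_add: "bexp p I (\<lambda>X. F X + G X) = bexp p I F + bexp p I G"
  unfolding bexp_def by (simp add: distrib_left sum.distrib)

lemma bexp_sum: "bexp p I (\<lambda>X. \<Sum>a\<in>A. F a X) = (\<Sum>a\<in>A. bexp p I (F a))"
  unfolding bexp_def by (subst sum.swap) (simp add: sum_distrib_left)

lemma bexp_mult_left: "bexp p I (\<lambda>X. c * F X) = c * bexp p I F"
  unfolding bexp_def by (simp add: sum_distrib_left mult_ac)

text \<open>Expanding a product of two-term sums produces one summand per subset. The complex case
  serves characteristic functions, the real case exponential moments.\<close>

lemma bexp_prod:
  assumes "finite I"
  shows "bexp p I (\<lambda>X. \<Prod>e\<in>I. h e (e \<in> X)) = (\<Prod>e\<in>I. of_real p * h e True + of_real (1 - p) * h e False)"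
proof -
  have "(\<Prod>e\<in>I. of_real p * h e True + of_real (1 - p) * h e False)
      = (\<Sum>X\<in>Pow I. (\<Prod>e\<in>X. of_real p * h e True) * (\<Prod>e\<in>I - X. of_real (1 - p) * h e False))"
    by (rule prod_add[OF assms])
  also have "\<dots> = bexp p I (\<lambda>X. \<Prod>e\<in>I. h e (e \<in> X))"
    unfolding bexp_def
  proof (intro sum.cong refl)
    fix X assume "X \<in> Pow I"
    then have X: "X \<subseteq> I" by simp
    have "(\<Prod>e\<in>I. h e (e \<in> X)) = (\<Prod>e\<in>I - X. h e (e \<in> X)) * (\<Prod>e\<in>X. h e (e \<in> X))"
      by (rule prod.subset_diff[OF X assms])
    also have "\<dots> = (\<Prod>e\<in>I - X. h e False) * (\<Prod>e\<in>X. h e True)"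
      by (intro arg_cong2[where f = "(*)"] prod.cong refl) auto
    finally show "(\<Prod>e\<in>X. of_real p * h e True) * (\<Prod>e\<in>I - X. of_real (1 - p) * h e False)
        = of_real (subset_weight p I X) * (\<Prod>e\<in>I. h e (e \<in> X))"
      by (simp add: subset_weight_def prod.distrib mult_ac)
  qed
  finally show ?thesis ..
qed

lemma bexp_const:
  fixes c :: "'b :: real_normed_field"
  assumes "finite I"
  shows "bexp p I (\<lambda>_. c) = c"
  using bexp_prod[OF assms, of p "\<lambda>_ _. 1 :: 'b"] bexp_mult_left[of p I c "\<lambda>_. 1"]
  by (simp flip: of_real_add)

lemma subset_weight_Un:
  assumes "finite A" "finite B" "A \<inter> B = {}" "Y \<subseteq> A" "Z \<subseteq> B"
  shows "subset_weight p (A \<union> B) (Y \<union> Z) = subset_weight p A Y * subset_weight p B Z"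
proof -
  have fin: "finite Y" "finite Z" using assms finite_subset by blast+
  have "card (Y \<union> Z) = card Y + card Z" using fin assms by (intro card_Un_disjoint) auto
  moreover have "(A \<union> B) - (Y \<union> Z) = (A - Y) \<union> (B - Z)" using assms by auto
  moreover have "card ((A - Y) \<union> (B - Z)) = card (A - Y) + card (B - Z)"
    using assms by (intro card_Un_disjoint) auto
  ultimately show ?thesis by (simp add: subset_weight_def power_add mult_ac)
qed

lemma bexp_indep:
  assumes "finite A" "finite B" "A \<inter> B = {}"
  shows "bexp p (A \<union> B) (\<lambda>X. F (X \<inter> A) * G (X \<inter> B)) = bexp p A F * bexp p B G"
proof -
  let ?u = "\<lambda>(Y, Z). Y \<union> Z"
  have bij: "bij_betw ?u (Pow A \<times> Pow B) (Pow (A \<union> B))"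
    by (rule bij_betwI[where g = "\<lambda>X. (X \<inter> A, X \<inter> B)"]) (use assms(3) in auto)
  have "bexp p (A \<union> B) (\<lambda>X. F (X \<inter> A) * G (X \<inter> B))
      = (\<Sum>q\<in>Pow A \<times> Pow B. of_real (subset_weight p (A \<union> B) (?u q)) * (F (?u q \<inter> A) * G (?u q \<inter> B)))"
    unfolding bexp_def by (rule sum.reindex_bij_betw[OF bij, symmetric])
  also have "\<dots> = (\<Sum>(Y, Z)\<in>Pow A \<times> Pow B. (of_real (subset_weight p A Y) * F Y) * (of_real (subset_weight p B Z) * G Z))"
  proof (intro sum.cong refl)
    fix q assume "q \<in> Pow A \<times> Pow B"
    then obtain Y Z where q: "q = (Y, Z)" and YZ: "Y \<subseteq> A" "Z \<subseteq> B" by auto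
    then have "(Y \<union> Z) \<inter> A = Y" "(Y \<union> Z) \<inter> B = Z" using assms(3) by auto
    then show "of_real (subset_weight p (A \<union> B) (?u q)) * (F (?u q \<inter> A) * G (?u q \<inter> B))
        = (case q of (Y, Z) \<Rightarrow> (of_real (subset_weight p A Y) * F Y) * (of_real (subset_weight p B Z) * G Z))"
      unfolding q using subset_weight_Un[OF assms YZ, of p] by simp
  qed
  also have "\<dots> = bexp p A F * bexp p B G"
    unfolding bexp_def sum_product by (simp add: sum.cartesian_product)
  finally show ?thesis .
qed

text \<open>Independence over pairwise disjoint blocks, splitting off one block at a time; elements
  in no block are averaged out in the base case.\<close>

lemma bexp_blocks:
  assumes "finite T" "finite I" "\<And>v. v \<in> T \<Longrightarrow> B v \<subseteq> I"
    and "\<And>v w. v \<in> T \<Longrightarrow> w \<in> T \<Longrightarrow> v \<noteq> w \<Longrightarrow> B v \<inter> B w = {}"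
  shows "bexp p I (\<lambda>X. \<Prod>v\<in>T. F v (X \<inter> B v)) = (\<Prod>v\<in>T. bexp p (B v) (F v))"
  using assms
proof (induction T arbitrary: I rule: finite_induct)
  case empty
  then show ?case by (simp add: bexp_const)
next
  case (insert t T)
  have Bt: "B t \<subseteq> I" "finite (B t)" using insert.prems(1,2) finite_subset[of "B t" I] by auto
  have sub: "B v \<subseteq> I - B t" if "v \<in> T" for v
    using insert.prems(2)[of v] insert.prems(3)[of v t] that insert.hyps(2) by auto
  have "bexp p I (\<lambda>X. \<Prod>v\<in>insert t T. F v (X \<inter> B v))
      = bexp p (B t \<union> (I - B t)) (\<lambda>X. F t (X \<inter> B t) * (\<Prod>v\<in>T. F v (X \<inter> (I - B t) \<inter> B v)))"
  proof -
    have I: "B t \<union> (I - B t) = I" using Bt by auto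
    have "F v (X \<inter> (I - B t) \<inter> B v) = F v (X \<inter> B v)" if "v \<in> T" for v X
      using sub[OF that] by (intro arg_cong[where f = "F v"]) auto
    then show ?thesis unfolding I using insert.hyps by simp
  qed
  also have "\<dots> = bexp p (B t) (F t) * bexp p (I - B t) (\<lambda>X. \<Prod>v\<in>T. F v (X \<inter> B v))"
    using Bt insert.prems(1) by (intro bexp_indep) auto
  also have "bexp p (I - B t) (\<lambda>X. \<Prod>v\<in>T. F v (X \<inter> B v)) = (\<Prod>v\<in>T. bexp p (B v) (F v))"
    by (rule insert.IH) (use insert.prems sub in auto)
  finally show ?case using insert.hyps by simp
qed

text \<open>Replaces the measure by a finite weighted sum. Almost every sampled function is False
  off \<open>vertex_pairs n\<close>, so an edge set has a single relevant preimage.\<close>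

lemma prob_erdos_renyi:
  assumes p: "0 \<le> p" "p \<le> 1"
  shows "measure_pmf.prob (erdos_renyi n p) A = bexp p (vertex_pairs n) (indicator A)"
proof -
  let ?V = "vertex_pairs n"
  let ?P = "Pi_pmf ?V False (\<lambda>_. bernoulli_pmf p)"
  let ?f = "\<lambda>X e. e \<in> X"
  have fin: "finite ?V" by (rule finite_vertex_pairs)
  have pmfX: "pmf (erdos_renyi n p) X = subset_weight p ?V X" if "X \<subseteq> ?V" for X
  proof -
    have "pmf (erdos_renyi n p) X = measure_pmf.prob ?P ((\<lambda>f. {e \<in> ?V. f e}) -` {X})"
      unfolding erdos_renyi_def by (simp add: pmf_map)
    also have "\<dots> = measure_pmf.prob ?P {?f X}"
    proof (rule measure_eq_AE)
      show "AE f in measure_pmf ?P. (f \<in> (\<lambda>f. {e \<in> ?V. f e}) -` {X}) = (f \<in> {?f X})"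
      proof (rule AE_pmfI)
        fix f assume "f \<in> set_pmf ?P"
        then have "\<And>e. e \<notin> ?V \<Longrightarrow> f e = False" using set_Pi_pmf_subset[OF fin, of False "\<lambda>_. bernoulli_pmf p"] by auto
        then show "(f \<in> (\<lambda>f. {e \<in> ?V. f e}) -` {X}) = (f \<in> {?f X})" using that by auto
      qed
    qed auto
    also have "\<dots> = pmf ?P (?f X)" by (simp add: measure_pmf_single)
    also have "\<dots> = (\<Prod>e\<in>?V. pmf (bernoulli_pmf p) (e \<in> X))"
      using that by (subst pmf_Pi[OF fin]) auto
    also have "\<dots> = (\<Prod>e\<in>?V - X. pmf (bernoulli_pmf p) (e \<in> X)) * (\<Prod>e\<in>X. pmf (bernoulli_pmf p) (e \<in> X))"
      by (rule prod.subset_diff[OF that fin])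
    also have "\<dots> = (\<Prod>e\<in>?V - X. 1 - p) * (\<Prod>e\<in>X. p)"
      using p by (intro arg_cong2[where f = "(*)"] prod.cong refl) auto
    finally show ?thesis by (simp add: subset_weight_def)
  qed
  have set: "set_pmf (erdos_renyi n p) \<subseteq> Pow ?V" unfolding erdos_renyi_def by auto
  have "measure_pmf.prob (erdos_renyi n p) A = measure_pmf.expectation (erdos_renyi n p) (indicator A :: _ \<Rightarrow> real)"
    by simp
  also have "\<dots> = (\<Sum>X\<in>Pow ?V. pmf (erdos_renyi n p) X *\<^sub>R indicator A X)"
    by (rule integral_measure_pmf[OF _ ]) (use fin set in auto)
  also have "\<dots> = bexp p ?V (indicator A)" unfolding bexp_def by (intro sum.cong refl) (simp add: pmfX)
  finally show ?thesis .
qed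

section \<open>Small-ball and exponential moment bounds\<close>

text \<open>By the half-angle formula this is 2 sin(u/2)^2, and |sin x| is at least 5/6 |x| for |x|
  at most 1/2; 2 * 25/144 exceeds 1/4.\<close>

lemma one_minus_cos_ge:
  fixes u :: real
  assumes "\<bar>u\<bar> \<le> 1"
  shows "1 - cos u \<ge> u\<^sup>2 / 4"
proof -
  let ?x = "u / 2"
  have "\<bar>sin ?x - (\<Sum>m<3. sin_coeff m * ?x ^ m)\<bar> \<le> inverse (fact 3) * \<bar>?x\<bar> ^ 3"
    by (rule Maclaurin_sin_bound)
  moreover have "(\<Sum>m<3. sin_coeff m * ?x ^ m) = ?x" by (simp add: numeral_3_eq_3 sin_coeff_def)
  moreover have "inverse (fact 3) * \<bar>?x\<bar> ^ 3 \<le> \<bar>?x\<bar> / 6"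
  proof -
    have "\<bar>?x\<bar> ^ 3 \<le> \<bar>?x\<bar> ^ 1" using assms by (intro power_decreasing) auto
    then show ?thesis by (simp add: fact_numeral)
  qed
  ultimately have "\<bar>sin ?x - ?x\<bar> \<le> \<bar>?x\<bar> / 6" by linarith
  then have "5 / 6 * \<bar>?x\<bar> \<le> \<bar>sin ?x\<bar>" by linarith
  then have "(5 / 6 * \<bar>?x\<bar>)\<^sup>2 \<le> \<bar>sin ?x\<bar>\<^sup>2" by (intro power_mono) auto
  then have "25 / 144 * u\<^sup>2 \<le> (sin ?x)\<^sup>2" by (simp add: power_mult_distrib power_divide)
  moreover have "cos u = 1 - 2 * (sin ?x)\<^sup>2" using cos_double_sin[of ?x] by simp
  moreover have "u\<^sup>2 \<ge> 0" by simp
  ultimately show ?thesis by linarith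
qed

lemma norm_bernoulli_char_sq:
  "(cmod (of_real p * iexp u + of_real (1 - p)))\<^sup>2 = 1 - 2 * p * (1 - p) * (1 - cos u)"
proof -
  have "(cmod (of_real p * iexp u + of_real (1 - p)))\<^sup>2 = (p * cos u + (1 - p))\<^sup>2 + (p * sin u)\<^sup>2"
    unfolding cmod_power2 by (simp add: Re_exp Im_exp)
  also have "\<dots> = p\<^sup>2 * ((cos u)\<^sup>2 + (sin u)\<^sup>2) + 2 * p * (1 - p) * cos u + (1 - p)\<^sup>2"
  proof -
    have "(p * c + (1 - p))\<^sup>2 + (p * s)\<^sup>2 = p\<^sup>2 * (c\<^sup>2 + s\<^sup>2) + 2 * p * (1 - p) * c + (1 - p)\<^sup>2" for c s
      by (simp add: power2_eq_square algebra_simps)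
    then show ?thesis .
  qed
  also have "\<dots> = p\<^sup>2 * 1 + 2 * p * (1 - p) * cos u + (1 - p)\<^sup>2"
    by (simp only: sin_cos_squared_add2)
  finally show ?thesis by (simp add: power2_eq_square algebra_simps)
qed

lemma norm_bernoulli_char_le_1:
  assumes "0 \<le> p" "p \<le> 1"
  shows "cmod (of_real p * iexp u + of_real (1 - p)) \<le> 1"
proof -
  have "cmod (of_real p * iexp u + of_real (1 - p)) \<le> cmod (of_real p * iexp u) + cmod (of_real (1 - p))"
    by (rule norm_triangle_ineq)
  also have "\<dots> = \<bar>p\<bar> + \<bar>1 - p\<bar>"
    by (simp only: norm_mult norm_of_real norm_exp_i_times mult_1_right)
  finally show ?thesis using assms by simp
qed

text \<open>The restriction on \<open>u\<close> is essential, since the characteristic function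
  returns to modulus 1 at multiples of 2 pi. This is why only coordinates of bounded size contribute
  to the small-ball estimate.\<close>

lemma norm_bernoulli_char_le_exp:
  assumes p: "0 \<le> p" "p \<le> 1" and u: "\<bar>u\<bar> \<le> 1"
  shows "cmod (of_real p * iexp u + of_real (1 - p)) \<le> exp (- (p * (1 - p) / 4 * u\<^sup>2))"
proof (rule power2_le_imp_le)
  have "2 * p * (1 - p) * (u\<^sup>2 / 4) \<le> 2 * p * (1 - p) * (1 - cos u)"
    using p one_minus_cos_ge[OF u] by (intro mult_left_mono) auto
  then have "(cmod (of_real p * iexp u + of_real (1 - p)))\<^sup>2 \<le> 1 + - (p * (1 - p) / 2 * u\<^sup>2)"
    unfolding norm_bernoulli_char_sq by simp
  also have "\<dots> \<le> exp (- (p * (1 - p) / 2 * u\<^sup>2))" by (rule exp_ge_add_one_self)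
  also have "\<dots> = (exp (- (p * (1 - p) / 4 * u\<^sup>2)))\<^sup>2"
    by (simp add: power2_eq_square flip: exp_add)
  finally show "(cmod (of_real p * iexp u + of_real (1 - p)))\<^sup>2 \<le> (exp (- (p * (1 - p) / 4 * u\<^sup>2)))\<^sup>2" .
qed simp

lemma integral_std_normal_exp_neg_square:
  assumes "c \<ge> 0"
  shows "(LINT x|std_normal_distribution. exp (- (c * x\<^sup>2))) = 1 / sqrt (1 + 2 * c)"
proof -
  define s where "s = 1 / sqrt (1 + 2 * c)"
  have s: "s > 0" "1 / s\<^sup>2 = 1 + 2 * c" using assms by (auto simp: s_def power_divide)
  have eq: "std_normal_density x * exp (- (c * x\<^sup>2)) = s * normal_density 0 s x" for x
  proof -
    have "- x\<^sup>2 / 2 + - (c * x\<^sup>2) = - (x\<^sup>2 / 2) * (1 / s\<^sup>2)" unfolding s(2) by (simp add: algebra_simps)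
    then have "exp (- x\<^sup>2 / 2) * exp (- (c * x\<^sup>2)) = exp (- (x - 0)\<^sup>2 / (2 * s\<^sup>2))"
      unfolding exp_add[symmetric] by simp
    moreover have "sqrt (2 * pi * s\<^sup>2) = sqrt (2 * pi) * s" using s(1) by (simp add: real_sqrt_mult)
    ultimately show ?thesis using s(1) unfolding normal_density_def std_normal_density_def
      by (simp add: field_simps)
  qed
  have "(LINT x|std_normal_distribution. exp (- (c * x\<^sup>2))) = (LINT x|lborel. std_normal_density x * exp (- (c * x\<^sup>2)))"
    by (subst integral_density) (auto simp: normal_density_nonneg)
  also have "\<dots> = s" unfolding eq using s(1) by simp
  finally show ?thesis by (simp add: s_def)
qed

text \<open>Writing the Gaussian as the characteristic function of a Gaussian turns the small-ball
  quantity into an average of the product of the characteristic functions of the summands.\<close>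

lemma small_ball_bernoulli_sum:
  assumes p: "0 \<le> p" "p \<le> 1" and fin: "finite J" and \<rho>: "\<rho> > 0" and m: "m \<ge> 0"
    and s: "s\<^sup>2 \<le> (\<Sum>e\<in>{e\<in>J. \<bar>y e\<bar> \<le> m}. (y e)\<^sup>2)"
  shows "bexp p J (\<lambda>X. exp (- (((\<Sum>e\<in>J. of_bool (e \<in> X) * y e) - b)\<^sup>2 / (2 * \<rho>\<^sup>2))))
    \<le> 1 / sqrt (1 + p * (1 - p) * s\<^sup>2 / (2 * \<rho>\<^sup>2)) + 3 * (m / \<rho>) ^ 4"
proof -
  interpret real_distribution std_normal_distribution by (rule real_dist_normal_dist)
  let ?N = std_normal_distribution
  define Y where "Y = (\<lambda>X. ((\<Sum>e\<in>J. of_bool (e \<in> X) * y e) - b) / \<rho>)"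
  define \<phi> where "\<phi> = (\<lambda>u. of_real p * iexp u + of_real (1 - p) :: complex)"
  define \<Phi> where "\<Phi> = (\<lambda>t. iexp (- (b / \<rho>) * t) * (\<Prod>e\<in>J. \<phi> (y e / \<rho> * t)))"
  define c where "c = p * (1 - p) / 4 * s\<^sup>2 / \<rho>\<^sup>2"
  have c: "c \<ge> 0" using p by (simp add: c_def)
  have int: "integrable ?N (\<lambda>t. iexp (a * t))" for a
    by (rule integrable_const_bound[of _ 1]) auto
  have char: "of_real (exp (- (a\<^sup>2) / 2)) = (CLINT t|?N. iexp (a * t))" for a
    using char_std_normal_distribution unfolding char_def by metis
  have "of_real (bexp p J (\<lambda>X. exp (- (((\<Sum>e\<in>J. of_bool (e \<in> X) * y e) - b)\<^sup>2 / (2 * \<rho>\<^sup>2)))))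
      = (\<Sum>X\<in>Pow J. of_real (subset_weight p J X) * of_real (exp (- ((Y X)\<^sup>2) / 2)))"
    unfolding bexp_def of_real_sum of_real_mult Y_def by (simp add: power_divide mult.commute)
  also have "\<dots> = (CLINT t|?N. (\<Sum>X\<in>Pow J. of_real (subset_weight p J X) * iexp (Y X * t)))"
    unfolding char by (subst Bochner_Integration.integral_sum) (use int in auto)
  also have "(\<lambda>t. (\<Sum>X\<in>Pow J. of_real (subset_weight p J X) * iexp (Y X * t))) = \<Phi>"
  proof
    fix t
    have "(\<Sum>X\<in>Pow J. of_real (subset_weight p J X) * iexp (Y X * t))
        = bexp p J (\<lambda>X. iexp (- (b / \<rho>) * t) * (\<Prod>e\<in>J. iexp (of_bool (e \<in> X) * (y e / \<rho> * t))))"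
      unfolding bexp_def
    proof (intro sum.cong refl arg_cong2[where f = "(*)"])
      fix X
      have "\<i> * complex_of_real (Y X * t) = \<i> * of_real (- (b / \<rho>) * t) + (\<Sum>e\<in>J. \<i> * of_real (of_bool (e \<in> X) * (y e / \<rho> * t)))"
        unfolding Y_def by (simp add: sum_distrib_left sum_distrib_right diff_divide_distrib sum_divide_distrib algebra_simps)
      then show "iexp (Y X * t) = iexp (- (b / \<rho>) * t) * (\<Prod>e\<in>J. iexp (of_bool (e \<in> X) * (y e / \<rho> * t)))"
        by (simp only: exp_add exp_sum[OF fin])
    qed
    also have "\<dots> = \<Phi> t"
      unfolding bexp_mult_left \<Phi>_def \<phi>_def
      by (subst bexp_prod[OF fin, of p "\<lambda>e c. iexp (of_bool c * (y e / \<rho> * t))"]) simp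
    finally show "(\<Sum>X\<in>Pow J. of_real (subset_weight p J X) * iexp (Y X * t)) = \<Phi> t" .
  qed
  finally have eq: "of_real (bexp p J (\<lambda>X. exp (- (((\<Sum>e\<in>J. of_bool (e \<in> X) * y e) - b)\<^sup>2 / (2 * \<rho>\<^sup>2)))))
      = (CLINT t|?N. \<Phi> t)" .
  have n1: "cmod (\<phi> u) \<le> 1" for u unfolding \<phi>_def using p by (rule norm_bernoulli_char_le_1)
  have \<Phi>: "cmod (\<Phi> t) = (\<Prod>e\<in>J. cmod (\<phi> (y e / \<rho> * t)))" for t
    unfolding \<Phi>_def norm_mult prod_norm[symmetric] by simp
  have \<Phi>1: "cmod (\<Phi> t) \<le> 1" for t unfolding \<Phi> by (intro prod_le_1) (auto intro: n1)
  \<comment> \<open>For |t| at most \<rho>/m the factors with coordinate at most \<open>m\<close>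
    decay like a Gaussian and the others are bounded by 1. For larger t the trivial bound 1 is below
    (m |t| / \<rho>)^4, whose Gaussian average is 3 (m / \<rho>)^4.\<close>
  have bound: "cmod (\<Phi> t) \<le> exp (- (c * t\<^sup>2)) + (m / \<rho>) ^ 4 * t ^ 4" for t
  proof -
    show ?thesis
    proof (cases "m / \<rho> * \<bar>t\<bar> \<le> 1")
      case True
      let ?J = "{e\<in>J. \<bar>y e\<bar> \<le> m}"
      have "cmod (\<Phi> t) = (\<Prod>e\<in>J - ?J. cmod (\<phi> (y e / \<rho> * t))) * (\<Prod>e\<in>?J. cmod (\<phi> (y e / \<rho> * t)))"
        unfolding \<Phi> by (rule prod.subset_diff) (use fin in auto)
      also have "\<dots> \<le> 1 * (\<Prod>e\<in>?J. exp (- (p * (1 - p) / 4 * (y e / \<rho> * t)\<^sup>2)))"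
      proof (intro mult_mono prod_le_1 prod_mono conjI)
        fix e assume e: "e \<in> ?J"
        have "\<bar>y e / \<rho> * t\<bar> \<le> m / \<rho> * \<bar>t\<bar>"
          using e \<rho> by (auto simp: abs_mult intro!: mult_right_mono divide_right_mono)
        then show "cmod (\<phi> (y e / \<rho> * t)) \<le> exp (- (p * (1 - p) / 4 * (y e / \<rho> * t)\<^sup>2))"
          unfolding \<phi>_def using True p by (intro norm_bernoulli_char_le_exp) auto
      qed (auto intro: n1 prod_nonneg)
      also have "\<dots> = exp (- (p * (1 - p) / 4 / \<rho>\<^sup>2 * t\<^sup>2 * (\<Sum>e\<in>?J. (y e)\<^sup>2)))"
        using fin by (simp add: exp_sum[symmetric] sum_negf sum_distrib_left sum_divide_distrib power_mult_distrib power_divide mult_ac)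
      also have "\<dots> \<le> exp (- (p * (1 - p) / 4 / \<rho>\<^sup>2 * t\<^sup>2 * s\<^sup>2))"
        unfolding exp_le_cancel_iff neg_le_iff_le using s p by (intro mult_left_mono) auto
      also have "\<dots> = exp (- (c * t\<^sup>2))" by (simp add: c_def mult_ac)
      also have "\<dots> \<le> exp (- (c * t\<^sup>2)) + (m / \<rho>) ^ 4 * t ^ 4" by simp
      finally show ?thesis .
    next
      case False
      note \<Phi>1[of t]
      also have "1 \<le> (m / \<rho> * \<bar>t\<bar>) ^ 4" using False by (intro one_le_power) auto
      also have "\<dots> = (m / \<rho>) ^ 4 * t ^ 4" unfolding power_mult_distrib by (simp add: power_even_abs)
      also have "\<dots> \<le> exp (- (c * t\<^sup>2)) + (m / \<rho>) ^ 4 * t ^ 4" by simp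
      finally show ?thesis .
    qed
  qed
  have i1: "integrable ?N (\<lambda>t. exp (- (c * t\<^sup>2)))"
    by (rule integrable_const_bound[of _ 1]) (use c in auto)
  have i2: "integrable ?N (\<lambda>t. t ^ 4)" by (rule integrable_std_normal_distribution_moment)
  have "bexp p J (\<lambda>X. exp (- (((\<Sum>e\<in>J. of_bool (e \<in> X) * y e) - b)\<^sup>2 / (2 * \<rho>\<^sup>2))))
      \<le> cmod (CLINT t|?N. \<Phi> t)"
    unfolding eq[symmetric] by simp
  also have "\<dots> \<le> (LINT t|?N. exp (- (c * t\<^sup>2)) + (m / \<rho>) ^ 4 * t ^ 4)"
  proof (rule order_trans[OF Bochner_Integration.integral_norm_bound integral_mono])
    have "\<Phi> \<in> borel_measurable ?N" unfolding \<Phi>_def \<phi>_def by measurable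
    then show "integrable ?N (\<lambda>t. cmod (\<Phi> t))"
      using \<Phi>1 by (intro integrable_norm integrable_const_bound[of _ 1]) auto
    show "integrable ?N (\<lambda>t. exp (- (c * t\<^sup>2)) + (m / \<rho>) ^ 4 * t ^ 4)" using i1 i2 by simp
    show "cmod (\<Phi> t) \<le> exp (- (c * t\<^sup>2)) + (m / \<rho>) ^ 4 * t ^ 4" for t by (rule bound)
  qed
  also have "\<dots> = 1 / sqrt (1 + 2 * c) + (m / \<rho>) ^ 4 * 3"
    using i1 i2 std_normal_distribution_even_moments(1)[of 2]
    by (simp add: integral_std_normal_exp_neg_square[OF c] fact_numeral)
  finally show ?thesis by (simp add: c_def mult_ac)
qed

text \<open>Hoeffding's lemma for a centred Bernoulli variable; negative \<open>s\<close> is reduced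
  to positive by exchanging \<open>p\<close> and \<open>1 - p\<close>.\<close>

lemma bernoulli_mgf_le:
  fixes p s :: real
  assumes p: "0 \<le> p" "p \<le> 1"
  shows "p * exp (s * (1 - p)) + (1 - p) * exp (- (s * p)) \<le> exp (s\<^sup>2 / 8)"
proof -
  have pos: "q * exp (h * (1 - q)) + (1 - q) * exp (- (h * q)) \<le> exp (h\<^sup>2 / 8)"
    if "h \<ge> 0" "0 \<le> q" "q \<le> 1" for h q :: real
  proof -
    have "q * (exp h - 1) \<ge> 0" using that by simp
    then have g: "1 + q * (exp h - 1) > 0" by linarith
    have "q * exp (h * (1 - q)) + (1 - q) * exp (- (h * q)) = exp (- h * q) * (1 + q * (exp h - 1))"
      by (simp add: algebra_simps exp_diff exp_minus field_simps)
    also have "\<dots> = exp (- h * q + ln (1 + q * (exp h - 1)))" using g by (simp only: exp_add exp_ln)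
    also have "\<dots> \<le> exp (h\<^sup>2 / 8)" using Hoeffdings_lemma_aux[OF that(1,2)] by simp
    finally show ?thesis .
  qed
  show ?thesis
  proof (cases "s \<ge> 0")
    case True
    then show ?thesis using p by (intro pos)
  next
    case False
    then have "(1 - p) * exp (- s * (1 - (1 - p))) + (1 - (1 - p)) * exp (- (- s * (1 - p))) \<le> exp ((- s)\<^sup>2 / 8)"
      using p by (intro pos) auto
    then show ?thesis by simp
  qed
qed

lemma bexp_exp_sum_le:
  assumes p: "0 \<le> p" "p \<le> 1" and fin: "finite I"
  shows "bexp p I (\<lambda>X. exp (\<Sum>e\<in>I. s e * (of_bool (e \<in> X) - p))) \<le> exp ((\<Sum>e\<in>I. (s e)\<^sup>2) / 8)"
proof -
  have "bexp p I (\<lambda>X. exp (\<Sum>e\<in>I. s e * (of_bool (e \<in> X) - p)))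
      = (\<Prod>e\<in>I. p * exp (s e * (1 - p)) + (1 - p) * exp (- (s e * p)))"
    using bexp_prod[OF fin, of p "\<lambda>e c. exp (s e * (of_bool c - p))"]
    by (simp add: exp_sum[OF fin])
  also have "\<dots> \<le> (\<Prod>e\<in>I. exp ((s e)\<^sup>2 / 8))"
    using p by (intro prod_mono conjI bernoulli_mgf_le add_nonneg_nonneg mult_nonneg_nonneg) auto
  also have "\<dots> = exp ((\<Sum>e\<in>I. (s e)\<^sup>2) / 8)" by (simp add: exp_sum[OF fin, symmetric] sum_divide_distrib)
  finally show ?thesis .
qed

lemma bexp_union_bound:
  assumes p: "0 \<le> p" "p \<le> 1" and A: "finite A"
    and cover: "\<And>X. X \<subseteq> I \<Longrightarrow> P X \<Longrightarrow> \<exists>a\<in>A. Q a X"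
    and le: "\<And>a. a \<in> A \<Longrightarrow> bexp p I (indicator {X. Q a X}) \<le> c"
  shows "bexp p I (indicator {X. P X}) \<le> real (card A) * (c :: real)"
proof -
  have "bexp p I (indicator {X. P X}) \<le> bexp p I (\<lambda>X. \<Sum>a\<in>A. indicator {X. Q a X} X :: real)"
  proof (rule bexp_mono[OF p])
    fix X assume X: "X \<subseteq> I"
    show "indicator {X. P X} X \<le> (\<Sum>a\<in>A. indicator {X. Q a X} X :: real)"
    proof (cases "P X")
      case True
      then obtain a where a: "a \<in> A" "Q a X" using cover X by blast
      then have "indicator {X. Q a X} X \<le> (\<Sum>a\<in>A. indicator {X. Q a X} X :: real)"
        using A by (intro member_le_sum) auto
      then show ?thesis using a True by simp
    qed (auto intro: sum_nonneg)
  qed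
  also have "\<dots> = (\<Sum>a\<in>A. bexp p I (indicator {X. Q a X}))" by (rule bexp_sum)
  also have "\<dots> \<le> (\<Sum>a\<in>A. c)" by (intro sum_mono le)
  finally show ?thesis by simp
qed

lemma bexp_markov_exp:
  assumes p: "0 \<le> p" "p \<le> 1" and le: "bexp p I (\<lambda>X. exp (f X)) \<le> M"
    and imp: "\<And>X. X \<subseteq> I \<Longrightarrow> P X \<Longrightarrow> t \<le> f X"
  shows "bexp p I (indicator {X. P X}) \<le> exp (- t) * (M :: real)"
proof -
  have "bexp p I (indicator {X. P X}) \<le> bexp p I (\<lambda>X. exp (- t) * exp (f X))"
    by (rule bexp_mono[OF p]) (auto simp: indicator_def exp_minus_inverse imp simp flip: exp_add)
  also have "\<dots> = exp (- t) * bexp p I (\<lambda>X. exp (f X))" by (rule bexp_mult_left)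
  also have "\<dots> \<le> exp (- t) * M" using le by simp
  finally show ?thesis .
qed

section \<open>Nets\<close>

text \<open>Since x^2 >= 2 |x| - 1, the sum is dominated by two geometric series of ratio exp(-2
  \<theta>). The 9 is 2 * 3 * (3/2), from e <= 3 and 1 / (1 - r) <= 3 / (2 \<theta>).\<close>

lemma theta_sum_le:
  assumes \<theta>: "0 < \<theta>" "\<theta> \<le> 1"
  shows "(\<Sum>k\<in>{-M..M}. exp (- (\<theta> * real_of_int k)\<^sup>2)) \<le> 9 / \<theta>"
proof -
  define r where "r = exp (- 2 * \<theta>)"
  have r: "0 < r" "r < 1" using \<theta> by (auto simp: r_def)
  have bound: "exp (- (\<theta> * real_of_int k)\<^sup>2) \<le> exp 1 * r ^ n" if "\<bar>k\<bar> = int n" for k n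
  proof -
    have kn: "\<bar>real_of_int k\<bar> = real n" using that by (metis of_int_abs of_int_of_nat_eq)
    have "(\<theta> * real_of_int k)\<^sup>2 = (\<theta> * real n)\<^sup>2" unfolding power_mult_distrib kn[symmetric] by simp
    moreover have "(\<theta> * real n - 1)\<^sup>2 \<ge> 0" by simp
    ultimately have "- (\<theta> * real_of_int k)\<^sup>2 \<le> 1 - 2 * (\<theta> * real n)" by (simp add: power2_diff)
    also have "\<dots> = 1 + real n * (- 2 * \<theta>)" by simp
    finally have "- (\<theta> * real_of_int k)\<^sup>2 \<le> 1 + real n * (- 2 * \<theta>)" .
    then show ?thesis unfolding r_def exp_of_nat_mult[symmetric] exp_add[symmetric] by simp
  qed
  have "(\<Sum>k\<in>{-M..M}. exp (- (\<theta> * real_of_int k)\<^sup>2))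
      \<le> (\<Sum>k\<in>int ` {..nat M} \<union> (\<lambda>n. - int n) ` {..nat M}. exp (- (\<theta> * real_of_int k)\<^sup>2))"
  proof (intro sum_mono2)
    show "{-M..M} \<subseteq> int ` {..nat M} \<union> (\<lambda>n. - int n) ` {..nat M}"
    proof
      fix k assume "k \<in> {-M..M}"
      then show "k \<in> int ` {..nat M} \<union> (\<lambda>n. - int n) ` {..nat M}"
        by (cases "k \<ge> 0") (auto simp: image_iff intro: bexI[of _ "nat k"] bexI[of _ "nat (- k)"])
    qed
  qed auto
  also have "\<dots> \<le> (\<Sum>k\<in>int ` {..nat M}. exp (- (\<theta> * real_of_int k)\<^sup>2)) + (\<Sum>k\<in>(\<lambda>n. - int n) ` {..nat M}. exp (- (\<theta> * real_of_int k)\<^sup>2))"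
    using sum.union_inter[of "int ` {..nat M}" "(\<lambda>n. - int n) ` {..nat M}" "\<lambda>k. exp (- (\<theta> * real_of_int k)\<^sup>2)"]
      sum_nonneg[of "int ` {..nat M} \<inter> (\<lambda>n. - int n) ` {..nat M}" "\<lambda>k. exp (- (\<theta> * real_of_int k)\<^sup>2)"]
    by simp
  also have "\<dots> = (\<Sum>n\<le>nat M. exp (- (\<theta> * real_of_int (int n))\<^sup>2)) + (\<Sum>n\<le>nat M. exp (- (\<theta> * real_of_int (- int n))\<^sup>2))"
    by (subst (1 2) sum.reindex) (auto simp: inj_on_def)
  also have "\<dots> \<le> (\<Sum>n\<le>nat M. exp 1 * r ^ n) + (\<Sum>n\<le>nat M. exp 1 * r ^ n)"
    by (intro add_mono sum_mono bound) auto
  also have "\<dots> = 2 * exp 1 * (\<Sum>n\<le>nat M. r ^ n)" by (simp add: sum_distrib_left mult.assoc)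
  also have "(\<Sum>n\<le>nat M. r ^ n) \<le> 1 / (1 - r)"
  proof -
    have "(1 - r) * (\<Sum>n\<le>nat M. r ^ n) = 1 - r ^ Suc (nat M)" by (rule sum_gp_basic)
    also have "\<dots> \<le> 1" using r by simp
    finally show ?thesis using r by (simp add: field_simps)
  qed
  also have "1 / (1 - r) \<le> 3 / (2 * \<theta>)"
  proof -
    have "r * (1 + 2 * \<theta>) \<le> r * exp (2 * \<theta>)" using r by (intro mult_left_mono exp_ge_add_one_self) auto
    also have "\<dots> = 1" by (simp add: r_def flip: exp_add)
    finally have "2 * \<theta> \<le> (1 - r) * (1 + 2 * \<theta>)" by (simp add: algebra_simps)
    also have "\<dots> \<le> (1 - r) * 3" using r \<theta> by (intro mult_left_mono) auto
    finally show ?thesis using r \<theta> by (simp add: field_simps)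
  qed
  also have "2 * exp 1 * (3 / (2 * \<theta>)) \<le> 9 / \<theta>"
    using exp_le \<theta> by (simp add: divide_right_mono)
  finally show ?thesis using r by simp
qed

text \<open>Lattice points of the unit ball. The mesh is tied to an upper bound \<open>N\<close> for
  the dimension, so that rounding every coordinate moves a vector by at most \<theta> in norm;
  \<open>z\<close> is extensional because arbitrary values outside \<open>S\<close> would make the
  set infinite.\<close>

definition grid :: "'a set \<Rightarrow> real \<Rightarrow> real \<Rightarrow> ('a \<Rightarrow> real) set" where
  "grid S N \<theta> = (\<lambda>z i. \<theta> / sqrt N * real_of_int (z i)) `
    {z \<in> S \<rightarrow>\<^sub>E UNIV. (\<Sum>i\<in>S. (real_of_int (z i))\<^sup>2) \<le> N / \<theta>\<^sup>2}"

text \<open>Every lattice point of the ball has Gaussian weight at least exp(-N), and the weights of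
  a whole box sum to a product of one-dimensional sums, each at most 9/\<theta>. With e <= 3 this
  gives 27/\<theta> per dimension.\<close>

lemma card_grid:
  assumes S: "finite S" "real (card S) \<le> N" and \<theta>: "0 < \<theta>" "\<theta> \<le> 1"
  shows "finite (grid S N \<theta>)" and "real (card (grid S N \<theta>)) \<le> (27 / \<theta>) powr N"
proof -
  let ?Z = "{z \<in> S \<rightarrow>\<^sub>E UNIV. (\<Sum>i\<in>S. (real_of_int (z i))\<^sup>2) \<le> N / \<theta>\<^sup>2}"
  define M where "M = \<lfloor>N / \<theta>\<^sup>2\<rfloor>"
  let ?B = "S \<rightarrow>\<^sub>E {-M..M}"
  have fB: "finite ?B" using S(1) by (intro finite_PiE) auto
  have sub: "?Z \<subseteq> ?B"
  proof
    fix z assume z: "z \<in> ?Z"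
    have "z i \<in> {-M..M}" if "i \<in> S" for i
    proof -
      have "(real_of_int (z i))\<^sup>2 \<le> (\<Sum>i\<in>S. (real_of_int (z i))\<^sup>2)"
        using that S(1) by (intro member_le_sum) auto
      then have "real_of_int ((z i)\<^sup>2) \<le> N / \<theta>\<^sup>2" using z by simp
      then have "(z i)\<^sup>2 \<le> M" unfolding M_def by (simp add: le_floor_iff)
      \<comment> \<open>For integers the square dominates the absolute value, so a bound on squares
        also bounds the box.\<close>
      moreover have "\<bar>z i\<bar> \<le> (z i)\<^sup>2"
        using self_le_power[of "\<bar>z i\<bar>" 2] by (cases "z i = 0") auto
      ultimately show ?thesis by auto
    qed
    then show "z \<in> ?B" using z by (auto simp: PiE_iff)
  qed
  have fZ: "finite ?Z" using sub fB finite_subset by blast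
  show fin: "finite (grid S N \<theta>)" unfolding grid_def using fZ by (rule finite_imageI)
  have "real (card (grid S N \<theta>)) \<le> real (card ?Z)" unfolding grid_def using card_image_le[OF fZ] by simp
  also have "\<dots> = (\<Sum>z\<in>?Z. 1)" by simp
  also have "\<dots> \<le> (\<Sum>z\<in>?Z. exp N * (\<Prod>i\<in>S. exp (- (\<theta> * real_of_int (z i))\<^sup>2)))"
  proof (intro sum_mono)
    fix z assume "z \<in> ?Z"
    then have "\<theta>\<^sup>2 * (\<Sum>i\<in>S. (real_of_int (z i))\<^sup>2) \<le> \<theta>\<^sup>2 * (N / \<theta>\<^sup>2)" by (intro mult_left_mono) auto
    then have "0 \<le> N + (\<Sum>i\<in>S. - (\<theta> * real_of_int (z i))\<^sup>2)"
      using \<theta> by (simp add: power_mult_distrib sum_distrib_left sum_negf)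
    then have "1 \<le> exp (N + (\<Sum>i\<in>S. - (\<theta> * real_of_int (z i))\<^sup>2))" by simp
    then show "1 \<le> exp N * (\<Prod>i\<in>S. exp (- (\<theta> * real_of_int (z i))\<^sup>2))"
      by (simp only: exp_add exp_sum[OF S(1)])
  qed
  also have "\<dots> \<le> (\<Sum>z\<in>?B. exp N * (\<Prod>i\<in>S. exp (- (\<theta> * real_of_int (z i))\<^sup>2)))"
    by (intro sum_mono2[OF fB sub]) (auto intro!: mult_nonneg_nonneg prod_nonneg)
  also have "\<dots> = exp N * (\<Prod>i\<in>S. \<Sum>k\<in>{-M..M}. exp (- (\<theta> * real_of_int k)\<^sup>2))"
    unfolding sum_distrib_left[symmetric] using S(1) by (subst prod_sum_PiE) auto
  also have "\<dots> \<le> exp N * (\<Prod>i\<in>S. 9 / \<theta>)"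
    using theta_sum_le[OF \<theta>] by (intro mult_left_mono prod_mono) (auto intro: sum_nonneg)
  also have "\<dots> = exp N * (9 / \<theta>) powr real (card S)" using \<theta> by (simp add: powr_realpow)
  also have "\<dots> \<le> 3 powr N * (9 / \<theta>) powr N"
  proof (intro mult_mono powr_mono)
    have "exp N = exp 1 powr N" by (simp add: powr_def)
    also have "\<dots> \<le> 3 powr N" using S(2) exp_le by (intro powr_mono2) auto
    finally show "exp N \<le> 3 powr N" .
    show "1 \<le> 9 / \<theta>" using \<theta> by simp
  qed (use S in auto)
  also have "\<dots> = (27 / \<theta>) powr N" using \<theta> by (simp flip: powr_mult)
  finally show "real (card (grid S N \<theta>)) \<le> (27 / \<theta>) powr N" .
qed

text \<open>Rounding towards zero instead of to the nearest point never enlarges a coordinate, so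
  both the unit ball and the truncation at \<open>m\<close> are respected.\<close>

lemma round_towards_zero:
  assumes "h > 0"
  shows "\<exists>k::int. \<bar>h * real_of_int k\<bar> \<le> \<bar>x\<bar> \<and> \<bar>x - h * real_of_int k\<bar> \<le> h"
proof -
  have pos: "\<bar>h * real_of_int \<lfloor>y / h\<rfloor>\<bar> \<le> y \<and> \<bar>y - h * real_of_int \<lfloor>y / h\<rfloor>\<bar> \<le> h" if "y \<ge> 0" for y
  proof -
    have "0 \<le> h * real_of_int \<lfloor>y / h\<rfloor>" using assms that by simp
    moreover have "h * real_of_int \<lfloor>y / h\<rfloor> \<le> h * (y / h)" using assms by (intro mult_left_mono) auto
    moreover have "h * (y / h) \<le> h * (real_of_int \<lfloor>y / h\<rfloor> + 1)" using assms by (intro mult_left_mono) linarith+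
    ultimately show ?thesis using assms by (simp add: algebra_simps)
  qed
  show ?thesis
  proof (cases "x \<ge> 0")
    case True
    then show ?thesis using pos[OF True] by (intro exI[of _ "\<lfloor>x / h\<rfloor>"]) auto
  next
    case False
    then show ?thesis using pos[of "- x"] by (intro exI[of _ "- \<lfloor>(- x) / h\<rfloor>"]) (auto simp: abs_if split: if_splits)
  qed
qed

lemma grid_approximation:
  assumes S: "finite S" "real (card S) \<le> N" "N > 0" and \<theta>: "\<theta> > 0" and x: "(\<Sum>i\<in>S. (x i)\<^sup>2) \<le> 1"
  shows "\<exists>y\<in>grid S N \<theta>. (\<forall>i\<in>S. \<bar>y i\<bar> \<le> \<bar>x i\<bar>) \<and> (\<Sum>i\<in>S. (x i - y i)\<^sup>2) \<le> \<theta>\<^sup>2"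
proof -
  let ?h = "\<theta> / sqrt N"
  have h: "?h > 0" using S \<theta> by simp
  have h2: "?h\<^sup>2 = \<theta>\<^sup>2 / N" using S by (simp add: power_divide)
  have "\<forall>i. \<exists>k::int. \<bar>?h * real_of_int k\<bar> \<le> \<bar>x i\<bar> \<and> \<bar>x i - ?h * real_of_int k\<bar> \<le> ?h"
    using round_towards_zero[OF h] by blast
  then obtain k :: "_ \<Rightarrow> int" where k: "\<And>i. \<bar>?h * real_of_int (k i)\<bar> \<le> \<bar>x i\<bar>" "\<And>i. \<bar>x i - ?h * real_of_int (k i)\<bar> \<le> ?h"
    by metis
  define z where "z = restrict k S"
  let ?y = "\<lambda>i. ?h * real_of_int (z i)"
  have z: "z i = k i" if "i \<in> S" for i using that by (simp add: z_def)
  have "?h\<^sup>2 * (\<Sum>i\<in>S. (real_of_int (z i))\<^sup>2) = (\<Sum>i\<in>S. (?h * real_of_int (k i))\<^sup>2)"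
    unfolding sum_distrib_left by (intro sum.cong refl) (simp add: z power_mult_distrib power_divide)
  also have "\<dots> \<le> (\<Sum>i\<in>S. (x i)\<^sup>2)"
    using k(1) by (intro sum_mono) (simp only: abs_le_square_iff[symmetric])
  finally have "?h\<^sup>2 * (\<Sum>i\<in>S. (real_of_int (z i))\<^sup>2) \<le> 1" using x by simp
  then have "(\<Sum>i\<in>S. (real_of_int (z i))\<^sup>2) \<le> N / \<theta>\<^sup>2" unfolding h2 using S \<theta> by (simp add: field_simps)
  then have "?y \<in> grid S N \<theta>" unfolding grid_def by (intro imageI) (auto simp: z_def)
  moreover have "(\<Sum>i\<in>S. (x i - ?y i)\<^sup>2) \<le> \<theta>\<^sup>2"
  proof -
    have "(\<Sum>i\<in>S. (x i - ?y i)\<^sup>2) \<le> (\<Sum>i\<in>S. ?h\<^sup>2)"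
    proof (intro sum_mono)
      fix i assume "i \<in> S"
      then have "\<bar>x i - ?y i\<bar> \<le> ?h" using k(2)[of i] by (simp add: z)
      then have "\<bar>x i - ?y i\<bar>\<^sup>2 \<le> ?h\<^sup>2" by (intro power_mono) auto
      then show "(x i - ?y i)\<^sup>2 \<le> ?h\<^sup>2" by simp
    qed
    also have "\<dots> = real (card S) * (\<theta>\<^sup>2 / N)" unfolding h2 by simp
    also have "\<dots> \<le> N * (\<theta>\<^sup>2 / N)" using S by (intro mult_right_mono) auto
    finally show ?thesis using S by simp
  qed
  ultimately show ?thesis using k(1) z by (intro bexI[of _ ?y]) auto
qed

lemma grid_norm_le:
  assumes "y \<in> grid S N \<theta>" "N > 0" "\<theta> > 0"
  shows "(\<Sum>i\<in>S. (y i)\<^sup>2) \<le> 1"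
proof -
  obtain z where z: "(\<Sum>i\<in>S. (real_of_int (z i))\<^sup>2) \<le> N / \<theta>\<^sup>2" and y: "y = (\<lambda>i. \<theta> / sqrt N * real_of_int (z i))"
    using assms(1) unfolding grid_def by auto
  have "(\<Sum>i\<in>S. (y i)\<^sup>2) = \<theta>\<^sup>2 / N * (\<Sum>i\<in>S. (real_of_int (z i))\<^sup>2)"
    unfolding y sum_distrib_left using assms by (simp add: power_mult_distrib power_divide)
  also have "\<dots> \<le> \<theta>\<^sup>2 / N * (N / \<theta>\<^sup>2)" using z assms by (intro mult_left_mono) auto
  finally show ?thesis using assms by simp
qed

section \<open>Typical properties of the adjacency matrix\<close>

lemma row_small_ball:
  assumes p: "0 \<le> p" "p \<le> 1" and S: "finite S" "v \<notin> S" and \<rho>: "\<rho> > 0" and m: "m \<ge> 0"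
    and s: "s\<^sup>2 \<le> (\<Sum>i\<in>{i\<in>S. \<bar>y i\<bar> \<le> m}. (y i)\<^sup>2)"
  shows "bexp p ((\<lambda>i. {v, i}) ` S) (\<lambda>X. exp (- (((\<Sum>i\<in>S. of_bool ({v, i} \<in> X) * y i) - b)\<^sup>2 / (2 * \<rho>\<^sup>2))))
    \<le> 1 / sqrt (1 + p * (1 - p) * s\<^sup>2 / (2 * \<rho>\<^sup>2)) + 3 * (m / \<rho>) ^ 4"
proof -
  let ?f = "\<lambda>i. {v, i}"
  let ?y = "\<lambda>e. y (the_inv_into S ?f e)"
  have inj: "inj_on ?f S" by (auto simp: inj_on_def doubleton_eq_iff)
  have inv: "the_inv_into S ?f {v, i} = i" if "i \<in> S" for i
    using the_inv_into_f_f[OF inj that] .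
  have eq: "(\<Sum>e\<in>?f ` S. of_bool (e \<in> X) * ?y e) = (\<Sum>i\<in>S. of_bool ({v, i} \<in> X) * y i)" for X
    by (subst sum.reindex[OF inj]) (auto simp: inv intro!: sum.cong)
  have set: "{e \<in> ?f ` S. \<bar>?y e\<bar> \<le> m} = ?f ` {i\<in>S. \<bar>y i\<bar> \<le> m}" by (auto simp: inv)
  have "(\<Sum>e\<in>{e \<in> ?f ` S. \<bar>?y e\<bar> \<le> m}. (?y e)\<^sup>2) = (\<Sum>i\<in>{i\<in>S. \<bar>y i\<bar> \<le> m}. (y i)\<^sup>2)"
    unfolding set by (subst sum.reindex) (auto simp: inv inj_on_def doubleton_eq_iff intro!: sum.cong)
  then show ?thesis
    using small_ball_bernoulli_sum[OF p _ \<rho> m, of "?f ` S" s ?y b] S s unfolding eq by simp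
qed

text \<open>Markov's inequality for the exponential of the negative sum of squares. This exponential
  is a product over rows, and rows \<open>v\<close> outside \<open>S\<close> use disjoint edge sets:
  an edge shared by two of them would have both ends outside \<open>S\<close>. Each factor is
  bounded by the small-ball estimate.\<close>

lemma image_tail_bound:
  assumes p: "0 \<le> p" "p \<le> 1" and S: "S \<subseteq> {..<n}" and \<rho>: "\<rho> > 0" and m: "m \<ge> 0"
    and s: "s\<^sup>2 \<le> (\<Sum>i\<in>{i\<in>S. \<bar>y i\<bar> \<le> m}. (y i)\<^sup>2)"
    and \<psi>: "1 / sqrt (1 + p * (1 - p) * s\<^sup>2 / (2 * \<rho>\<^sup>2)) + 3 * (m / \<rho>) ^ 4 \<le> \<psi>"
  shows "bexp p (vertex_pairs n) (indicator {E. (\<Sum>v\<in>{..<n} - S. ((\<Sum>i\<in>S. adj E v i * y i) - b)\<^sup>2)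
      \<le> 2 * \<sigma>\<^sup>2 * real (card ({..<n} - S))})
    \<le> (exp (\<sigma>\<^sup>2 / \<rho>\<^sup>2) * \<psi>) ^ card ({..<n} - S)"
proof -
  let ?T = "{..<n} - S"
  let ?B = "\<lambda>v. (\<lambda>i. {v, i}) ` S"
  define F where "F = (\<lambda>v X. exp (- (((\<Sum>i\<in>S. of_bool ({v, i} \<in> X) * y i) - b)\<^sup>2 / (2 * \<rho>\<^sup>2))))"
  let ?f = "\<lambda>E. - (\<Sum>v\<in>?T. ((\<Sum>i\<in>S. adj E v i * y i) - b)\<^sup>2) / (2 * \<rho>\<^sup>2)"
  have finS: "finite S" using S finite_subset by auto
  have "exp (?f E) = (\<Prod>v\<in>?T. F v (E \<inter> ?B v))" for E
  proof -
    have "(\<Sum>i\<in>S. of_bool ({v, i} \<in> E \<inter> ?B v) * y i) = (\<Sum>i\<in>S. adj E v i * y i)" for v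
      by (intro sum.cong refl) (auto simp: adj_def)
    then have "F v (E \<inter> ?B v) = exp (- (((\<Sum>i\<in>S. adj E v i * y i) - b)\<^sup>2 / (2 * \<rho>\<^sup>2)))" for v
      unfolding F_def by simp
    then show ?thesis by (simp add: exp_sum[symmetric] sum_negf sum_divide_distrib)
  qed
  then have "bexp p (vertex_pairs n) (\<lambda>E. exp (?f E)) = bexp p (vertex_pairs n) (\<lambda>E. \<Prod>v\<in>?T. F v (E \<inter> ?B v))"
    by simp
  also have "\<dots> = (\<Prod>v\<in>?T. bexp p (?B v) (F v))"
  proof (rule bexp_blocks)
    show "?B v \<subseteq> vertex_pairs n" if "v \<in> ?T" for v
      using S that by (auto simp: vertex_pairs_def card_insert_if)
    show "?B v \<inter> ?B w = {}" if "v \<in> ?T" "w \<in> ?T" "v \<noteq> w" for v w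
      using that by (auto simp: doubleton_eq_iff)
  qed auto
  also have "\<dots> \<le> (\<Prod>v\<in>?T. \<psi>)"
  proof (intro prod_mono conjI)
    fix v assume "v \<in> ?T"
    then have v: "v \<notin> S" by auto
    show "0 \<le> bexp p (?B v) (F v)" by (intro bexp_nonneg p) (simp add: F_def)
    show "bexp p (?B v) (F v) \<le> \<psi>"
      unfolding F_def by (rule order_trans[OF row_small_ball[OF p finS v \<rho> m s] \<psi>])
  qed
  finally have le: "bexp p (vertex_pairs n) (\<lambda>E. exp (?f E)) \<le> \<psi> ^ card ?T" by simp
  have "bexp p (vertex_pairs n) (indicator {E. (\<Sum>v\<in>?T. ((\<Sum>i\<in>S. adj E v i * y i) - b)\<^sup>2) \<le> 2 * \<sigma>\<^sup>2 * real (card ?T)})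
      \<le> exp (- (- (real (card ?T) * (\<sigma>\<^sup>2 / \<rho>\<^sup>2)))) * \<psi> ^ card ?T"
  proof (rule bexp_markov_exp[OF p le])
    fix E assume "(\<Sum>v\<in>?T. ((\<Sum>i\<in>S. adj E v i * y i) - b)\<^sup>2) \<le> 2 * \<sigma>\<^sup>2 * real (card ?T)"
    then have "(\<Sum>v\<in>?T. ((\<Sum>i\<in>S. adj E v i * y i) - b)\<^sup>2) / (2 * \<rho>\<^sup>2) \<le> 2 * \<sigma>\<^sup>2 * real (card ?T) / (2 * \<rho>\<^sup>2)"
      by (intro divide_right_mono) auto
    then show "- (real (card ?T) * (\<sigma>\<^sup>2 / \<rho>\<^sup>2)) \<le> ?f E" by (simp add: mult_ac)
  qed
  also have "\<dots> = (exp (\<sigma>\<^sup>2 / \<rho>\<^sup>2) * \<psi>) ^ card ?T"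
    unfolding power_mult_distrib exp_of_nat_mult[symmetric] by simp
  finally show ?thesis .
qed

section \<open>Operator norm of the centred adjacency matrix\<close>

definition centred_form :: "real \<Rightarrow> nat \<Rightarrow> nat set set \<Rightarrow> (nat \<Rightarrow> real) \<Rightarrow> (nat \<Rightarrow> real) \<Rightarrow> real" where
  "centred_form p n E x y = (\<Sum>i<n. x i * (\<Sum>j<n. (adj E i j - p) * y j))"

lemma centred_form_decompose:
  "centred_form p n E x y = centred_form p n E a b + centred_form p n E (\<lambda>i. x i - a i) b + centred_form p n E x (\<lambda>i. y i - b i)"
  unfolding centred_form_def
  by (simp add: sum.distrib[symmetric] right_diff_distrib left_diff_distrib sum_subtractf)

lemma centred_form_scale: "centred_form p n E (\<lambda>i. c * x i) (\<lambda>i. d * y i) = c * d * centred_form p n E x y"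
  unfolding centred_form_def by (simp add: sum_distrib_left mult_ac)

text \<open>Ensures that the supremum in \<open>op_bound_from_grid\<close> is finite, without which
  it could not be absorbed.\<close>

lemma centred_form_crude_bound:
  assumes p: "0 \<le> p" "p \<le> 1" and x: "(\<Sum>i<n. (x i)\<^sup>2) \<le> 1" and y: "(\<Sum>i<n. (y i)\<^sup>2) \<le> 1"
  shows "centred_form p n E x y \<le> real n * real n"
proof -
  have le1: "\<bar>z i\<bar> \<le> 1" if "(\<Sum>i<n. (z i)\<^sup>2) \<le> 1" "i < n" for z :: "nat \<Rightarrow> real" and i
  proof -
    have "(z i)\<^sup>2 \<le> (\<Sum>i<n. (z i)\<^sup>2)" using that(2) by (intro member_le_sum) auto
    then have "(z i)\<^sup>2 \<le> 1" using that(1) by linarith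
    then show ?thesis by (simp add: abs_square_le_1)
  qed
  have "centred_form p n E x y = (\<Sum>i<n. \<Sum>j<n. x i * ((adj E i j - p) * y j))"
    unfolding centred_form_def by (simp add: sum_distrib_left)
  also have "\<dots> \<le> (\<Sum>i<n. \<Sum>j<n. 1)"
  proof (intro sum_mono)
    fix i j assume "i \<in> {..<n}" "j \<in> {..<n}"
    then have "\<bar>x i\<bar> \<le> 1" "\<bar>y j\<bar> \<le> 1" using le1 x y by auto
    moreover have "\<bar>adj E i j - p\<bar> \<le> 1" using p by (auto simp: adj_def)
    ultimately have "\<bar>x i * ((adj E i j - p) * y j)\<bar> \<le> 1 * (1 * 1)"
      unfolding abs_mult by (intro mult_mono) auto
    then show "x i * ((adj E i j - p) * y j) \<le> 1" by simp
  qed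
  finally show ?thesis by simp
qed

text \<open>Let N be the supremum of the form over unit balls. Moving both arguments to lattice
  points within 1/4 costs N/4 each, so N is at most K sqrt n / 2 + N/2, hence at most K sqrt
  n.\<close>

lemma op_bound_from_grid:
  assumes n: "n \<ge> 1" and p: "0 \<le> p" "p \<le> 1" and K: "K \<ge> 0"
    and G: "\<And>x y. x \<in> grid {..<n} (real n) (1 / 4) \<Longrightarrow> y \<in> grid {..<n} (real n) (1 / 4) \<Longrightarrow>
      centred_form p n E x y \<le> K * sqrt (real n) / 2"
  shows "op_bound p n E K"
proof -
  let ?q = "\<lambda>x. \<Sum>i<n. (x i :: real)\<^sup>2"
  let ?B = "centred_form p n E"
  define U where "U = {?B x y | x y. ?q x \<le> 1 \<and> ?q y \<le> 1}"
  define N where "N = Sup U"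
  have "bdd_above U"
    unfolding U_def bdd_above_def using centred_form_crude_bound[OF p] by blast
  then have up: "?B x y \<le> N" if "?q x \<le> 1" "?q y \<le> 1" for x y
    unfolding N_def by (intro cSup_upper) (use that in \<open>auto simp: U_def\<close>)
  have small: "?B x y \<le> N / 4" if "?q x \<le> 1 \<and> ?q y \<le> 1 / 16 \<or> ?q x \<le> 1 / 16 \<and> ?q y \<le> 1" for x y
    using that
  proof
    assume *: "?q x \<le> 1 \<and> ?q y \<le> 1 / 16"
    have "?q (\<lambda>i. 4 * y i) = 16 * ?q y" by (simp add: power_mult_distrib sum_distrib_left)
    then have "?B (\<lambda>i. 1 * x i) (\<lambda>i. 4 * y i) \<le> N" using * by (intro up) auto
    then show ?thesis unfolding centred_form_scale by simp
  next
    assume *: "?q x \<le> 1 / 16 \<and> ?q y \<le> 1"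
    have "?q (\<lambda>i. 4 * x i) = 16 * ?q x" by (simp add: power_mult_distrib sum_distrib_left)
    then have "?B (\<lambda>i. 4 * x i) (\<lambda>i. 1 * y i) \<le> N" using * by (intro up) auto
    then show ?thesis unfolding centred_form_scale by simp
  qed
  have appr: "\<exists>y\<in>grid {..<n} (real n) (1 / 4). ?q y \<le> 1 \<and> ?q (\<lambda>i. x i - y i) \<le> 1 / 16" if x1: "?q x \<le> 1" for x
  proof -
    obtain y where "y \<in> grid {..<n} (real n) (1 / 4)" "?q (\<lambda>i. x i - y i) \<le> (1 / 4)\<^sup>2"
      using grid_approximation[of "{..<n}" "real n" "1 / 4" x] x1 n by auto
    then show ?thesis using grid_norm_le[of y "{..<n}" "real n" "1 / 4"] n
      by (intro bexI[of _ y]) (auto simp: power_divide)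
  qed
  have "N \<le> K * sqrt (real n) / 2 + N / 2"
    unfolding N_def
  proof (rule cSup_least)
    have "?B (\<lambda>_. 0) (\<lambda>_. 0) \<in> U" unfolding U_def by (intro CollectI exI[of _ "\<lambda>_. 0"]) auto
    then show "U \<noteq> {}" by blast
    fix u assume "u \<in> U"
    then obtain x y where u: "u = ?B x y" "?q x \<le> 1" "?q y \<le> 1" by (auto simp: U_def)
    obtain a where a: "a \<in> grid {..<n} (real n) (1 / 4)" "?q a \<le> 1" "?q (\<lambda>i. x i - a i) \<le> 1 / 16"
      using appr[OF u(2)] by blast
    obtain b where b: "b \<in> grid {..<n} (real n) (1 / 4)" "?q b \<le> 1" "?q (\<lambda>i. y i - b i) \<le> 1 / 16"
      using appr[OF u(3)] by blast
    have "?B (\<lambda>i. x i - a i) b \<le> N / 4" using a b by (intro small) auto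
    moreover have "?B x (\<lambda>i. y i - b i) \<le> N / 4" using u b by (intro small) auto
    ultimately show "u \<le> K * sqrt (real n) / 2 + Sup U / 2"
      using G[OF a(1) b(1)] centred_form_decompose[of p n E x y a b] unfolding u(1) N_def[symmetric] by linarith
  qed
  then have NK: "N \<le> K * sqrt (real n)" by simp
  have N0: "N \<ge> 0" using up[of "\<lambda>_. 0" "\<lambda>_. 0"] by (simp add: centred_form_def)
  show ?thesis
    unfolding op_bound_def
  proof
    fix x :: "nat \<Rightarrow> real"
    \<comment> \<open>Pairing \<open>x\<close> with its own image turns the bound on the form into
      one on the norm of the image.\<close>
    define v where "v = (\<lambda>i. \<Sum>j<n. (adj E i j - p) * x j)"
    have nn: "?q x \<ge> 0" "?q v \<ge> 0" by (intro sum_nonneg; simp)+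
    have Bv: "?B v x = ?q v" unfolding centred_form_def by (simp add: v_def power2_eq_square)
    have "?q v \<le> K\<^sup>2 * real n * ?q x"
    proof (cases "?q x = 0 \<or> ?q v = 0")
      case True
      have "?q v = 0"
      proof (rule ccontr)
        assume "?q v \<noteq> 0"
        then have "?q x = 0" using True by simp
        then have "\<forall>i<n. x i = 0" by (subst (asm) sum_nonneg_eq_0_iff) auto
        then have "v i = 0" for i by (simp add: v_def)
        then show False using \<open>?q v \<noteq> 0\<close> by simp
      qed
      then show ?thesis using nn K by simp
    next
      case False
      then have pos: "?q x > 0" "?q v > 0" using nn by linarith+
      have unit: "?q (\<lambda>i. 1 / sqrt (?q z) * z i) \<le> 1" if "?q z > 0" for z
        using that by (simp add: power_divide sum_divide_distrib[symmetric])
      have "?B (\<lambda>i. 1 / sqrt (?q v) * v i) (\<lambda>i. 1 / sqrt (?q x) * x i) \<le> N"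
        using pos by (intro up unit)
      then have "?q v / (sqrt (?q v) * sqrt (?q x)) \<le> N" unfolding centred_form_scale Bv by simp
      then have "?q v \<le> N * (sqrt (?q v) * sqrt (?q x))" using pos by (simp add: pos_divide_le_eq)
      then have "sqrt (?q v) * sqrt (?q v) \<le> sqrt (?q v) * (N * sqrt (?q x))" using pos by (simp add: mult_ac)
      then have "sqrt (?q v) \<le> N * sqrt (?q x)" using pos by (simp only: mult_le_cancel_left_pos real_sqrt_gt_0_iff)
      also have "\<dots> \<le> K * sqrt (real n) * sqrt (?q x)" using NK by (intro mult_right_mono) (auto simp: nn)
      finally have "(sqrt (?q v))\<^sup>2 \<le> (K * sqrt (real n) * sqrt (?q x))\<^sup>2" using nn by (intro power_mono) auto
      then show ?thesis using nn by (simp add: power_mult_distrib)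
    qed
    then show "(\<Sum>i<n. (\<Sum>j<n. (adj E i j - p) * x j)\<^sup>2) \<le> K\<^sup>2 * real n * ?q x" by (simp add: v_def)
  qed
qed

text \<open>The form is linear in the independent edge indicators: the edge {a, b} has coefficient
  x_a y_b + x_b y_a, and the squares of these coefficients sum to at most 2. The diagonal
  contributes a deterministic term of size at most 1.\<close>

lemma centred_form_tail:
  assumes n: "n \<ge> 1" and p: "0 \<le> p" "p \<le> 1"
    and x: "(\<Sum>i<n. (x i)\<^sup>2) \<le> 1" and y: "(\<Sum>i<n. (y i)\<^sup>2) \<le> 1"
  shows "bexp p (vertex_pairs n) (indicator {E. K * sqrt (real n) / 2 < centred_form p n E x y})
    \<le> exp (real n * (5 / 4 - K / 2))"
proof -
  let ?V = "vertex_pairs n"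
  let ?g = "\<lambda>q. {fst q, snd q}"
  define Q where "Q = {q \<in> {..<n} \<times> {..<n}. fst q \<noteq> snd q}"
  define s where "s e = (\<Sum>q\<in>{q\<in>Q. ?g q = e}. x (fst q) * y (snd q))" for e
  have finQ: "finite Q" by (auto simp: Q_def)
  have gQ: "?g ` Q \<subseteq> ?V" by (auto simp: Q_def vertex_pairs_def)
  let ?c = "p * (\<Sum>i<n. x i * y i)"
  have eq: "centred_form p n E x y = (\<Sum>e\<in>?V. s e * (of_bool (e \<in> E) - p)) - ?c" if E: "E \<subseteq> ?V" for E
  proof -
    let ?h = "\<lambda>q. x (fst q) * y (snd q) * (adj E (fst q) (snd q) - p)"
    have "centred_form p n E x y = (\<Sum>i<n. \<Sum>j<n. x i * y j * (adj E i j - p))"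
      unfolding centred_form_def by (simp add: sum_distrib_left mult_ac)
    also have "\<dots> = (\<Sum>q\<in>{..<n} \<times> {..<n}. ?h q)"
      by (simp add: sum.cartesian_product case_prod_beta)
    also have "\<dots> = (\<Sum>q\<in>Q. ?h q) + (\<Sum>q\<in>{..<n} \<times> {..<n} - Q. ?h q)"
      by (subst sum.subset_diff[of Q]) (auto simp: Q_def)
    also have "{..<n} \<times> {..<n} - Q = (\<lambda>i. (i, i)) ` {..<n}" by (auto simp: Q_def)
    also have "(\<Sum>q\<in>(\<lambda>i. (i, i)) ` {..<n}. ?h q) = - ?c"
      by (subst sum.reindex) (auto simp: inj_on_def adj_refl[OF E] sum_distrib_left sum_negf mult_ac)
    also have "(\<Sum>q\<in>Q. ?h q) = (\<Sum>e\<in>?V. \<Sum>q\<in>{q\<in>Q. ?g q = e}. ?h q)"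
      by (rule sum.group[OF finQ finite_vertex_pairs gQ, symmetric])
    also have "\<dots> = (\<Sum>e\<in>?V. s e * (of_bool (e \<in> E) - p))"
      unfolding s_def sum_distrib_right by (intro sum.cong refl) (auto simp: adj_def)
    finally show ?thesis by simp
  qed
  have s2: "(s e)\<^sup>2 \<le> 2 * (\<Sum>q\<in>{q\<in>Q. ?g q = e}. (x (fst q))\<^sup>2 * (y (snd q))\<^sup>2)" if "e \<in> ?V" for e
  proof -
    have "card e = 2" using that by (simp add: vertex_pairs_def)
    then obtain a b where e: "e = {a, b}" by (meson card_2_iff)
    have "{q\<in>Q. ?g q = e} \<subseteq> {(a, b), (b, a)}" unfolding e by (auto simp: doubleton_eq_iff)
    then have "card {q\<in>Q. ?g q = e} \<le> card {(a, b), (b, a)}" by (intro card_mono) auto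
    also have "\<dots> \<le> 2" using card_length[of "[(a, b), (b, a)]"] by simp
    finally have c2: "real (card {q\<in>Q. ?g q = e}) \<le> 2" by simp
    have "(s e)\<^sup>2 = (\<Sum>q\<in>{q\<in>Q. ?g q = e}. 1 * (x (fst q) * y (snd q)))\<^sup>2" by (simp add: s_def)
    also have "\<dots> \<le> (\<Sum>q\<in>{q\<in>Q. ?g q = e}. 1\<^sup>2) * (\<Sum>q\<in>{q\<in>Q. ?g q = e}. (x (fst q) * y (snd q))\<^sup>2)"
      by (rule Cauchy_Schwarz_ineq_sum)
    also have "\<dots> \<le> 2 * (\<Sum>q\<in>{q\<in>Q. ?g q = e}. (x (fst q) * y (snd q))\<^sup>2)"
      using c2 by (intro mult_right_mono) (auto intro: sum_nonneg)
    finally show ?thesis by (simp add: power_mult_distrib)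
  qed
  have "(\<Sum>e\<in>?V. (s e)\<^sup>2) \<le> (\<Sum>e\<in>?V. 2 * (\<Sum>q\<in>{q\<in>Q. ?g q = e}. (x (fst q))\<^sup>2 * (y (snd q))\<^sup>2))"
    by (intro sum_mono s2)
  also have "\<dots> = 2 * (\<Sum>q\<in>Q. (x (fst q))\<^sup>2 * (y (snd q))\<^sup>2)"
    unfolding sum_distrib_left[symmetric] by (subst sum.group[OF finQ finite_vertex_pairs gQ]) simp
  also have "\<dots> \<le> 2 * (\<Sum>q\<in>{..<n} \<times> {..<n}. (x (fst q))\<^sup>2 * (y (snd q))\<^sup>2)"
    by (intro mult_left_mono sum_mono2) (auto simp: Q_def)
  also have "\<dots> = 2 * ((\<Sum>i<n. (x i)\<^sup>2) * (\<Sum>i<n. (y i)\<^sup>2))"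
    by (simp add: sum_product sum.cartesian_product case_prod_beta)
  also have "\<dots> \<le> 2 * (1 * 1)" using x y by (intro mult_left_mono mult_mono) (auto intro: sum_nonneg)
  finally have ss: "(\<Sum>e\<in>?V. (s e)\<^sup>2) \<le> 2" by simp
  have "(\<Sum>i<n. x i * y i)\<^sup>2 \<le> (\<Sum>i<n. (x i)\<^sup>2) * (\<Sum>i<n. (y i)\<^sup>2)" by (rule Cauchy_Schwarz_ineq_sum)
  also have "\<dots> \<le> 1 * 1" using x y by (intro mult_mono) (auto intro: sum_nonneg)
  finally have "\<bar>\<Sum>i<n. x i * y i\<bar> \<le> 1" by (simp add: abs_square_le_1)
  then have "\<bar>?c\<bar> \<le> 1 * 1" unfolding abs_mult using p by (intro mult_mono) auto
  then have c: "- ?c \<le> 1" by linarith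
  let ?r = "sqrt (real n)"
  have r: "?r \<ge> 1" "?r * ?r = real n" using n by auto
  \<comment> \<open>The Chernoff parameter sqrt n makes all exponents linear in n: n/4 from the
    moment bound, K n / 2 from the threshold, and sqrt n <= n from the diagonal.\<close>
  have "bexp p ?V (\<lambda>E. exp (\<Sum>e\<in>?V. (?r * s e) * (of_bool (e \<in> E) - p))) \<le> exp ((\<Sum>e\<in>?V. (?r * s e)\<^sup>2) / 8)"
    by (rule bexp_exp_sum_le[OF p finite_vertex_pairs])
  also have "(\<Sum>e\<in>?V. (?r * s e)\<^sup>2) = real n * (\<Sum>e\<in>?V. (s e)\<^sup>2)"
    by (simp add: power_mult_distrib sum_distrib_left)
  also have "exp (real n * (\<Sum>e\<in>?V. (s e)\<^sup>2) / 8) \<le> exp (real n / 4)"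
    using mult_left_mono[OF ss, of "real n"] by simp
  finally have mgf: "bexp p ?V (\<lambda>E. exp (\<Sum>e\<in>?V. (?r * s e) * (of_bool (e \<in> E) - p))) \<le> exp (real n / 4)" .
  have "bexp p ?V (indicator {E. K * ?r / 2 < centred_form p n E x y}) \<le> exp (- (?r * (K * ?r / 2 - 1))) * exp (real n / 4)"
  proof (rule bexp_markov_exp[OF p mgf])
    fix E assume E: "E \<subseteq> ?V" and "K * ?r / 2 < centred_form p n E x y"
    then have "K * ?r / 2 - 1 \<le> (\<Sum>e\<in>?V. s e * (of_bool (e \<in> E) - p))" using eq[OF E] c by linarith
    then have "?r * (K * ?r / 2 - 1) \<le> ?r * (\<Sum>e\<in>?V. s e * (of_bool (e \<in> E) - p))"
      using r by (intro mult_left_mono) auto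
    then show "?r * (K * ?r / 2 - 1) \<le> (\<Sum>e\<in>?V. (?r * s e) * (of_bool (e \<in> E) - p))"
      by (simp add: sum_distrib_left mult_ac)
  qed
  also have "\<dots> = exp (- (K * (?r * ?r) / 2) + ?r + real n / 4)" by (simp add: algebra_simps flip: exp_add)
  also have "\<dots> \<le> exp (real n * (5 / 4 - K / 2))"
  proof -
    have "?r \<le> real n" using mult_left_mono[OF r(1), of ?r] r by simp
    then show ?thesis unfolding r(2) by (simp add: algebra_simps)
  qed
  finally show ?thesis .
qed

text \<open>The value 30 leaves room: pairs of lattice points number at most exp(12 n), each fails
  with probability at most exp((5/4 - 15) n), and 12 + 5/4 - 15 < -1.\<close>

lemma op_bound_fails_prob:
  assumes n: "n \<ge> 1" and p: "0 \<le> p" "p \<le> 1"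
  shows "bexp p (vertex_pairs n) (indicator {E. \<not> op_bound p n E 30}) \<le> exp (- real n)"
proof -
  let ?G = "grid {..<n} (real n) (1 / 4)"
  have fin: "finite ?G" and card: "real (card ?G) \<le> (27 / (1 / 4)) powr real n"
    by (rule card_grid; simp)+
  have e: "27 / (1 / 4) \<le> exp (6 :: real)"
  proof -
    have "1 + 1 + 1\<^sup>2 / 2 \<le> exp (1 :: real)" by (rule exp_lower_Taylor_quadratic) simp
    then have "(5 / 2 :: real) ^ 6 \<le> exp 1 ^ 6" by (intro power_mono) auto
    then show ?thesis by (simp add: exp_of_nat_mult[symmetric] power_divide flip: exp_of_nat_mult)
  qed
  have "(27 / (1 / 4)) powr real n \<le> exp 6 powr real n" using e by (intro powr_mono2) auto
  moreover have "exp 6 powr real n = exp (6 * real n)" by (simp add: powr_def mult.commute)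
  ultimately have card': "real (card ?G) \<le> exp (6 * real n)" using card by linarith
  have "bexp p (vertex_pairs n) (indicator {E. \<not> op_bound p n E 30})
      \<le> real (card (?G \<times> ?G)) * exp (real n * (5 / 4 - 30 / 2))"
  proof (rule bexp_union_bound[OF p, where Q = "\<lambda>q E. 30 * sqrt (real n) / 2 < centred_form p n E (fst q) (snd q)"])
    fix E assume "\<not> op_bound p n E 30"
    then obtain x y where "x \<in> ?G" "y \<in> ?G" "\<not> centred_form p n E x y \<le> 30 * sqrt (real n) / 2"
      using op_bound_from_grid[OF n p, of 30 E] by auto
    then show "\<exists>q\<in>?G \<times> ?G. 30 * sqrt (real n) / 2 < centred_form p n E (fst q) (snd q)"
      by (intro bexI[of _ "(x, y)"]) auto
  next
    fix q assume "q \<in> ?G \<times> ?G"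
    then have "fst q \<in> ?G" "snd q \<in> ?G" by auto
    then have "(\<Sum>i<n. (fst q i)\<^sup>2) \<le> 1" "(\<Sum>i<n. (snd q i)\<^sup>2) \<le> 1"
      using n by (auto intro: grid_norm_le)
    then show "bexp p (vertex_pairs n) (indicator {E. 30 * sqrt (real n) / 2 < centred_form p n E (fst q) (snd q)})
        \<le> exp (real n * (5 / 4 - 30 / 2))"
      by (rule centred_form_tail[OF n p])
  qed (use fin in auto)
  also have "\<dots> \<le> (exp (6 * real n) * exp (6 * real n)) * exp (real n * (5 / 4 - 30 / 2))"
    unfolding card_cartesian_product of_nat_mult using card' by (intro mult_right_mono mult_mono) auto
  also have "\<dots> \<le> exp (- real n)" by (simp flip: exp_add)
  finally show ?thesis .
qed

text \<open>A Chernoff bound for the lower tail with coefficient \<open>- p\<close> on the edges at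
  \<open>i\<close>, and a union bound over \<open>i\<close>. For n >= 4 the mean p (n - 1) exceeds n
  p / 2 by at least n p / 4.\<close>

lemma small_degree_prob:
  assumes n: "n \<ge> 4" and p: "0 < p" "p \<le> 1"
  shows "bexp p (vertex_pairs n) (indicator {E. \<exists>i<n. deg n E i < real n * p / 2}) \<le> real n * exp (- (real n * p\<^sup>2 / 8))"
proof -
  let ?V = "vertex_pairs n"
  have p': "0 \<le> p" "p \<le> 1" using p by auto
  have "bexp p ?V (indicator {E. \<exists>i<n. deg n E i < real n * p / 2}) \<le> real (card {..<n}) * exp (- (real n * p\<^sup>2 / 8))"
  proof (rule bexp_union_bound[OF p', where Q = "\<lambda>i E. deg n E i < real n * p / 2"])
    fix i assume i: "i \<in> {..<n}"
    let ?f = "\<lambda>j. {i, j}"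
    define J where "J = ?f ` ({..<n} - {i})"
    have inj: "inj_on ?f ({..<n} - {i})" by (auto simp: inj_on_def doubleton_eq_iff)
    have JV: "J \<subseteq> ?V" using i by (auto simp: J_def vertex_pairs_def card_insert_if)
    have cJ: "real (card J) = real n - 1"
      unfolding J_def card_image[OF inj] using i n by (simp add: of_nat_diff)
    define s where "s = (\<lambda>e. if e \<in> J then - p else 0)"
    have sums: "(\<Sum>e\<in>?V. s e * h e) = - p * (\<Sum>e\<in>J. h e)" for h :: "nat set \<Rightarrow> real"
    proof -
      have "(\<Sum>e\<in>?V. s e * h e) = (\<Sum>e\<in>J. s e * h e)"
        by (rule sum.mono_neutral_right[OF finite_vertex_pairs JV]) (auto simp: s_def)
      then show ?thesis by (simp add: s_def sum_distrib_left sum_negf)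
    qed
    have "(\<Sum>e\<in>?V. (s e)\<^sup>2) = (\<Sum>e\<in>?V. s e * s e)" by (simp add: power2_eq_square)
    also have "\<dots> = p\<^sup>2 * (real n - 1)" unfolding sums by (simp add: s_def cJ power2_eq_square)
    finally have ss: "(\<Sum>e\<in>?V. (s e)\<^sup>2) = p\<^sup>2 * (real n - 1)" .
    have mgf: "bexp p ?V (\<lambda>E. exp (\<Sum>e\<in>?V. s e * (of_bool (e \<in> E) - p))) \<le> exp (p\<^sup>2 * (real n - 1) / 8)"
      using bexp_exp_sum_le[OF p' finite_vertex_pairs, of n s] unfolding ss .
    have "bexp p ?V (indicator {E. deg n E i < real n * p / 2}) \<le> exp (- (real n * p\<^sup>2 / 4)) * exp (p\<^sup>2 * (real n - 1) / 8)"
    proof (rule bexp_markov_exp[OF p' mgf])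
      fix E assume E: "E \<subseteq> ?V" and d: "deg n E i < real n * p / 2"
      have "(\<Sum>e\<in>J. of_bool (e \<in> E) - p) = (\<Sum>j\<in>{..<n} - {i}. adj E i j) - p * (real n - 1)"
        using cJ unfolding J_def sum_subtractf by (simp add: sum.reindex[OF inj] adj_def of_bool_def mult.commute)
      also have "(\<Sum>j\<in>{..<n} - {i}. adj E i j) = deg n E i"
        unfolding deg_def using i adj_refl[OF E, of i] by (subst sum.remove[of _ i]) auto
      finally have sJ: "(\<Sum>e\<in>J. of_bool (e \<in> E) - p) = deg n E i - p * (real n - 1)" .
      have "(\<Sum>e\<in>?V. s e * (of_bool (e \<in> E) - p)) = p * (p * (real n - 1) - deg n E i)"
        unfolding sums sJ by (simp add: algebra_simps)
      moreover have "p * (real n * p / 4) \<le> p * (p * (real n - 1) - deg n E i)"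
      proof (intro mult_left_mono)
        have "p * 4 \<le> p * real n" using n p by (intro mult_left_mono) auto
        then show "real n * p / 4 \<le> p * (real n - 1) - deg n E i" using d by (simp add: algebra_simps)
      qed (use p in auto)
      ultimately show "real n * p\<^sup>2 / 4 \<le> (\<Sum>e\<in>?V. s e * (of_bool (e \<in> E) - p))"
        by (simp add: power2_eq_square mult_ac)
    qed
    also have "\<dots> \<le> exp (- (real n * p\<^sup>2 / 8))"
      unfolding exp_add[symmetric] exp_le_cancel_iff using p by (simp add: algebra_simps)
    finally show "bexp p ?V (indicator {E. deg n E i < real n * p / 2}) \<le> exp (- (real n * p\<^sup>2 / 8))" .
  qed auto
  then show ?thesis by simp
qed

section \<open>Net argument for nonconcentration\<close>

lemma L2_set_image_le:
  assumes W: "op_bound p n E K" and K: "K \<ge> 0" and S: "S \<subseteq> {..<n}" and T: "T \<subseteq> {..<n}"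
  shows "L2_set (\<lambda>v. \<Sum>i\<in>S. (adj E v i - p) * z i) T \<le> K * sqrt (real n) * L2_set z S"
proof -
  let ?z = "\<lambda>i. if i \<in> S then z i else 0"
  have sum: "(\<Sum>i<n. if i \<in> S then f i else 0) = (\<Sum>i\<in>S. f i)" for f :: "nat \<Rightarrow> real"
    using S by (subst sum.inter_restrict[symmetric]) (auto simp: Int_absorb1)
  have row: "(\<Sum>i\<in>S. (adj E v i - p) * z i) = (\<Sum>i<n. (adj E v i - p) * ?z i)" for v
    unfolding sum[symmetric] by (intro sum.cong refl) auto
  have z2: "(\<Sum>i<n. (?z i)\<^sup>2) = (\<Sum>i\<in>S. (z i)\<^sup>2)"
    unfolding sum[symmetric] by (intro sum.cong refl) auto
  have "(\<Sum>v\<in>T. (\<Sum>i\<in>S. (adj E v i - p) * z i)\<^sup>2) \<le> (\<Sum>v<n. (\<Sum>i\<in>S. (adj E v i - p) * z i)\<^sup>2)"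
    using T by (intro sum_mono2) auto
  also have "\<dots> \<le> K\<^sup>2 * real n * (\<Sum>i\<in>S. (z i)\<^sup>2)"
    unfolding row z2[symmetric] by (rule W[unfolded op_bound_def, rule_format])
  finally have "sqrt (\<Sum>v\<in>T. (\<Sum>i\<in>S. (adj E v i - p) * z i)\<^sup>2) \<le> sqrt (K\<^sup>2 * real n * (\<Sum>i\<in>S. (z i)\<^sup>2))"
    by (rule real_sqrt_le_mono)
  then show ?thesis using K by (simp add: L2_set_def real_sqrt_mult)
qed

text \<open>A violation by arbitrary \<open>x\<close> and \<open>b\<close> is transferred to a
  lattice point and an integer. The offset is measured relative to the centred matrix: p times the
  sum of the x i may be of order sqrt n, but its difference to \<open>b\<close> is bounded, so only
  boundedly many \<open>k\<close> occur, and passing from \<open>x\<close> to \<open>y\<close>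
  leaves no error from the rank-one part.\<close>

lemma concentration_grid_witness:
  assumes n: "n \<ge> 1" and \<alpha>: "0 < \<alpha>" "\<alpha> \<le> 1 / 2" and \<theta>: "0 < \<theta>" "\<theta> \<le> 1" and K: "K \<ge> 0"
    and s: "2 * \<theta> \<le> s" and W: "op_bound p n E K"
    and S: "S \<subseteq> {..<n}" "real (card S) \<le> \<alpha> * real n" and x: "(\<Sum>i\<in>S. (x i)\<^sup>2) \<le> 1"
    and spread: "s\<^sup>2 \<le> (\<Sum>i\<in>{i\<in>S. \<bar>x i\<bar> \<le> m}. (x i)\<^sup>2)"
    and fail: "(\<Sum>v\<in>{..<n} - S. ((\<Sum>i\<in>S. adj E v i * x i) - b)\<^sup>2) < \<theta>\<^sup>2 * real n"
  shows "\<exists>y\<in>grid S (\<alpha> * real n) \<theta>. \<exists>k::int. \<bar>real_of_int k\<bar> \<le> 2 * (K + 1) / \<theta> \<and>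
    (s / 2)\<^sup>2 \<le> (\<Sum>i\<in>{i\<in>S. \<bar>y i\<bar> \<le> m}. (y i)\<^sup>2) \<and>
    (\<Sum>v\<in>{..<n} - S. ((\<Sum>i\<in>S. adj E v i * y i) - (p * (\<Sum>i\<in>S. y i) - \<theta> * real_of_int k))\<^sup>2)
      \<le> 2 * ((K + 2) * \<theta>)\<^sup>2 * real (card ({..<n} - S))"
proof -
  let ?T = "{..<n} - S"
  let ?r = "sqrt (real n)"
  define w where "w z v = (\<Sum>i\<in>S. (adj E v i - p) * z i)" for z v
  define \<beta> where "\<beta> = p * (\<Sum>i\<in>S. x i) - b"
  have finS: "finite S" using S(1) finite_subset by auto
  have r: "?r \<ge> 1" using n by simp
  have wle: "L2_set (w z) ?T \<le> K * ?r * L2_set z S" for z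
    unfolding w_def by (rule L2_set_image_le[OF W K S(1)]) auto
  have row: "(\<Sum>i\<in>S. adj E v i * z i) = w z v + p * (\<Sum>i\<in>S. z i)" for z v
    unfolding w_def by (simp add: left_diff_distrib sum_subtractf sum_distrib_left)
  have xS: "L2_set x S \<le> 1" using x by (simp add: L2_set_def)
  have "(\<Sum>i\<in>S. adj E v i * x i) - b = w x v + \<beta>" for v unfolding row \<beta>_def by simp
  then have "sqrt (\<Sum>v\<in>?T. (w x v + \<beta>)\<^sup>2) \<le> sqrt (\<theta>\<^sup>2 * real n)" using fail by (intro real_sqrt_le_mono) simp
  then have h1: "L2_set (\<lambda>v. w x v + \<beta>) ?T \<le> \<theta> * ?r" using \<theta> by (simp add: L2_set_def real_sqrt_mult)
  have Kr: "K * ?r * L2_set z S \<le> K * ?r * c" if "L2_set z S \<le> c" for z c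
    using that K r by (intro mult_left_mono) auto
  have cardT: "real n \<le> 2 * real (card ?T)"
  proof -
    have "real (card ?T) = real n - real (card S)"
      using S(1) card_mono[OF _ S(1)] by (simp add: card_Diff_subset finS of_nat_diff)
    moreover have "\<alpha> * real n \<le> 1 / 2 * real n" using \<alpha> by (intro mult_right_mono) auto
    ultimately show ?thesis using S(2) by linarith
  qed
  \<comment> \<open>The constant vector \<beta> is the difference of two vectors of norm O(sqrt n),
    and at least n/2 rows remain outside \<open>S\<close>.\<close>
  have \<beta>: "\<bar>\<beta>\<bar> \<le> 2 * (K + 1)"
  proof -
    have "L2_set (\<lambda>v. (w x v + \<beta>) + - w x v) ?T \<le> L2_set (\<lambda>v. w x v + \<beta>) ?T + L2_set (\<lambda>v. - w x v) ?T"
      by (rule L2_set_triangle_ineq)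
    also have "L2_set (\<lambda>v. - w x v) ?T = L2_set (w x) ?T" by (simp add: L2_set_def)
    finally have "L2_set (\<lambda>v. \<beta>) ?T \<le> \<theta> * ?r + K * ?r * 1"
      using h1 wle[of x] Kr[OF xS] by simp
    moreover have "L2_set (\<lambda>v. \<beta>) ?T = \<bar>\<beta>\<bar> * sqrt (real (card ?T))"
      by (simp add: L2_set_def real_sqrt_mult mult.commute)
    moreover have "?r \<le> 2 * sqrt (real (card ?T))"
    proof -
      have "?r \<le> sqrt (4 * real (card ?T))" using cardT by (intro real_sqrt_le_mono) simp
      then show ?thesis by (simp add: real_sqrt_mult)
    qed
    then have "\<bar>\<beta>\<bar> * ?r \<le> 2 * (\<bar>\<beta>\<bar> * sqrt (real (card ?T)))"
      using mult_left_mono[of ?r "2 * sqrt (real (card ?T))" "\<bar>\<beta>\<bar>"] by simp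
    ultimately have "\<bar>\<beta>\<bar> * ?r \<le> 2 * (\<theta> + K) * ?r" by (simp add: algebra_simps)
    then have "\<bar>\<beta>\<bar> \<le> 2 * (\<theta> + K)" by (rule mult_right_le_imp_le) (use r in linarith)
    also have "2 * (\<theta> + K) \<le> 2 * (K + 1)" using \<theta> by simp
    finally show ?thesis .
  qed
  have \<alpha>n: "\<alpha> * real n > 0" using \<alpha> n by simp
  obtain y where y: "y \<in> grid S (\<alpha> * real n) \<theta>" "\<forall>i\<in>S. \<bar>y i\<bar> \<le> \<bar>x i\<bar>" "(\<Sum>i\<in>S. (x i - y i)\<^sup>2) \<le> \<theta>\<^sup>2"
    using grid_approximation[OF finS S(2) \<alpha>n \<theta>(1) x] by blast
  have xy: "L2_set (\<lambda>i. x i - y i) S \<le> \<theta>"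
    using real_sqrt_le_mono[OF y(3)] \<theta> by (simp add: L2_set_def)
  have yx: "L2_set (\<lambda>i. y i - x i) S \<le> \<theta>"
    using xy by (simp add: L2_set_def power2_commute)
  obtain k :: int where k: "\<bar>\<theta> * real_of_int k\<bar> \<le> \<bar>\<beta>\<bar>" "\<bar>\<beta> - \<theta> * real_of_int k\<bar> \<le> \<theta>"
    using round_towards_zero[OF \<theta>(1)] by blast
  have "\<bar>real_of_int k\<bar> * \<theta> \<le> 2 * (K + 1)" using k(1) \<beta> \<theta> by (simp add: abs_mult mult.commute)
  then have kb: "\<bar>real_of_int k\<bar> \<le> 2 * (K + 1) / \<theta>" using \<theta> by (simp add: pos_le_divide_eq)
  have sp: "(s / 2)\<^sup>2 \<le> (\<Sum>i\<in>{i\<in>S. \<bar>y i\<bar> \<le> m}. (y i)\<^sup>2)"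
  proof -
    let ?J = "{i\<in>S. \<bar>x i\<bar> \<le> m}"
    have "s \<le> L2_set x ?J"
      using real_sqrt_le_mono[OF spread] by (simp add: L2_set_def)
    also have "L2_set x ?J = L2_set (\<lambda>i. y i + (x i - y i)) ?J" by simp
    also have "\<dots> \<le> L2_set y ?J + L2_set (\<lambda>i. x i - y i) ?J" by (rule L2_set_triangle_ineq)
    also have "L2_set (\<lambda>i. x i - y i) ?J \<le> L2_set (\<lambda>i. x i - y i) S"
      unfolding L2_set_def using finS by (intro real_sqrt_le_mono sum_mono2) auto
    finally have "s / 2 \<le> L2_set y ?J" using xy s by linarith
    then have "(s / 2)\<^sup>2 \<le> (L2_set y ?J)\<^sup>2" using s \<theta> by (intro power_mono) auto
    also have "\<dots> = (\<Sum>i\<in>?J. (y i)\<^sup>2)" by (simp add: L2_set_def sum_nonneg)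
    also have "\<dots> \<le> (\<Sum>i\<in>{i\<in>S. \<bar>y i\<bar> \<le> m}. (y i)\<^sup>2)"
      using finS y(2) by (intro sum_mono2) (auto intro: order_trans)
    finally show ?thesis .
  qed
  let ?\<sigma> = "(K + 2) * \<theta>"
  have tail: "(\<Sum>v\<in>?T. ((\<Sum>i\<in>S. adj E v i * y i) - (p * (\<Sum>i\<in>S. y i) - \<theta> * real_of_int k))\<^sup>2) \<le> 2 * ?\<sigma>\<^sup>2 * real (card ?T)"
  proof -
    \<comment> \<open>Three errors, in units of \<theta> sqrt n: 1 from the assumed violation, K
      from the change of vector, 1 from rounding \<beta>. Together they give K + 2.\<close>
    have eq: "(\<Sum>i\<in>S. adj E v i * y i) - (p * (\<Sum>i\<in>S. y i) - \<theta> * real_of_int k)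
        = (w x v + \<beta>) + (w (\<lambda>i. y i - x i) v + (\<theta> * real_of_int k - \<beta>))" for v
      unfolding row by (simp add: w_def right_diff_distrib sum_subtractf)
    have c: "L2_set (\<lambda>v. \<theta> * real_of_int k - \<beta>) ?T \<le> \<theta> * ?r"
    proof -
      have "L2_set (\<lambda>v. \<theta> * real_of_int k - \<beta>) ?T = \<bar>\<theta> * real_of_int k - \<beta>\<bar> * sqrt (real (card ?T))"
        by (simp add: L2_set_def real_sqrt_mult mult.commute)
      also have "\<dots> \<le> \<theta> * ?r"
        using k(2) card_mono[of "{..<n}" ?T] \<theta> by (intro mult_mono real_sqrt_le_mono) (auto simp: abs_minus_commute)
      finally show ?thesis .
    qed
    have "L2_set (\<lambda>v. (w x v + \<beta>) + (w (\<lambda>i. y i - x i) v + (\<theta> * real_of_int k - \<beta>))) ?T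
        \<le> L2_set (\<lambda>v. w x v + \<beta>) ?T + L2_set (\<lambda>v. w (\<lambda>i. y i - x i) v + (\<theta> * real_of_int k - \<beta>)) ?T"
      by (rule L2_set_triangle_ineq)
    also have "L2_set (\<lambda>v. w (\<lambda>i. y i - x i) v + (\<theta> * real_of_int k - \<beta>)) ?T
        \<le> L2_set (w (\<lambda>i. y i - x i)) ?T + L2_set (\<lambda>v. \<theta> * real_of_int k - \<beta>) ?T"
      by (rule L2_set_triangle_ineq)
    finally have "L2_set (\<lambda>v. (w x v + \<beta>) + (w (\<lambda>i. y i - x i) v + (\<theta> * real_of_int k - \<beta>))) ?T \<le> ?\<sigma> * ?r"
      using h1 c wle[of "\<lambda>i. y i - x i"] Kr[OF yx] by (simp add: algebra_simps)
    then have "(L2_set (\<lambda>v. (w x v + \<beta>) + (w (\<lambda>i. y i - x i) v + (\<theta> * real_of_int k - \<beta>))) ?T)\<^sup>2 \<le> (?\<sigma> * ?r)\<^sup>2"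
      by (intro power_mono) auto
    then have "(\<Sum>v\<in>?T. ((\<Sum>i\<in>S. adj E v i * y i) - (p * (\<Sum>i\<in>S. y i) - \<theta> * real_of_int k))\<^sup>2) \<le> ?\<sigma>\<^sup>2 * real n"
      unfolding eq by (simp add: L2_set_def sum_nonneg power_mult_distrib)
    also have "\<dots> \<le> ?\<sigma>\<^sup>2 * (2 * real (card ?T))" using cardT by (intro mult_left_mono) auto
    finally show ?thesis by (simp add: mult_ac)
  qed
  show ?thesis using y(1) kb sp tail by blast
qed

text \<open>A union bound over supports, lattice points and integer offsets. The level of
  nonconcentration equals the lattice mesh \<theta>, so rounding loses only the factor K + 2;
  \<open>q\<close> is the resulting bound per row, and \<open>q \<le> 1\<close> allows the number of
  rows to be replaced by its lower bound (1 - \<alpha>) n.\<close>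

lemma nonconcentrated_fails_prob:
  assumes n: "n \<ge> 1" and p: "0 \<le> p" "p \<le> 1" and \<alpha>: "0 < \<alpha>" "\<alpha> \<le> 1 / 2"
    and \<theta>: "0 < \<theta>" "\<theta> \<le> 1" and K: "K \<ge> 0" and s: "2 * \<theta> \<le> s" and \<rho>: "\<rho> > 0" and m: "m \<ge> 0"
    and \<psi>: "1 / sqrt (1 + p * (1 - p) * (s / 2)\<^sup>2 / (2 * \<rho>\<^sup>2)) + 3 * (m / \<rho>) ^ 4 \<le> \<psi>"
    and q: "q = exp (((K + 2) * \<theta>)\<^sup>2 / \<rho>\<^sup>2) * \<psi>" "q \<le> 1"
  shows "bexp p (vertex_pairs n) (indicator {E. op_bound p n E K \<and> \<not> nonconcentrated n E \<alpha> m s \<theta>})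
    \<le> real (card {S. S \<subseteq> {..<n} \<and> real (card S) \<le> \<alpha> * real n}) *
      ((4 * (K + 1) / \<theta> + 1) * (27 / \<theta>) powr (\<alpha> * real n) * q powr ((1 - \<alpha>) * real n))"
proof -
  let ?V = "vertex_pairs n"
  let ?N = "\<alpha> * real n"
  let ?SS = "{S. S \<subseteq> {..<n} \<and> real (card S) \<le> ?N}"
  define k0 where "k0 = \<lfloor>2 * (K + 1) / \<theta>\<rfloor>"
  define Y where "Y S = {y\<in>grid S ?N \<theta>. (s / 2)\<^sup>2 \<le> (\<Sum>i\<in>{i\<in>S. \<bar>y i\<bar> \<le> m}. (y i)\<^sup>2)}" for S :: "nat set"
  define R where "R S y k E \<longleftrightarrow> (\<Sum>v\<in>{..<n} - S. ((\<Sum>i\<in>S. adj E v i * y i) - (p * (\<Sum>i\<in>S. y i) - \<theta> * real_of_int k))\<^sup>2)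
      \<le> 2 * ((K + 2) * \<theta>)\<^sup>2 * real (card ({..<n} - S))" for S y and k :: int and E
  have N: "?N > 0" using \<alpha> n by simp
  have k0: "k0 \<ge> 0" unfolding k0_def using K \<theta> by simp
  have "0 < 1 / sqrt (1 + p * (1 - p) * (s / 2)\<^sup>2 / (2 * \<rho>\<^sup>2))"
    using p by (intro divide_pos_pos real_sqrt_gt_zero add_pos_nonneg divide_nonneg_nonneg mult_nonneg_nonneg) auto
  moreover have "0 \<le> 3 * (m / \<rho>) ^ 4" by simp
  ultimately have "\<psi> > 0" using \<psi> by linarith
  then have q0: "q > 0" using q(1) by simp
  show ?thesis
  proof (rule bexp_union_bound[OF p, where Q = "\<lambda>S E. \<exists>a\<in>Y S \<times> {-k0..k0}. R S (fst a) (snd a) E"])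
    show "finite ?SS" by (rule finite_subset[of _ "Pow {..<n}"]) auto
    show "\<exists>S\<in>?SS. \<exists>a\<in>Y S \<times> {-k0..k0}. R S (fst a) (snd a) E"
      if H: "op_bound p n E K \<and> \<not> nonconcentrated n E \<alpha> m s \<theta>" for E
    proof -
      obtain S x b where S: "S \<subseteq> {..<n}" "real (card S) \<le> ?N" and x: "(\<Sum>i\<in>S. (x i)\<^sup>2) \<le> 1"
        "s\<^sup>2 \<le> (\<Sum>i\<in>{i\<in>S. \<bar>x i\<bar> \<le> m}. (x i)\<^sup>2)"
        "(\<Sum>v\<in>{..<n} - S. ((\<Sum>i\<in>S. adj E v i * x i) - b)\<^sup>2) < \<theta>\<^sup>2 * real n"
        using H unfolding nonconcentrated_def by (auto simp: not_le)
      obtain y and k :: int where y: "y \<in> grid S ?N \<theta>" "\<bar>real_of_int k\<bar> \<le> 2 * (K + 1) / \<theta>"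
        "(s / 2)\<^sup>2 \<le> (\<Sum>i\<in>{i\<in>S. \<bar>y i\<bar> \<le> m}. (y i)\<^sup>2)" "R S y k E"
        using concentration_grid_witness[OF n \<alpha> \<theta> K s conjunct1[OF H] S x] unfolding R_def by blast
      have "\<bar>k\<bar> \<le> k0" unfolding k0_def using y(2) by (simp add: le_floor_iff)
      then have "(y, k) \<in> Y S \<times> {-k0..k0}" using y by (auto simp: Y_def)
      then show ?thesis using S y(4) by (intro bexI[of _ S] bexI[of _ "(y, k)"]) auto
    qed
    fix S assume "S \<in> ?SS"
    then have S: "S \<subseteq> {..<n}" "real (card S) \<le> ?N" by auto
    have finS: "finite S" using S(1) finite_subset by auto
    have finY: "finite (Y S)" unfolding Y_def using card_grid(1)[OF finS S(2) \<theta>] by simp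
    have "real (card (Y S)) \<le> real (card (grid S ?N \<theta>))"
      unfolding Y_def by (intro of_nat_mono card_mono card_grid(1)[OF finS S(2) \<theta>]) auto
    also have "\<dots> \<le> (27 / \<theta>) powr ?N" by (rule card_grid(2)[OF finS S(2) \<theta>])
    finally have cY: "real (card (Y S)) \<le> (27 / \<theta>) powr ?N" .
    have "real (card {-k0..k0}) = 2 * real_of_int k0 + 1" using k0 by simp
    also have "\<dots> \<le> 4 * (K + 1) / \<theta> + 1"
    proof -
      have "real_of_int k0 \<le> 2 * (K + 1) / \<theta>" unfolding k0_def by (rule of_int_floor_le)
      moreover have "4 * (K + 1) / \<theta> = 2 * (2 * (K + 1) / \<theta>)" by simp
      ultimately show ?thesis by linarith
    qed
    finally have ck: "real (card {-k0..k0}) \<le> 4 * (K + 1) / \<theta> + 1" .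
    let ?T = "{..<n} - S"
    have cT: "(1 - \<alpha>) * real n \<le> real (card ?T)"
      using S card_mono[OF _ S(1)] by (simp add: card_Diff_subset finS of_nat_diff algebra_simps)
    have qT: "q ^ card ?T \<le> q powr ((1 - \<alpha>) * real n)"
      unfolding powr_realpow[OF q0, symmetric] using cT q0 q(2) by (intro powr_mono') auto
    have "bexp p ?V (indicator {E. \<exists>a\<in>Y S \<times> {-k0..k0}. R S (fst a) (snd a) E})
        \<le> real (card (Y S \<times> {-k0..k0})) * q powr ((1 - \<alpha>) * real n)"
    proof (rule bexp_union_bound[OF p, where Q = "\<lambda>a E. R S (fst a) (snd a) E"])
      fix a assume "a \<in> Y S \<times> {-k0..k0}"
      then have "(s / 2)\<^sup>2 \<le> (\<Sum>i\<in>{i\<in>S. \<bar>fst a i\<bar> \<le> m}. (fst a i)\<^sup>2)" by (auto simp: Y_def)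
      from image_tail_bound[OF p S(1) \<rho> m this \<psi>, of _ "(K + 2) * \<theta>"]
      show "bexp p ?V (indicator {E. R S (fst a) (snd a) E}) \<le> q powr ((1 - \<alpha>) * real n)"
        unfolding R_def q(1)[symmetric] using qT by (rule order_trans)
    qed (use finY in auto)
    also have "\<dots> \<le> ((27 / \<theta>) powr ?N * (4 * (K + 1) / \<theta> + 1)) * q powr ((1 - \<alpha>) * real n)"
      unfolding card_cartesian_product of_nat_mult using cY ck by (intro mult_right_mono mult_mono) auto
    finally show "bexp p ?V (indicator {E. \<exists>a\<in>Y S \<times> {-k0..k0}. R S (fst a) (snd a) E})
        \<le> (4 * (K + 1) / \<theta> + 1) * (27 / \<theta>) powr ?N * q powr ((1 - \<alpha>) * real n)"
      by (simp only: mult_ac)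
  qed
qed

text \<open>Weighting a set by t^(|S| - \<delta> n), which is at least 1 on the sets counted, and
  summing over all subsets gives a binomial sum. The free \<open>t\<close> covers two uses: t =
  \<delta> makes the exponent vanish with \<delta>, and t = 1 gives the crude exp(n).\<close>

lemma card_small_subsets:
  assumes t: "0 < t" "t \<le> 1"
  shows "real (card {S. S \<subseteq> {..<n} \<and> real (card S) \<le> \<delta> * real n}) \<le> exp (real n * (t + \<delta> * ln (1 / t)))"
proof -
  let ?SS = "{S. S \<subseteq> {..<n} \<and> real (card S) \<le> \<delta> * real n}"
  have sub: "?SS \<subseteq> Pow {..<n}" by auto
  have "real (card ?SS) = (\<Sum>S\<in>?SS. 1)" by simp
  also have "\<dots> \<le> (\<Sum>S\<in>?SS. t powr (- (\<delta> * real n)) * t ^ card S)"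
  proof (intro sum_mono)
    fix S assume "S \<in> ?SS"
    then have "real (card S) \<le> \<delta> * real n" by simp
    then have "t powr (\<delta> * real n) \<le> t ^ card S"
      unfolding powr_realpow[OF t(1), symmetric] using t by (intro powr_mono') auto
    then have "t powr (- (\<delta> * real n)) * t powr (\<delta> * real n) \<le> t powr (- (\<delta> * real n)) * t ^ card S"
      by (intro mult_left_mono) auto
    then show "1 \<le> t powr (- (\<delta> * real n)) * t ^ card S" using t by (simp flip: powr_add)
  qed
  also have "\<dots> \<le> (\<Sum>S\<in>Pow {..<n}. t powr (- (\<delta> * real n)) * t ^ card S)"
    by (intro sum_mono2 sub) (use t in auto)
  also have "\<dots> = t powr (- (\<delta> * real n)) * (1 + t) ^ n"
    using prod_add[of "{..<n}" "\<lambda>_. t" "\<lambda>_. 1"] by (simp add: sum_distrib_left add.commute)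
  also have "\<dots> \<le> t powr (- (\<delta> * real n)) * exp t ^ n"
    using t exp_ge_add_one_self[of t] by (intro mult_left_mono power_mono) auto
  also have "\<dots> = exp (real n * (t + \<delta> * ln (1 / t)))"
    using t by (simp add: powr_def ln_div exp_of_nat_mult[symmetric] algebra_simps flip: exp_add)
  finally show ?thesis .
qed

section \<open>Asymptotics\<close>

lemma inverse_sqrt_le: "1 / sqrt (1 + x) \<le> 1 - x / 4" if "0 \<le> x" "x \<le> 1" for x :: real
proof -
  have "x * x \<le> x" using that by (simp add: mult_left_le)
  then have "0 \<le> x / 2 - 7 / 16 * (x * x) + x * x * x / 16" using that by simp
  also have "\<dots> = (1 - x / 4)\<^sup>2 * (1 + x) - 1" by (simp add: power2_eq_square field_simps)
  finally have "1 \<le> (1 - x / 4)\<^sup>2 * (1 + x)" by simp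
  then have "sqrt 1 \<le> sqrt ((1 - x / 4)\<^sup>2 * (1 + x))" by (intro real_sqrt_le_mono)
  then have "1 \<le> (1 - x / 4) * sqrt (1 + x)" using that by (simp add: real_sqrt_mult)
  then show ?thesis using that by (simp add: pos_divide_le_eq)
qed

text \<open>For large \<rho> the gain is of order 1/\<rho>^2 and the error of order 1/\<rho>^4. With
  \<rho>^2 = 24/a the gain is a^2/96 and the error a^2/192.\<close>

lemma small_ball_constant_less_1:
  fixes a :: real
  assumes a: "0 < a" "a \<le> 1"
  shows "\<exists>\<rho>>0. 1 / sqrt (1 + a / \<rho>\<^sup>2) + 3 * (1 / \<rho>) ^ 4 < 1"
proof (intro exI[of _ "sqrt (24 / a)"] conjI)
  let ?\<rho> = "sqrt (24 / a)"
  have \<rho>2: "?\<rho>\<^sup>2 = 24 / a" using a by simp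
  have "(1 / ?\<rho>) ^ 4 = ((1 / ?\<rho>)\<^sup>2)\<^sup>2" by simp
  also have "(1 / ?\<rho>)\<^sup>2 = a / 24" unfolding power_divide \<rho>2 using a by simp
  finally have 4: "(1 / ?\<rho>) ^ 4 = (a / 24)\<^sup>2" .
  have e: "a / ?\<rho>\<^sup>2 = a\<^sup>2 / 24" unfolding \<rho>2 using a by (simp add: power2_eq_square)
  have "a\<^sup>2 \<le> 1" using a by (simp add: power_le_one)
  then have "1 / sqrt (1 + a / ?\<rho>\<^sup>2) \<le> 1 - a\<^sup>2 / 96"
    unfolding e using inverse_sqrt_le[of "a\<^sup>2 / 24"] by simp
  moreover have "3 * (1 / ?\<rho>) ^ 4 = a\<^sup>2 / 192" unfolding 4 by (simp add: power_divide)
  moreover have "a\<^sup>2 > 0" using a by simp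
  ultimately show "1 / sqrt (1 + a / ?\<rho>\<^sup>2) + 3 * (1 / ?\<rho>) ^ 4 < 1" by linarith
qed (use a in simp)

lemma exp_decay_tendsto_0:
  assumes "eventually (\<lambda>n. f n \<le> c * exp (real n * r)) sequentially" "\<And>n. f n \<ge> 0" "r < 0"
  shows "f \<longlonglongrightarrow> 0"
proof (rule tendsto_sandwich[OF _ assms(1) tendsto_const])
  have "(\<lambda>n. exp r ^ n) \<longlonglongrightarrow> 0" using assms(3) by (intro LIMSEQ_realpow_zero) auto
  then have "(\<lambda>n. c * exp r ^ n) \<longlonglongrightarrow> c * 0" by (intro tendsto_mult_left)
  then show "(\<lambda>n. c * exp (real n * r)) \<longlonglongrightarrow> 0" by (simp add: exp_of_nat_mult)
qed (use assms(2) in auto)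

lemma indicator_bexp_nonneg: "0 \<le> p \<Longrightarrow> p \<le> 1 \<Longrightarrow> bexp p I (indicator A :: _ \<Rightarrow> real) \<ge> 0"
  by (rule bexp_nonneg) auto

text \<open>For very small supports the entropy of the support is negligible, so a single row having
  small-ball constant below one is enough.\<close>

lemma nonconcentrated_sparse:
  assumes p: "0 < p" "p < 1" and K: "K \<ge> 0"
  shows "\<exists>\<delta> c. \<delta> > 0 \<and> c > 0 \<and>
    (\<lambda>n. bexp p (vertex_pairs n) (indicator {E. op_bound p n E K \<and> \<not> nonconcentrated n E \<delta> 1 1 c}) :: real) \<longlonglongrightarrow> 0"
proof -
  have p': "0 \<le> p" "p \<le> 1" using p by auto
  have "p * (1 - p) \<le> 1 * 1" using p by (intro mult_mono) auto
  moreover have "p * (1 - p) > 0" using p by simp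
  ultimately obtain \<rho> where \<rho>: "\<rho> > 0" "1 / sqrt (1 + (p * (1 - p) / 8) / \<rho>\<^sup>2) + 3 * (1 / \<rho>) ^ 4 < 1"
    using small_ball_constant_less_1[of "p * (1 - p) / 8"] by auto
  \<comment> \<open>The factor 1/8 is (1/2)^2 / 2: a unit vector keeps norm at least 1/2 after
    rounding to the lattice.\<close>
  define \<psi> where "\<psi> = 1 / sqrt (1 + (p * (1 - p) / 8) / \<rho>\<^sup>2) + 3 * (1 / \<rho>) ^ 4"
  have \<psi>1: "\<psi> < 1" using \<rho>(2) by (simp add: \<psi>_def)
  have "((\<lambda>\<theta>. exp (((K + 2) * \<theta>)\<^sup>2 / \<rho>\<^sup>2) * \<psi>) \<longlongrightarrow> exp (((K + 2) * 0)\<^sup>2 / \<rho>\<^sup>2) * \<psi>) (at_right 0)"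
    using \<rho> by (intro tendsto_intros) auto
  then have "eventually (\<lambda>\<theta>. exp (((K + 2) * \<theta>)\<^sup>2 / \<rho>\<^sup>2) * \<psi> < 1) (at_right 0)"
    by (rule order_tendstoD) (use \<psi>1 in simp)
  moreover have "eventually (\<lambda>\<theta>::real. \<theta> \<in> {0<..<1 / 2}) (at_right 0)"
    by (rule eventually_at_right_real) simp
  ultimately have "eventually (\<lambda>\<theta>. exp (((K + 2) * \<theta>)\<^sup>2 / \<rho>\<^sup>2) * \<psi> < 1 \<and> \<theta> \<in> {0<..<1 / 2}) (at_right 0)"
    by (rule eventually_conj)
  then obtain \<theta> where \<theta>: "exp (((K + 2) * \<theta>)\<^sup>2 / \<rho>\<^sup>2) * \<psi> < 1" "0 < \<theta>" "\<theta> < 1 / 2"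
    using eventually_happens'[OF trivial_limit_at_right_real] by fastforce
  define q where "q = exp (((K + 2) * \<theta>)\<^sup>2 / \<rho>\<^sup>2) * \<psi>"
  have "1 / sqrt (1 + (p * (1 - p) / 8) / \<rho>\<^sup>2) > 0"
    using p by (intro divide_pos_pos real_sqrt_gt_zero add_pos_nonneg) auto
  then have "\<psi> > 0" unfolding \<psi>_def using \<rho>(1) by (intro add_pos_nonneg) auto
  then have q: "0 < q" "q < 1" using \<theta>(1) by (auto simp: q_def)
  \<comment> \<open>With \<theta>, and hence \<open>q\<close>, already fixed, every entropy term
    disappears as \<delta> tends to 0 and only the negative ln q is left.\<close>
  have "((\<lambda>\<delta>. \<delta> + \<delta> * ln (1 / \<delta>) + \<delta> * ln (27 / \<theta>) + (1 - \<delta>) * ln q) \<longlongrightarrow> ln q) (at_right 0)"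
    by real_asymp
  moreover have "ln q < 0" using q by simp
  ultimately have "eventually (\<lambda>\<delta>. \<delta> + \<delta> * ln (1 / \<delta>) + \<delta> * ln (27 / \<theta>) + (1 - \<delta>) * ln q < 0) (at_right 0)"
    by (rule order_tendstoD)
  moreover have "eventually (\<lambda>\<delta>::real. \<delta> \<in> {0<..<1 / 2}) (at_right 0)"
    by (rule eventually_at_right_real) simp
  ultimately have "eventually (\<lambda>\<delta>. \<delta> + \<delta> * ln (1 / \<delta>) + \<delta> * ln (27 / \<theta>) + (1 - \<delta>) * ln q < 0 \<and> \<delta> \<in> {0<..<1 / 2}) (at_right 0)"
    by (rule eventually_conj)
  then obtain \<delta> where \<delta>: "\<delta> + \<delta> * ln (1 / \<delta>) + \<delta> * ln (27 / \<theta>) + (1 - \<delta>) * ln q < 0" "0 < \<delta>" "\<delta> < 1 / 2"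
    using eventually_happens'[OF trivial_limit_at_right_real] by fastforce
  let ?r = "\<delta> + \<delta> * ln (1 / \<delta>) + \<delta> * ln (27 / \<theta>) + (1 - \<delta>) * ln q"
  let ?f = "\<lambda>n. bexp p (vertex_pairs n) (indicator {E. op_bound p n E K \<and> \<not> nonconcentrated n E \<delta> 1 1 \<theta>}) :: real"
  have bound: "?f n \<le> (4 * (K + 1) / \<theta> + 1) * exp (real n * ?r)" if n: "n \<ge> 1" for n
  proof -
    have \<psi>': "1 / sqrt (1 + p * (1 - p) * (1 / 2)\<^sup>2 / (2 * \<rho>\<^sup>2)) + 3 * (1 / \<rho>) ^ 4 \<le> \<psi>"
      by (simp add: \<psi>_def power_divide)
    have "?f n \<le> real (card {S. S \<subseteq> {..<n} \<and> real (card S) \<le> \<delta> * real n}) *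
      ((4 * (K + 1) / \<theta> + 1) * (27 / \<theta>) powr (\<delta> * real n) * q powr ((1 - \<delta>) * real n))"
      by (rule nonconcentrated_fails_prob[OF n p' _ _ _ _ K _ \<rho>(1) _ \<psi>' q_def])
        (use \<delta> \<theta> q in auto)
    also have "\<dots> \<le> exp (real n * (\<delta> + \<delta> * ln (1 / \<delta>))) *
      ((4 * (K + 1) / \<theta> + 1) * (27 / \<theta>) powr (\<delta> * real n) * q powr ((1 - \<delta>) * real n))"
      using \<delta> \<theta> K by (intro mult_right_mono card_small_subsets) auto
    also have "\<dots> = (4 * (K + 1) / \<theta> + 1) * exp (real n * ?r)"
      using \<theta> q by (simp add: powr_def exp_add[symmetric] algebra_simps flip: exp_add)
    finally show ?thesis .
  qed
  have "?f \<longlonglongrightarrow> 0"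
    by (rule exp_decay_tendsto_0[where r = ?r and c = "4 * (K + 1) / \<theta> + 1"])
      (use bound \<delta>(1) indicator_bexp_nonneg[OF p'] in \<open>auto intro: eventually_sequentiallyI[of 1]\<close>)
  then show ?thesis using \<delta>(2) \<theta>(2) by blast
qed

text \<open>For supports of size up to \<open>(1/2 - \<eta>) n\<close> there are \<open>2 \<eta> n\<close> more rows than columns; the resulting
  factor \<open>\<theta>\<close> to the power \<open>2 \<eta> n\<close> beats the exponential entropy of the support and of the grid.\<close>

lemma nonconcentrated_dense:
  assumes p: "0 < p" "p < 1" and K: "K \<ge> 0" and \<eta>: "0 < \<eta>" "\<eta> < 1 / 2" and \<tau>: "\<tau> > 0" and M: "M \<ge> 0"
  shows "\<exists>c>0. (\<lambda>n. bexp p (vertex_pairs n)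
      (indicator {E. op_bound p n E K \<and> \<not> nonconcentrated n E (1 / 2 - \<eta>) (M / sqrt (real n)) \<tau> c}) :: real) \<longlonglongrightarrow> 0"
proof -
  have p': "0 \<le> p" "p \<le> 1" using p by auto
  have pp: "p * (1 - p) > 0" using p by simp
  \<comment> \<open>The small-ball scale is taken equal to the lattice error \<sigma> = (K + 2)
    \<theta>. The main term is then at most (D - 1) \<theta>, and the added 1 makes room for the
    fourth-order error.\<close>
  define D where "D = (K + 2) * sqrt (8 / (p * (1 - p))) / \<tau> + 1"
  have D: "D > 0" unfolding D_def using K pp \<tau> by (intro add_nonneg_pos divide_nonneg_nonneg mult_nonneg_nonneg) auto
  define \<alpha> where "\<alpha> = 1 / 2 - \<eta>"
  have \<alpha>: "0 < \<alpha>" "\<alpha> \<le> 1 / 2" using \<eta> by (auto simp: \<alpha>_def)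
  \<comment> \<open>The exponential rate is B + 2 \<eta> ln \<theta>, where 2 \<eta> is the excess
    of (1 - \<alpha>) over \<alpha>. The condition on ln \<theta> below makes it at most -1.\<close>
  define B where "B = 1 + \<alpha> * ln 27 + (1 - \<alpha>) * (1 + ln D)"
  have "eventually (\<lambda>\<theta>::real. ln \<theta> \<le> - (B + 1) / (2 * \<eta>)) (at_right 0)"
    using ln_at_0 unfolding filterlim_at_bot by blast
  moreover have "eventually (\<lambda>\<theta>::real. \<theta> \<in> {0<..<min 1 (min (\<tau> / 2) (1 / (exp 1 * D)))}) (at_right 0)"
    using D \<tau> by (intro eventually_at_right_real) auto
  ultimately have "eventually (\<lambda>\<theta>::real. ln \<theta> \<le> - (B + 1) / (2 * \<eta>) \<and> \<theta> \<in> {0<..<min 1 (min (\<tau> / 2) (1 / (exp 1 * D)))}) (at_right 0)"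
    by (rule eventually_conj)
  then obtain \<theta> where \<theta>: "ln \<theta> \<le> - (B + 1) / (2 * \<eta>)" "0 < \<theta>" "\<theta> < 1" "\<theta> < \<tau> / 2" "\<theta> < 1 / (exp 1 * D)"
    using eventually_happens'[OF trivial_limit_at_right_real] by fastforce
  define \<sigma> where "\<sigma> = (K + 2) * \<theta>"
  have \<sigma>: "\<sigma> > 0" using K \<theta> by (simp add: \<sigma>_def)
  define q where "q = exp (\<sigma>\<^sup>2 / \<sigma>\<^sup>2) * (D * \<theta>)"
  have q': "q = exp 1 * (D * \<theta>)" using \<sigma> by (simp add: q_def)
  have q1: "q < 1" using \<theta>(5) D unfolding q' by (simp add: pos_less_divide_eq mult_ac)
  have q0: "q > 0" using D \<theta> by (simp add: q')
  define r where "r = 1 + \<alpha> * ln (27 / \<theta>) + (1 - \<alpha>) * ln q"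
  have r: "r < 0"
  proof -
    have "r = B + (2 * \<eta>) * ln \<theta>"
      unfolding r_def q' B_def using \<theta> D by (simp add: ln_div ln_mult \<alpha>_def algebra_simps) (simp add: field_simps)
    moreover have "(2 * \<eta>) * ln \<theta> \<le> (2 * \<eta>) * (- (B + 1) / (2 * \<eta>))"
      using \<theta>(1) \<eta> by (intro mult_left_mono) auto
    moreover have "(2 * \<eta>) * (- (B + 1) / (2 * \<eta>)) = - (B + 1)" using \<eta> by simp
    ultimately show ?thesis by linarith
  qed
  let ?m = "\<lambda>n. M / sqrt (real n)"
  let ?f = "\<lambda>n. bexp p (vertex_pairs n) (indicator {E. op_bound p n E K \<and> \<not> nonconcentrated n E \<alpha> (?m n) \<tau> \<theta>}) :: real"
  have main: "1 / sqrt (1 + p * (1 - p) * (\<tau> / 2)\<^sup>2 / (2 * \<sigma>\<^sup>2)) \<le> (D - 1) * \<theta>"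
  proof -
    let ?x = "p * (1 - p) * (\<tau> / 2)\<^sup>2 / (2 * \<sigma>\<^sup>2)"
    have xeq: "?x = p * (1 - p) * \<tau>\<^sup>2 / (8 * \<sigma>\<^sup>2)" by (simp add: power_divide)
    have x: "?x > 0" using pp \<tau> \<sigma> by simp
    have "1 / sqrt (1 + ?x) \<le> 1 / sqrt ?x" using x by (intro divide_left_mono) auto
    also have "\<dots> = sqrt (8 * \<sigma>\<^sup>2 / (p * (1 - p) * \<tau>\<^sup>2))"
      unfolding xeq real_sqrt_divide by simp
    also have "\<dots> = sqrt (8 / (p * (1 - p)) * (\<sigma> / \<tau>)\<^sup>2)" by (simp add: power_divide)
    also have "\<dots> = sqrt (8 / (p * (1 - p))) * (\<sigma> / \<tau>)"
      unfolding real_sqrt_mult using \<sigma> \<tau> by simp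
    finally show ?thesis by (simp add: D_def \<sigma>_def mult_ac)
  qed
  \<comment> \<open>The truncation level shrinks like 1 / sqrt n while \<sigma> stays fixed, so the
    fourth-order error is eventually below \<theta>.\<close>
  have "(\<lambda>n. 3 * (M / sqrt (real n) / \<sigma>) ^ 4) \<longlonglongrightarrow> 3 * (0 / \<sigma>) ^ 4"
  proof (intro tendsto_intros)
    show "(\<lambda>n. M / sqrt (real n)) \<longlonglongrightarrow> 0" by real_asymp
  qed (use \<sigma> in auto)
  then have "eventually (\<lambda>n. 3 * (?m n / \<sigma>) ^ 4 < \<theta>) sequentially"
    by (rule order_tendstoD) (use \<theta> in simp)
  then have "eventually (\<lambda>n. ?f n \<le> (4 * (K + 1) / \<theta> + 1) * exp (real n * r)) sequentially"
    using eventually_ge_at_top[of 1]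
  proof eventually_elim
    case (elim n)
    have \<psi>: "1 / sqrt (1 + p * (1 - p) * (\<tau> / 2)\<^sup>2 / (2 * \<sigma>\<^sup>2)) + 3 * (?m n / \<sigma>) ^ 4 \<le> D * \<theta>"
      using main elim(1) by (simp add: algebra_simps)
    have qd: "q = exp (((K + 2) * \<theta>)\<^sup>2 / \<sigma>\<^sup>2) * (D * \<theta>)" unfolding q_def by (simp only: \<sigma>_def)
    have "?f n \<le> real (card {S. S \<subseteq> {..<n} \<and> real (card S) \<le> \<alpha> * real n}) *
      ((4 * (K + 1) / \<theta> + 1) * (27 / \<theta>) powr (\<alpha> * real n) * q powr ((1 - \<alpha>) * real n))"
      by (rule nonconcentrated_fails_prob[OF elim(2) p' \<alpha> _ _ K _ \<sigma> _ \<psi> qd])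
        (use \<theta> q1 M in auto)
    also have "\<dots> \<le> exp (real n * (1 + \<alpha> * ln (1 / 1))) *
      ((4 * (K + 1) / \<theta> + 1) * (27 / \<theta>) powr (\<alpha> * real n) * q powr ((1 - \<alpha>) * real n))"
      using \<theta> K by (intro mult_right_mono card_small_subsets) auto
    also have "\<dots> = (4 * (K + 1) / \<theta> + 1) * exp (real n * r)"
    proof -
      have "(27 / \<theta>) powr (\<alpha> * real n) = exp (\<alpha> * real n * ln (27 / \<theta>))"
        "q powr ((1 - \<alpha>) * real n) = exp ((1 - \<alpha>) * real n * ln q)"
        using \<theta> q0 by (simp_all add: powr_def)
      moreover have "real n * r = real n * (1 + \<alpha> * ln (1 / 1)) + \<alpha> * real n * ln (27 / \<theta>) + (1 - \<alpha>) * real n * ln q"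
        by (simp add: r_def algebra_simps)
      ultimately show ?thesis by (simp only: exp_add mult_ac)
    qed
    finally show ?case .
  qed
  then have "?f \<longlonglongrightarrow> 0" by (rule exp_decay_tendsto_0) (use r indicator_bexp_nonneg[OF p'] in auto)
  then show ?thesis using \<theta>(2) unfolding \<alpha>_def by blast
qed

text \<open>The order of choices avoids circularity: K gives C, sparse nonconcentration gives
  \<delta> and c0, these give \<tau>, dense nonconcentration at spread \<tau> and truncation 1 /
  sqrt(\<delta> n) gives c, and only then is n taken large depending on \<omega>. Failures of
  nonconcentration are counted only on the event \<open>op_bound\<close>, whose failure has its own
  term \<open>b2\<close>.\<close>

lemma gap_decrease_proportion_whp:
  fixes p \<eta> :: real
  assumes p: "0 < p" "p < 1" and \<eta>: "0 < \<eta>" "\<eta> \<le> 1 / 32"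
  shows "(\<lambda>n. measure_pmf.prob (erdos_renyi n p) {E. gap_decrease_proportion n E \<ge> 1 / 8 - 2 * \<eta>}) \<longlonglongrightarrow> 1"
proof -
  have p': "0 \<le> p" "p \<le> 1" using p by auto
  define K :: real where "K = 30"
  have K: "K \<ge> 0" by (simp add: K_def)
  define C where "C = 2 / p * (K + K\<^sup>2 / p)"
  obtain \<delta> c0 where \<delta>: "\<delta> > 0" and c0: "c0 > 0" and lim0:
    "(\<lambda>n. bexp p (vertex_pairs n) (indicator {E. op_bound p n E K \<and> \<not> nonconcentrated n E \<delta> 1 1 c0}) :: real) \<longlonglongrightarrow> 0"
    using nonconcentrated_sparse[OF p K] by blast
  let ?t = "c0\<^sup>2 / (c0\<^sup>2 + 2 * (C\<^sup>2 + K\<^sup>2))"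
  have t: "?t > 0" using c0 by (intro divide_pos_pos add_pos_nonneg) auto
  have "\<exists>\<tau>>0. 2 * \<tau>\<^sup>2 \<le> t" if "t > 0" for t :: real
    by (intro exI[of _ "sqrt (t / 2)"]) (use that in auto)
  then obtain \<tau> where \<tau>: "\<tau> > 0" "2 * \<tau>\<^sup>2 \<le> ?t" using t by blast
  have \<delta>': "1 / sqrt \<delta> \<ge> 0" using \<delta> by simp
  have \<eta>': "\<eta> < 1 / 2" using \<eta> by simp
  obtain c where c: "c > 0" and lim1: "(\<lambda>n. bexp p (vertex_pairs n)
      (indicator {E. op_bound p n E K \<and> \<not> nonconcentrated n E (1 / 2 - \<eta>) (1 / sqrt \<delta> / sqrt (real n)) \<tau> c}) :: real) \<longlonglongrightarrow> 0"
    using nonconcentrated_dense[OF p K \<eta>(1) \<eta>' \<tau>(1) \<delta>'] by blast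
  define \<omega> where "\<omega> = (C + 4 * (1 + C) / p) * (1 / sqrt \<eta>)"
  let ?V = vertex_pairs
  define b0 where "b0 n = (bexp p (?V n) (indicator {E. op_bound p n E K \<and> \<not> nonconcentrated n E \<delta> 1 1 c0}) :: real)" for n
  define b1 where "b1 n = (bexp p (?V n)
      (indicator {E. op_bound p n E K \<and> \<not> nonconcentrated n E (1 / 2 - \<eta>) (1 / sqrt \<delta> / sqrt (real n)) \<tau> c}) :: real)" for n
  define b2 where "b2 n = (bexp p (?V n) (indicator {E. \<not> op_bound p n E K}) :: real)" for n
  define b3 where "b3 n = (bexp p (?V n) (indicator {E. \<exists>i<n. deg n E i < real n * p / 2}) :: real)" for n
  have lim2: "b2 \<longlonglongrightarrow> 0"
    unfolding b2_def
    by (rule exp_decay_tendsto_0[where c = 1 and r = "- 1"])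
      (use op_bound_fails_prob[OF _ p'] indicator_bexp_nonneg[OF p'] in \<open>auto simp: K_def intro: eventually_sequentiallyI[of 1]\<close>)
  have lim3: "b3 \<longlonglongrightarrow> 0"
  proof (rule tendsto_sandwich[OF _ _ tendsto_const])
    show "eventually (\<lambda>n. 0 \<le> b3 n) sequentially" by (intro always_eventually allI) (simp only: b3_def indicator_bexp_nonneg[OF p'])
    show "eventually (\<lambda>n. b3 n \<le> real n * exp (- (real n * p\<^sup>2 / 8))) sequentially"
      using small_degree_prob[OF _ p(1) p'(2)] by (auto simp: b3_def intro: eventually_sequentiallyI[of 4])
    have "p\<^sup>2 > 0" using p by simp
    then show "(\<lambda>n. real n * exp (- (real n * p\<^sup>2 / 8))) \<longlonglongrightarrow> 0" by real_asymp
  qed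
  have "eventually (\<lambda>n. 1 - (b0 n + b1 n + b2 n + b3 n) \<le>
      measure_pmf.prob (erdos_renyi n p) {E. gap_decrease_proportion n E \<ge> 1 / 8 - 2 * \<eta>}) sequentially"
  proof -
    have top: "filterlim (\<lambda>n. a * real n) at_top sequentially" if "a > 0" for a :: real
      using that by real_asymp
    have tops: "filterlim (\<lambda>n. a * sqrt (real n)) at_top sequentially" if "a > 0" for a :: real
      using that by real_asymp
    have "eventually (\<lambda>n. \<omega>\<^sup>2 \<le> \<tau>\<^sup>2 * real n) sequentially"
      using top[of "\<tau>\<^sup>2"] \<tau> by (simp add: filterlim_at_top)
    moreover have "eventually (\<lambda>n. 2 * (C\<^sup>2 + K\<^sup>2) * \<omega>\<^sup>2 < c\<^sup>2 * real n) sequentially"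
      using top[of "c\<^sup>2"] c by (simp add: filterlim_at_top_dense)
    moreover have "eventually (\<lambda>n. 3 * K + 2 \<le> (1 - p) * \<eta> * sqrt (real n)) sequentially"
      using tops[of "(1 - p) * \<eta>"] p \<eta> by (simp add: filterlim_at_top)
    ultimately show ?thesis using eventually_ge_at_top[of 2]
    proof eventually_elim
      case (elim n)
      let ?A = "{E. gap_decrease_proportion n E \<ge> 1 / 8 - 2 * \<eta>}"
      let ?B0 = "{E. op_bound p n E K \<and> \<not> nonconcentrated n E \<delta> 1 1 c0}"
      let ?B1 = "{E. op_bound p n E K \<and> \<not> nonconcentrated n E (1 / 2 - \<eta>) (1 / sqrt \<delta> / sqrt (real n)) \<tau> c}"
      let ?B2 = "{E. \<not> op_bound p n E K}"
      let ?B3 = "{E. \<exists>i<n. deg n E i < real n * p / 2}"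
      have "1 = bexp p (?V n) (\<lambda>_. 1 :: real)" by (simp add: bexp_const)
      \<comment> \<open>The union bound as a pointwise inequality between indicators: every edge set
        is good or lies in one of the four exceptional events.\<close>
      also have "\<dots> \<le> bexp p (?V n) (\<lambda>E. indicator ?A E + (indicator ?B0 E + (indicator ?B1 E + (indicator ?B2 E + indicator ?B3 E))))"
      proof (rule bexp_mono[OF p'])
        fix E assume E: "E \<subseteq> ?V n"
        show "(1 :: real) \<le> indicator ?A E + (indicator ?B0 E + (indicator ?B1 E + (indicator ?B2 E + indicator ?B3 E)))"
        proof (cases "E \<in> ?B0 \<union> ?B1 \<union> ?B2 \<union> ?B3")
          case True
          then show ?thesis by (auto simp: indicator_def)
        next
          case False
          then have W: "op_bound p n E K" and nc0: "nonconcentrated n E \<delta> 1 1 c0"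
            and nc: "nonconcentrated n E (1 / 2 - \<eta>) (1 / sqrt \<delta> / sqrt (real n)) \<tau> c"
            and d': "\<not> (\<exists>i<n. deg n E i < real n * p / 2)" by blast+
          have d: "deg n E i \<ge> real n * p / 2" if "i < n" for i using d' that not_less by blast
          have "1 / 8 - 2 * \<eta> \<le> gap_decrease_proportion n E"
            by (rule gap_decrease_proportion_lower_bound[OF elim(4) E p \<eta> K \<delta> c0 W d C_def \<tau> nc0 nc _ elim(1-3)])
              (simp_all add: \<omega>_def)
          then show ?thesis by (simp add: indicator_def)
        qed
      qed
      also have "\<dots> = measure_pmf.prob (erdos_renyi n p) ?A + (b0 n + (b1 n + (b2 n + b3 n)))"
        unfolding bexp_add prob_erdos_renyi[OF p'] b0_def b1_def b2_def b3_def by simp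
      finally show ?case by simp
    qed
  qed
  moreover have "eventually (\<lambda>n. measure_pmf.prob (erdos_renyi n p) {E. gap_decrease_proportion n E \<ge> 1 / 8 - 2 * \<eta>} \<le> 1) sequentially"
    by simp
  moreover have "(\<lambda>n. 1 - (b0 n + b1 n + b2 n + b3 n)) \<longlonglongrightarrow> 1 - (0 + 0 + 0 + 0)"
    by (intro tendsto_intros lim2 lim3 lim0[folded b0_def] lim1[folded b1_def])
  then have "(\<lambda>n. 1 - (b0 n + b1 n + b2 n + b3 n)) \<longlonglongrightarrow> 1" by simp
  ultimately show ?thesis by (rule tendsto_sandwich[OF _ _ _ tendsto_const])
qed

theorem theorem1:
  fixes p :: real
  assumes "0 < p" and "p < 1"
  shows "(\<exists>c>0. (\<lambda>n. measure_pmf.prob (erdos_renyi n p) {E. gap_decrease_proportion n E \<ge> c}) \<longlonglongrightarrow> 1) \<and>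
         (\<forall>\<eta>>0. (\<lambda>n. measure_pmf.prob (erdos_renyi n p) {E. gap_decrease_proportion n E \<ge> 1 / 8 - \<eta>}) \<longlonglongrightarrow> 1)"
proof
  \<comment> \<open>The probability grows as the threshold falls, so the bound for small \<eta> also
    covers every larger \<eta>, including thresholds that are not positive.\<close>
  have mono: "(\<lambda>n. measure_pmf.prob (erdos_renyi n p) {E. gap_decrease_proportion n E \<ge> c}) \<longlonglongrightarrow> 1"
    if "0 < \<eta>" "\<eta> \<le> 1 / 32" "c \<le> 1 / 8 - 2 * \<eta>" for c \<eta>
  proof (rule tendsto_sandwich[OF _ _ gap_decrease_proportion_whp[OF assms that(1,2)] tendsto_const])
    show "eventually (\<lambda>n. measure_pmf.prob (erdos_renyi n p) {E. gap_decrease_proportion n E \<ge> 1 / 8 - 2 * \<eta>}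
        \<le> measure_pmf.prob (erdos_renyi n p) {E. gap_decrease_proportion n E \<ge> c}) sequentially"
      by (intro always_eventually allI measure_pmf.finite_measure_mono) (use that in auto)
  qed simp
  show "\<exists>c>0. (\<lambda>n. measure_pmf.prob (erdos_renyi n p) {E. gap_decrease_proportion n E \<ge> c}) \<longlonglongrightarrow> 1"
    using mono[of "1 / 32" "1 / 16"] by (intro exI[of _ "1 / 16"]) simp
  show "\<forall>\<eta>>0. (\<lambda>n. measure_pmf.prob (erdos_renyi n p) {E. gap_decrease_proportion n E \<ge> 1 / 8 - \<eta>}) \<longlonglongrightarrow> 1"
  proof (intro allI impI)
    fix \<eta> :: real assume "\<eta> > 0"
    then show "(\<lambda>n. measure_pmf.prob (erdos_renyi n p) {E. gap_decrease_proportion n E \<ge> 1 / 8 - \<eta>}) \<longlonglongrightarrow> 1"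
      by (intro mono[of "min (\<eta> / 2) (1 / 32)"]) auto
  qed
qed

end
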